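(* Let $\alpha_1,\alpha_2,\alpha_3>0$ with $\alpha_1+\alpha_2+\alpha_3=\pi$. For every $0<c\le2$, the square grid circle pattern $z^c$, and also the square grid circle pattern $\mathrm{Log}$, are immersions.
   Context: Let $Q=\{(k,l,m)\in\mathbb Z^3:k\ge0,l\ge0,m\le0\}$ and $q(z_1,z_2,z_3,z_4)=\frac{(z_1-z_2)(z_3-z_4)}{(z_2-z_3)(z_4-z_1)}$. For $0<c<2$ let $z:Q\to\mathbb C$ be the unique solution of the cross-ratio equations $q(z_{k,l,m},z_{k,l+1,m},z_{k-1,l+1,m},z_{k-1,l,m})=e^{-2i\alpha_1}$, $q(z_{k,l,m},z_{k,l,m-1},z_{k,l+1,m-1},z_{k,l+1,m})=e^{-2i\alpha_2}$, $q(z_{k,l,m},z_{k+1,l,m},z_{k+1,l,m-1},z_{k,l,m-1})=e^{-2i\alpha_3}$ together with the constraint $c\,z_{k,l,m}=2k\frac{(z_{k+1,l,m}-z_{k,l,m})(z_{k,l,m}-z_{k-1,l,m})}{z_{k+1,l,m}-z_{k-1,l,m}}+2l\frac{(z_{k,l+1,m}-z_{k,l,m})(z_{k,l,m}-z_{k,l-1,m})}{z_{k,l+1,m}-z_{k,l-1,m}}+2m\frac{(z_{k,l,m+1}-z_{k,l,m})(z_{k,l,m}-z_{k,l,m-1})}{z_{k,l,m+1}-z_{k,l,m-1}}$ (terms with vanishing coefficient omitted) and initial data $z_{1,0,0}=1$, $z_{0,1,0}=e^{ic(\alpha_2+\alpha_3)}$, $z_{0,0,-1}=e^{ic\alpha_3}$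 (the hexagonal $Z^c$ extended to all of $Q$). For $c=2$, $z$ is the limit as $c\to2^-$ of $\frac{2-c}{c}$ times this solution (the hexagonal $Z^2$ extended to $Q$ by the cross-ratio equations), and for $\mathrm{Log}$, $z$ is the map on $Q$ determined by the cross-ratio equations from the hexagonal $\mathrm{Log}$ pattern (the dual of $Z^2$, whose radius function is the reciprocal of that of $Z^2$). The square grid pattern is the restriction $w_{k,m}=z_{k,0,m}$, $k\ge0$, $m\le0$: circles are centered at $w_{k,m}$ with $k+m$ even and pass through the four neighbouring points $w_{k\pm1,m},w_{k,m\pm1}$; neighbouring circles intersect at angles $\alpha_3$ or $\pi-\alpha_3$. It is an immersion if the interiors of the images of any two edge-adjacent elementary quadrilaterals $(w_{k,m},w_{k+1,m},w_{k+1,m-1},w_{k,m-1})$ are disjoint. *)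

theory Defs
  imports "HOL-Complex_Analysis.Complex_Analysis"
begin

type_synonym pt = "int \<times> int \<times> int"

definition inQ :: "pt \<Rightarrow> bool" where
  "inQ p = (case p of (k, l, m) \<Rightarrow> 0 \<le> k \<and> 0 \<le> l \<and> m \<le> 0)"

definition crossratio :: "complex \<Rightarrow> complex \<Rightarrow> complex \<Rightarrow> complex \<Rightarrow> complex" where
  "crossratio z1 z2 z3 z4 = ((z1 - z2) * (z3 - z4)) / ((z2 - z3) * (z4 - z1))"

definition crossratio_eqs :: "real \<Rightarrow> real \<Rightarrow> real \<Rightarrow> (pt \<Rightarrow> complex) \<Rightarrow> bool" where
  "crossratio_eqs a1 a2 a3 z \<longleftrightarrow>
     (\<forall>k l m. 1 \<le> k \<and> 0 \<le> l \<and> m \<le> 0 \<longrightarrow>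
        crossratio (z (k,l,m)) (z (k,l+1,m)) (z (k-1,l+1,m)) (z (k-1,l,m))
          = exp (- 2 * \<i> * of_real a1)) \<and>
     (\<forall>k l m. 0 \<le> k \<and> 0 \<le> l \<and> m \<le> 0 \<longrightarrow>
        crossratio (z (k,l,m)) (z (k,l,m-1)) (z (k,l+1,m-1)) (z (k,l+1,m))
          = exp (- 2 * \<i> * of_real a2)) \<and>
     (\<forall>k l m. 0 \<le> k \<and> 0 \<le> l \<and> m \<le> 0 \<longrightarrow>
        crossratio (z (k,l,m)) (z (k+1,l,m)) (z (k+1,l,m-1)) (z (k,l,m-1))
          = exp (- 2 * \<i> * of_real a3))"

text \<open>The constraint defining Z^c (terms with vanishing coefficient are zero anyway;
  the denominators of the terms with non-vanishing coefficient are required to be nonzero,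
  as needed for the constraint to make sense).\<close>
definition Zc_constraint :: "real \<Rightarrow> (pt \<Rightarrow> complex) \<Rightarrow> bool" where
  "Zc_constraint c z \<longleftrightarrow>
     (\<forall>k l m. inQ (k,l,m) \<longrightarrow>
        (k \<noteq> 0 \<longrightarrow> z (k+1,l,m) \<noteq> z (k-1,l,m)) \<and>
        (l \<noteq> 0 \<longrightarrow> z (k,l+1,m) \<noteq> z (k,l-1,m)) \<and>
        (m \<noteq> 0 \<longrightarrow> z (k,l,m+1) \<noteq> z (k,l,m-1)) \<and>
        of_real c * z (k,l,m) =
          2 * of_int k * (z (k+1,l,m) - z (k,l,m)) * (z (k,l,m) - z (k-1,l,m))
              / (z (k+1,l,m) - z (k-1,l,m))
        + 2 * of_int l * (z (k,l+1,m) - z (k,l,m)) * (z (k,l,m) - z (k,l-1,m))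
              / (z (k,l+1,m) - z (k,l-1,m))
        + 2 * of_int m * (z (k,l,m+1) - z (k,l,m)) * (z (k,l,m) - z (k,l,m-1))
              / (z (k,l,m+1) - z (k,l,m-1)))"

text \<open>z is (a, in fact the unique) solution defining the extended hexagonal Z^c on Q, 0 < c < 2.
  Only the values on Q matter.\<close>
definition is_Zc :: "real \<Rightarrow> real \<Rightarrow> real \<Rightarrow> real \<Rightarrow> (pt \<Rightarrow> complex) \<Rightarrow> bool" where
  "is_Zc a1 a2 a3 c z \<longleftrightarrow>
     crossratio_eqs a1 a2 a3 z \<and> Zc_constraint c z \<and>
     z (1,0,0) = 1 \<and>
     z (0,1,0) = exp (\<i> * of_real (c * (a2 + a3))) \<and>
     z (0,0,-1) = exp (\<i> * of_real (c * a3))"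

definition is_Z2 :: "real \<Rightarrow> real \<Rightarrow> real \<Rightarrow> (pt \<Rightarrow> complex) \<Rightarrow> bool" where
  "is_Z2 a1 a2 a3 z \<longleftrightarrow>
     (\<exists>Zf :: real \<Rightarrow> pt \<Rightarrow> complex.
        (\<forall>c. 0 < c \<and> c < 2 \<longrightarrow> is_Zc a1 a2 a3 c (Zf c)) \<and>
        (\<forall>p. inQ p \<longrightarrow>
           ((\<lambda>c. of_real ((2 - c) / c) * Zf c p) \<longlongrightarrow> z p) (at_left 2)))"

definition edge_label :: "real \<Rightarrow> real \<Rightarrow> real \<Rightarrow> pt \<Rightarrow> complex" where
  "edge_label a1 a2 a3 e =
     (if e = (1,0,0) then 1
      else if e = (0,1,0) then exp (- 2 * \<i> * of_real a1)
      else exp (2 * \<i> * of_real a3))"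

text \<open>Log on Q: the dual of Z^2 (radii reciprocal to those of Z^2), i.e.
  w(p+e) - w(p) = a_e / (z(p+e) - z(p)) for every edge of Q.
  The vertex (0,0,0) is mapped to infinity (Z^2 degenerates there), so the value of w at the
  origin is irrelevant and edges at the origin are excluded.\<close>
definition is_Log :: "real \<Rightarrow> real \<Rightarrow> real \<Rightarrow> (pt \<Rightarrow> complex) \<Rightarrow> bool" where
  "is_Log a1 a2 a3 w \<longleftrightarrow>
     (\<exists>z. is_Z2 a1 a2 a3 z \<and>
        (\<forall>p e. inQ p \<and> e \<in> {(1,0,0), (0,1,0), (0,0,1)} \<and> inQ (p + e) \<and>
               p \<noteq> (0,0,0) \<and> p + e \<noteq> (0,0,0) \<longrightarrow>
           w (p + e) - w p = edge_label a1 a2 a3 e / (z (p + e) - z p)))"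

definition grid :: "(pt \<Rightarrow> complex) \<Rightarrow> int \<Rightarrow> int \<Rightarrow> complex" where
  "grid z k m = z (k, 0, m)"

text \<open>Interior of the image of a (possibly non-convex or degenerate) quadrilateral:
  the points off the boundary polygon with nonzero winding number.\<close>
definition quad_interior :: "complex \<Rightarrow> complex \<Rightarrow> complex \<Rightarrow> complex \<Rightarrow> complex set" where
  "quad_interior a b c d =
     (let g = linepath a b +++ linepath b c +++ linepath c d +++ linepath d a
      in {p. p \<notin> path_image g \<and> winding_number g p \<noteq> 0})"

text \<open>Interior of the image of a quadrilateral (infinity, a, b, d) whose first vertex lies at
  infinity in direction v: the edges at infinity are the rays a + t v, d + t v (t >= 0);
  truncate them at parameter T and take the limit T to infinity.\<close>
definition quad_interior_inf :: "complex \<Rightarrow> complex \<Rightarrow> complex \<Rightarrow> complex \<Rightarrow> complex set" where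
  "quad_interior_inf v a b d =
     {p. \<forall>\<^sub>F T in at_top.
          (let g = linepath (a + of_real T * v) a +++ linepath a b +++ linepath b d
                   +++ linepath d (d + of_real T * v) +++ linepath (d + of_real T * v) (a + of_real T * v)
           in p \<notin> path_image g \<and> winding_number g p \<noteq> 0)}"

definition grid_quad :: "(int \<Rightarrow> int \<Rightarrow> complex) \<Rightarrow> int \<Rightarrow> int \<Rightarrow> complex set" where
  "grid_quad w k m = quad_interior (w k m) (w (k+1) m) (w (k+1) (m-1)) (w k (m-1))"

definition immersion_by :: "(int \<Rightarrow> int \<Rightarrow> complex set) \<Rightarrow> bool" where
  "immersion_by Quad \<longleftrightarrow>
     (\<forall>k m. 0 \<le> k \<and> m \<le> 0 \<longrightarrow>
        Quad k m \<inter> Quad (k+1) m = {} \<and> Quad k m \<inter> Quad k (m-1) = {})"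

definition sq_immersion :: "(int \<Rightarrow> int \<Rightarrow> complex) \<Rightarrow> bool" where
  "sq_immersion w \<longleftrightarrow> immersion_by (grid_quad w)"

text \<open>For Log, the quadrilateral at (0,0) has its vertex w_{0,0} at infinity; the edges to it
  point in direction -1 (limit direction of the dual edges).\<close>
definition sq_immersion_Log :: "(int \<Rightarrow> int \<Rightarrow> complex) \<Rightarrow> bool" where
  "sq_immersion_Log w \<longleftrightarrow>
     immersion_by (\<lambda>k m. if k = 0 \<and> m = 0
                          then quad_interior_inf (-1) (w 1 0) (w 1 (-1)) (w 0 (-1))
                          else grid_quad w k m)"

end

theory Submission
  imports Defs
begin

text \<open>
  Write \<open>f n m = z (n, 0, -m)\<close>.  The quadrilaterals of the pattern are kites, and at every vertex \<open>A\<close> of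
  even parity each kite lies in an open sector with apex \<open>A\<close>.  Half the opening angles of two adjacent
  kites are smaller than \<open>\<alpha>\<close> and \<open>\<pi> - \<alpha>\<close>, so the two sectors are disjoint.  This needs only that the
  (a priori signed) radii are positive.

  The constraint gives an equation between the four radii around a vertex of odd parity, by which
  positivity spreads from the diagonal.  On the diagonal, the product of Lax matrices applied to
  \<open>(1, -\<lambda>\<^sup>s)\<close>, \<open>s = c/2\<close>, vanishes to order \<open>n\<close> at the two points \<open>1\<close> and \<open>exp (-2 i \<alpha>)\<close>; its entries are the
  two-point Pade approximants of \<open>\<lambda>\<^sup>s\<close>.  Integrating along the two sides of the cut of \<open>\<lambda>\<^sup>s\<close> shows that
  the upper left entry is an orthogonal polynomial for a positive weight on the negative half-axis.
  Its zeros are negative, and therefore its leading coefficient, the radius \<open>r n n\<close>, is positive.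

  \<open>Z\<^sup>2\<close> is treated by passing to the limit, and \<open>Log\<close> by inverting the radii of \<open>Z\<^sup>2\<close>.
\<close>

section \<open>Edges, radii and the radius equation\<close>

text \<open>The diagonal needs a global argument: the propagation below it consumes the diagonal
  radii, since the vertex next to the diagonal has a diagonal radius as its upper neighbour, and
  returns none. The initial vector is forced by the initial data. At \<lambda> = 1 it is killed by
  the Lax matrix of the first horizontal edge, which is 1, and at \<lambda> = exp (-2 i \<alpha>) by
  that of the first vertical edge, which is exp (i c \<alpha>); the later matrices keep raising the
  order. The weight has a simple source. After multiplication by \<lambda>^(1-s) the entry carrying
  \<lambda>^s gets the single-valued factor \<lambda>, so it has no jump across the cut, and only
  the upper left entry times the jump of \<lambda>^(1-s) remains. The logarithm z of \<lambda>
  serves as variable, so the cut becomes the pair of lines Im z = \<pi> and Im z = -\<pi>, and the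
  integral over the cut becomes a statement about a primitive.\<close>

lemma quad_transport:
  fixes q d p1 m1 p2 m2 :: complex
  assumes "q \<noteq> 1" "q \<noteq> 0" "d \<noteq> 0"
    and up: "q * d * (d + p2 - p1) = p2 * p1"
    and down: "q * d * (m1 + d - m2) = m2 * m1"
  shows "m2 * (d + p2) * (p1 + m1) = p1 * (d + m1) * (p2 + m2)"
proof -
  \<comment> \<open>Each quadrilateral relation is a Moebius map, \<open>p1\<close> to
    \<open>p2\<close> above the edge and \<open>m1\<close> to \<open>m2\<close> below it.
    \<open>p1 - q*d\<close> and \<open>m1 + q*d\<close> are the denominators; their vanishing would
    force \<open>q = 1\<close>.\<close>
  have "p1 \<noteq> q * d"
  proof
    assume "p1 = q * d"
    then have "q * d * d * (1 - q) = 0" using up by algebra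
    with assms show False by simp
  qed
  moreover have "m1 \<noteq> - (q * d)"
  proof
    assume "m1 = - (q * d)"
    then have "q * d * d * (1 - q) = 0" using down by algebra
    with assms show False by simp
  qed
  moreover have "(p1 - q*d) * (m1 + q*d) *
      (m2 * (d + p2) * (p1 + m1) - p1 * (d + m1) * (p2 + m2)) = 0"
    using up down by algebra
  ultimately show ?thesis by (auto simp: add_eq_0_iff2)
qed

text \<open>The difference of the constraints at the two ends of the edge \<open>d\<close> is
  divisible by \<open>d\<close>, and the quotient is a linear relation between the fluxes at the two
  ends. The last hypothesis carries the transverse term across the edge.\<close>

lemma corner_sum:
  fixes d :: complex
  assumes "d \<noteq> 0"
    and "s * f = P * d * dm + Q * ep * em"
    and "s * (f + d) = P' * d' * d + Q' * ep' * em'"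
    and "P * (d + dm) = N" "P' * (d' + d) = N + 1"
    and "Q * (ep + em) = M" "Q' * (ep' + em') = M"
    and "Q' * em' * (d + ep') = Q * ep * (d + em)"
  shows "(P' * d' + Q' * ep') + (P * d + Q * ep) = N + M + s"
proof -
  have "d * ((P' * d' + Q' * ep') + (P * d + Q * ep) - (N + M + s)) = 0"
    using assms(2-) by algebra
  with assms(1) show ?thesis by simp
qed

text \<open>On the boundary row \<open>M = 0\<close> there is no quadrilateral on the other side,
  and the weight 0 makes both sides vanish; hence the conditional hypotheses.\<close>

lemma transport_weighted:
  fixes q d p1 m1 p2 m2 M :: complex
  assumes "q \<noteq> 1" "q \<noteq> 0" "d \<noteq> 0"
    and "q * d * (d + p2 - p1) = p2 * p1"
    and "M \<noteq> 0 \<Longrightarrow> q * d * (m1 + d - m2) = m2 * m1"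
    and "M \<noteq> 0 \<Longrightarrow> p1 + m1 \<noteq> 0" "M \<noteq> 0 \<Longrightarrow> p2 + m2 \<noteq> 0"
  shows "M / (p2 + m2) * m2 * (d + p2) = M / (p1 + m1) * p1 * (d + m1)"
proof (cases "M = 0")
  case False
  then have "m2 * (d + p2) * (p1 + m1) = p1 * (d + m1) * (p2 + m2)"
    using quad_transport assms by blast
  then have "m2 * (d + p2) / (p2 + m2) = p1 * (d + m1) / (p1 + m1)"
    using False assms(6,7) by (simp add: frac_eq_eq)
  then show ?thesis by (metis times_divide_eq_left mult.assoc mult.commute)
qed simp

section \<open>Discrete power functions on a quadrant: edges, fluxes, radii\<close>

definition hedge :: "(nat \<Rightarrow> nat \<Rightarrow> complex) \<Rightarrow> nat \<Rightarrow> nat \<Rightarrow> complex" where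
  "hedge f n m = f (Suc n) m - f n m"

definition vedge :: "(nat \<Rightarrow> nat \<Rightarrow> complex) \<Rightarrow> nat \<Rightarrow> nat \<Rightarrow> complex" where
  "vedge f n m = f n (Suc m) - f n m"

text \<open>The coordinate \<open>m\<close> is reversed, so that both indices are natural numbers.
  At \<open>n = 0\<close> or \<open>m = 0\<close> the truncated predecessor refers to the outgoing
  edge of the vertex itself, and the factor 0 removes the term.\<close>

locale discrete_power =
  fixes a c :: real and f :: "nat \<Rightarrow> nat \<Rightarrow> complex"
  assumes a: "0 < a" "a < pi" and c: "0 < c" "c < 2"
    and cross: "\<And>n m. crossratio (f n m) (f (Suc n) m) (f (Suc n) (Suc m)) (f n (Suc m))
                  = exp (- 2 * \<i> * of_real a)"
    and hsum_nz: "\<And>n m. n \<noteq> 0 \<Longrightarrow> hedge f n m + hedge f (n-1) m \<noteq> 0"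
    and vsum_nz: "\<And>n m. m \<noteq> 0 \<Longrightarrow> vedge f n m + vedge f n (m-1) \<noteq> 0"
    and constraint: "\<And>n m. of_real c * f n m =
        2 * of_nat n * hedge f n m * hedge f (n-1) m / (hedge f n m + hedge f (n-1) m)
      + 2 * of_nat m * vedge f n m * vedge f n (m-1) / (vedge f n m + vedge f n (m-1))"
    and f10: "f (Suc 0) 0 = 1" and f01: "f 0 (Suc 0) = cis (c * a)"
begin

abbreviation "d \<equiv> hedge f"
abbreviation "e \<equiv> vedge f"

definition b :: complex where "b = cis a"
definition s :: real where "s = c / 2"

lemma s: "0 < s" "s < 1" using c by (auto simp: s_def)

lemma b_simps [simp]: "b \<noteq> 0" "norm b = 1" "cnj b = inverse b"
  by (auto simp: b_def cis_cnj)

lemma Im_b: "Im b > 0" using a by (simp add: b_def sin_gt_zero)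

lemma b2_neq_1: "b\<^sup>2 \<noteq> 1"
  using Im_b by (auto simp: power2_eq_1_iff)

lemma f00 [simp]: "f 0 0 = 0"
  using constraint[of 0 0] c by simp

lemma edges_nz: "d n m \<noteq> 0" "d n (Suc m) \<noteq> 0" "e n m \<noteq> 0" "e (Suc n) m \<noteq> 0"
proof -
  have "crossratio (f n m) (f (Suc n) m) (f (Suc n) (Suc m)) (f n (Suc m)) \<noteq> 0"
    by (simp add: cross)
  then show "d n m \<noteq> 0" "d n (Suc m) \<noteq> 0" "e n m \<noteq> 0" "e (Suc n) m \<noteq> 0"
    by (auto simp: crossratio_def hedge_def vedge_def)
qed

lemma closure: "d n m + e (Suc n) m = e n m + d n (Suc m)"
  by (simp add: hedge_def vedge_def)

lemma quad: "b\<^sup>2 * d n m * d n (Suc m) = e n m * e (Suc n) m"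
proof -
  have "exp (- 2 * \<i> * of_real a) * b\<^sup>2 = 1"
    by (simp add: b_def cis_conv_exp flip: exp_double exp_add)
  moreover have "exp (- 2 * \<i> * of_real a) * (e n m * e (Suc n) m) = d n m * d n (Suc m)"
  proof -
    have "crossratio (f n m) (f (Suc n) m) (f (Suc n) (Suc m)) (f n (Suc m))
        = (- d n m * d n (Suc m)) / (- e (Suc n) m * e n m)"
      by (simp add: crossratio_def hedge_def vedge_def)
    also have "\<dots> * (e n m * e (Suc n) m) = d n m * d n (Suc m)"
      using edges_nz by simp
    finally show ?thesis by (simp only: cross)
  qed
  ultimately show ?thesis by (metis mult.assoc mult.commute mult_1)
qed

text \<open>\<open>flux\<close> is the upper left entry, at \<open>\<lambda> = \<infinity>\<close>, of the logarithmic derivative of the Lax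
  wave function: its value alternates between the two local exponents.\<close>

definition hwt where "hwt n m = of_nat n / (d n m + d (n-1) m)"
definition vwt where "vwt n m = of_nat m / (e n m + e n (m-1))"
definition flux where "flux n m = hwt n m * d n m + vwt n m * e n m"

lemma hwt_mult: "hwt n m * (d n m + d (n-1) m) = of_nat n"
  using hsum_nz[of n m] by (cases "n = 0") (auto simp: hwt_def)

lemma vwt_mult: "vwt n m * (e n m + e n (m-1)) = of_nat m"
  using vsum_nz[of m n] by (cases "m = 0") (auto simp: vwt_def)

lemma constraint': "of_real s * f n m = hwt n m * d n m * d (n-1) m + vwt n m * e n m * e n (m-1)"
proof -
  have "2 * (of_real s * f n m) = of_real c * f n m" by (simp add: s_def)
  also have "\<dots> = 2 * (hwt n m * d n m * d (n-1) m + vwt n m * e n m * e n (m-1))"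
    unfolding constraint[of n m] hwt_def vwt_def by (simp only: distrib_left times_divide_eq_left times_divide_eq_right mult.assoc)
  finally show ?thesis by (subst (asm) mult_cancel_left) simp
qed

lemma flux_Suc_left: "flux (Suc n) m + flux n m = of_nat n + of_nat m + of_real s"
  unfolding flux_def
proof (rule corner_sum[OF edges_nz(1)[of n m] constraint' _ hwt_mult _ vwt_mult])
  show "of_real s * (f n m + d n m) = hwt (Suc n) m * d (Suc n) m * d n m
          + vwt (Suc n) m * e (Suc n) m * e (Suc n) (m-1)"
    using constraint'[of "Suc n" m] by (simp add: hedge_def)
  show "hwt (Suc n) m * (d (Suc n) m + d n m) = of_nat n + 1"
    using hwt_mult[of "Suc n" m] by simp
  show "vwt (Suc n) m * (e (Suc n) m + e (Suc n) (m-1)) = of_nat m" by (rule vwt_mult)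
  show "vwt (Suc n) m * e (Suc n) (m-1) * (d n m + e (Suc n) m)
        = vwt n m * e n m * (d n m + e n (m-1))"
    unfolding vwt_def
  proof (rule transport_weighted[of "b\<^sup>2"])
    show "b\<^sup>2 * d n m * (d n m + e (Suc n) m - e n m) = e (Suc n) m * e n m"
    proof -
      have *: "d n m + e (Suc n) m - e n m = d n (Suc m)"
        using closure[of n m] by (simp add: algebra_simps)
      show ?thesis unfolding * quad by (rule mult.commute)
    qed
    assume "of_nat m \<noteq> (0::complex)"
    then obtain k where k: "m = Suc k" by (cases m) auto
    have *: "e n (m-1) + d n m - e (Suc n) (m-1) = d n k"
      using closure[of n k] k by (simp add: algebra_simps)
    have "d n m = d n (Suc k)" "e n (m-1) = e n k" "e (Suc n) (m-1) = e (Suc n) k" using k by simp_all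
    then show "b\<^sup>2 * d n m * (e n (m-1) + d n m - e (Suc n) (m-1)) = e (Suc n) (m-1) * e n (m-1)"
      unfolding * using quad[of n k] by (metis mult.assoc mult.commute)
    show "e n m + e n (m-1) \<noteq> 0" "e (Suc n) m + e (Suc n) (m-1) \<noteq> 0"
      using vsum_nz[of m n] vsum_nz[of m "Suc n"] k by auto
  qed (use b2_neq_1 edges_nz in auto)
qed

lemma flux_Suc_right: "flux n (Suc m) + flux n m = of_nat n + of_nat m + of_real s"
proof -
  have "(vwt n (Suc m) * e n (Suc m) + hwt n (Suc m) * d n (Suc m)) + (vwt n m * e n m + hwt n m * d n m)
        = of_nat m + of_nat n + of_real s"
  proof (rule corner_sum[OF edges_nz(3)[of n m] _ _ vwt_mult _ hwt_mult])
    show "of_real s * f n m = vwt n m * e n m * e n (m-1) + hwt n m * d n m * d (n-1) m"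
      using constraint'[of n m] by simp
    show "of_real s * (f n m + e n m) = vwt n (Suc m) * e n (Suc m) * e n m
            + hwt n (Suc m) * d n (Suc m) * d (n-1) (Suc m)"
      using constraint'[of n "Suc m"] by (simp add: vedge_def)
    show "vwt n (Suc m) * (e n (Suc m) + e n m) = of_nat m + 1"
      using vwt_mult[of n "Suc m"] by simp
    show "hwt n (Suc m) * (d n (Suc m) + d (n-1) (Suc m)) = of_nat n" by (rule hwt_mult)
    show "hwt n (Suc m) * d (n-1) (Suc m) * (e n m + d n (Suc m))
          = hwt n m * d n m * (e n m + d (n-1) m)"
      unfolding hwt_def
    proof (rule transport_weighted[of "1 / b\<^sup>2"])
      show "1 / b\<^sup>2 * e n m * (e n m + d n (Suc m) - d n m) = d n (Suc m) * d n m"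
        proof -
        have *: "e n m + d n (Suc m) - d n m = e (Suc n) m"
          using closure[of n m] by (simp add: algebra_simps)
        show ?thesis unfolding * using quad[of n m] by (simp add: divide_eq_eq mult_ac)
      qed
      assume "of_nat n \<noteq> (0::complex)"
      then obtain k where k: "n = Suc k" by (cases n) auto
      have *: "d (n-1) m + e n m - d (n-1) (Suc m) = e k m"
        using closure[of k m] k by (simp add: algebra_simps)
      show "1 / b\<^sup>2 * e n m * (d (n-1) m + e n m - d (n-1) (Suc m))
                 = d (n-1) (Suc m) * d (n-1) m"
        unfolding * using quad[of k m] k by (simp add: divide_eq_eq mult_ac)
      show "d n m + d (n-1) m \<noteq> 0" "d n (Suc m) + d (n-1) (Suc m) \<noteq> 0"
        using hsum_nz[of n m] hsum_nz[of n "Suc m"] k by auto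
    qed (use b2_neq_1 edges_nz in auto)
  qed
  then show ?thesis by (simp add: flux_def algebra_simps)
qed

lemma flux_eq: "flux n m = (if even (n + m) then of_nat (n + m) / 2
                      else of_real s + (of_nat (n + m) - 1) / 2)"
proof (induction m)
  case 0
  show ?case
  proof (induction n)
    case 0 show ?case by (simp add: flux_def hwt_def vwt_def)
  next
    case (Suc n)
    have *: "flux (Suc n) 0 = of_nat n + of_real s - flux n 0"
      using flux_Suc_left[of n 0] by (simp add: algebra_simps)
    show ?case unfolding * Suc.IH by (simp add: field_simps)
  qed
next
  case (Suc m)
  have *: "flux n (Suc m) = of_nat n + of_nat m + of_real s - flux n m"
    using flux_Suc_right[of n m] by (simp add: algebra_simps)
  show ?case unfolding * Suc.IH by (simp add: field_simps)
qed

lemma cnj_unit: "norm z = 1 \<Longrightarrow> cnj z = inverse z" for z :: complex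
  using complex_norm_square[of z] by (intro inverse_unique[symmetric]) simp

text \<open>The function \<open>u\<close> factorises the edges.  At even vertices (circle centres) it is the radius, at odd
  vertices (intersection points) it is a unit complex number.  That the radii do not change sign is
  only shown at the end.\<close>

fun u :: "nat \<Rightarrow> nat \<Rightarrow> complex" where
  "u 0 0 = 1"
| "u (Suc n) 0 = d n 0 / u n 0"
| "u n (Suc m) = e n m / (b * u n m)"

declare u.simps(2,3) [simp del]

lemma u_nz [simp]: "u n m \<noteq> 0"
proof (induction m)
  case 0 show ?case by (induction n) (auto simp: edges_nz u.simps)
qed (auto simp: edges_nz u.simps)

lemma e_eq: "e n m = b * u n m * u n (Suc m)"
  by (simp add: u.simps)

lemma d_eq: "d n m = u n m * u (Suc n) m"
proof (induction m)
  case (Suc m)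
  have "b\<^sup>2 * d n m * d n (Suc m) = (b * u n m * u n (Suc m)) * (b * u (Suc n) m * u (Suc n) (Suc m))"
    unfolding quad by (simp only: e_eq)
  then have "(b\<^sup>2 * d n m) * d n (Suc m) = (b\<^sup>2 * d n m) * (u n (Suc m) * u (Suc n) (Suc m))"
    unfolding Suc.IH by (simp only: power2_eq_square mult_ac)
  then show ?case using edges_nz by simp
qed (simp add: u.simps)

text \<open>The factorisation by \<open>u\<close> absorbs the cross-ratio relation, so the closing
  of the quadrilateral is the only condition left: a discrete Hirota equation.\<close>

lemma hirota: "u (Suc n) (Suc m) * (b * u (Suc n) m - u n (Suc m))
             = u n m * (b * u n (Suc m) - u (Suc n) m)"
  using closure[of n m] by (simp add: d_eq e_eq algebra_simps)

text \<open>On an axis one of the two terms of the flux vanishes, so the known value of the flux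
  determines the ratio of consecutive edges.\<close>

lemma axis_ratio:
  assumes "x \<noteq> 0" "y \<noteq> 0" "x + y \<noteq> (0::complex)" "of_nat k * x / (x + y)
     = (if even k then of_nat k / 2 else of_real s + (of_nat k - 1) / 2)" "k \<ge> 1"
  shows "x = of_real (if even k then 1 else (real k - 1 + c) / (real k + 1 - c)) * y"
proof (cases "even k")
  case True
  then have "of_nat k * (2 * x) = of_nat k * (x + y)" using assms by (simp add: field_simps)
  then show ?thesis using \<open>k \<ge> 1\<close> True by simp
next
  case False
  have nz: "complex_of_real (real k + 1 - c) \<noteq> 0" using c \<open>k \<ge> 1\<close> by (subst of_real_eq_0_iff) auto
  have "2 * of_nat k * x = (of_real c + (of_nat k - 1)) * (x + y)"
    using assms False by (simp add: field_simps s_def)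
  then have "of_real (real k + 1 - c) * x = of_real (real k - 1 + c) * y"
    by (simp add: algebra_simps)
  then show ?thesis using nz False by (simp add: field_simps)
qed

lemma u_h_axis: "u (Suc (Suc n)) 0
   = of_real (if odd n then 1 else (real n + c) / (real n + 2 - c)) * u n 0"
proof -
  have "of_nat (Suc n) * d (Suc n) 0 / (d (Suc n) 0 + d n 0) = flux (Suc n) 0"
    by (simp add: flux_def hwt_def vwt_def)
  then have "d (Suc n) 0 = of_real (if even (Suc n) then 1 else (real (Suc n) - 1 + c) / (real (Suc n) + 1 - c)) * d n 0"
    using hsum_nz[of "Suc n" 0]
    by (intro axis_ratio) (auto simp: edges_nz flux_eq)
  then show ?thesis by (auto simp: d_eq)
qed

lemma u_v_axis: "u 0 (Suc (Suc n))
   = of_real (if odd n then 1 else (real n + c) / (real n + 2 - c)) * u 0 n"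
proof -
  have "of_nat (Suc n) * e 0 (Suc n) / (e 0 (Suc n) + e 0 n) = flux 0 (Suc n)"
    by (simp add: flux_def hwt_def vwt_def)
  then have "e 0 (Suc n) = of_real (if even (Suc n) then 1 else (real (Suc n) - 1 + c) / (real (Suc n) + 1 - c)) * e 0 n"
    using vsum_nz[of "Suc n" 0]
    by (intro axis_ratio) (auto simp: edges_nz flux_eq)
  then show ?thesis by (auto simp: e_eq)
qed

lemma u_first: "u (Suc 0) 0 = 1" "u 0 (Suc 0) = cis ((c - 1) * a)"
  by (simp_all add: u.simps hedge_def vedge_def f10 f01 b_def cis_divide algebra_simps)

text \<open>With \<open>x\<close>, \<open>y\<close> the middle corners, the Hirota equation
  multiplies \<open>u\<close> by \<open>(b * y - x) / (b * x - y)\<close> from one corner to the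
  opposite one. For unit \<open>x\<close>, \<open>y\<close> this factor equals its conjugate; for
  real \<open>x\<close>, \<open>y\<close> its numerator is \<open>- b\<close> times the conjugate of
  its denominator, so it has norm 1. Both properties spread from the axes.\<close>

lemma u_parity: "if even (n + m) then u n m \<in> \<real> else norm (u n m) = 1"
proof -
  have h: "(if even n then u n 0 \<in> \<real> else norm (u n 0) = 1) \<and>
           (if even n then u 0 n \<in> \<real> else norm (u 0 n) = 1)" for n
  proof (induction n rule: induct_nat_012)
    case (ge2 n)
    then show ?case by (auto simp: u_h_axis u_v_axis)
  qed (auto simp: u_first)
  have "n + m = k \<Longrightarrow> ?thesis" for k
  proof (induction k arbitrary: n m rule: less_induct)
    case (less k)
    show ?case
    proof (cases "n = 0 \<or> m = 0")
      case True then show ?thesis using h by auto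
    next
      case False
      then obtain i j where ij: "n = Suc i" "m = Suc j" by (meson not0_implies_Suc)
      let ?x = "u (Suc i) j" and ?y = "u i (Suc j)"
      have k: "k = Suc (Suc (i + j))" using ij less.prems by simp
      have IH0: "if even (i + j) then u i j \<in> \<real> else norm (u i j) = 1"
        by (rule less.IH[of "i+j"]) (auto simp: k)
      have IH1: "if even (Suc (i + j)) then ?x \<in> \<real> else norm ?x = 1"
        using less.IH[of "Suc (i+j)" "Suc i" j] by (simp add: k)
      have IH2: "if even (Suc (i + j)) then ?y \<in> \<real> else norm ?y = 1"
        using less.IH[of "Suc (i+j)" i "Suc j"] by (simp add: k)
      \<comment> \<open>If the denominator vanished, so would the other bracket of the Hirota
        equation, and the two linear relations together force \<open>b\<^sup>2 = 1\<close>.\<close>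
      have xy: "b * ?x - ?y \<noteq> 0"
      proof
        assume eq: "b * ?x - ?y = 0"
        then have "b * ?y - ?x = 0" using hirota[of i j] by simp
        then have "(b\<^sup>2 - 1) * ?x = 0" using eq by algebra
        then show False using b2_neq_1 by simp
      qed
      have H: "u n m = u i j * ((b * ?y - ?x) / (b * ?x - ?y))"
        using hirota[of i j] xy ij by (simp add: field_simps)
      show ?thesis
      proof (cases "even (i + j)")
        case True
        have "norm ?x = 1" "norm ?y = 1" using IH1 IH2 True by auto
        then have cn: "cnj ?x = inverse ?x" "cnj ?y = inverse ?y"
          by (auto simp: cnj_unit)
        have "cnj ((b * ?y - ?x) / (b * ?x - ?y)) = (b * ?y - ?x) / (b * ?x - ?y)"
        proof -
          have "(inverse b * inverse ?y - inverse ?x) * (b * ?x - ?y) = (b * ?y - ?x) * (inverse b * inverse ?x - inverse ?y)"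
            by (simp add: field_simps)
          moreover have "cnj (b * ?x - ?y) \<noteq> 0" using xy complex_cnj_zero_iff by blast
          ultimately show ?thesis using xy by (simp add: cn frac_eq_eq)
        qed
        then have "(b * ?y - ?x) / (b * ?x - ?y) \<in> \<real>" by (simp add: Reals_cnj_iff)
        then have "u n m \<in> \<real>" unfolding H using IH0 True by (intro Reals_mult) auto
        then show ?thesis using True ij by simp
      next
        case False
        then have "?x \<in> \<real>" "?y \<in> \<real>" using IH1 IH2 by auto
        then have "cnj ?x = ?x" "cnj ?y = ?y" by (auto simp: Reals_cnj_iff)
        then have "b * ?y - ?x = - b * cnj (b * ?x - ?y)" by (simp add: field_simps)
        then have "norm (b * ?y - ?x) = norm (b * ?x - ?y)"
          by (metis b_simps(2) complex_mod_cnj mult_1 norm_minus_cancel norm_mult)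
        then have "norm ((b * ?y - ?x) / (b * ?x - ?y)) = 1" using xy by (simp add: norm_divide)
        then have "norm (u n m) = 1" unfolding H using IH0 False by (simp only: norm_mult) simp
        then show ?thesis using False ij by simp
      qed
    qed
  qed
  then show ?thesis by blast
qed

definition r :: "nat \<Rightarrow> nat \<Rightarrow> real" where "r n m = Re (u n m)"

lemma u_even: "even (n + m) \<Longrightarrow> u n m = of_real (r n m)"
  using u_parity[of n m] by (auto simp: r_def of_real_Re)

lemma u_odd: "odd (n + m) \<Longrightarrow> norm (u n m) = 1"
  using u_parity[of n m] by auto

lemma r_nz: "even (n + m) \<Longrightarrow> r n m \<noteq> 0"
  using u_even[of n m] u_nz[of n m] by auto

text \<open>At an odd vertex every horizontal edge is the unit number \<open>u n m\<close> times a
  neighbouring radius, and every vertical edge is \<open>b * u n m\<close> times one. These factors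
  cancel in the quotients, and the value of the flux becomes a real equation.\<close>

lemma radius_eq:
  assumes "odd (n + m)"
  shows "real n * r (Suc n) m / (r (Suc n) m + r (n-1) m)
       + real m * r n (Suc m) / (r n (Suc m) + r n (m-1)) = s + (real (n + m) - 1) / 2"
    and "n \<noteq> 0 \<Longrightarrow> r (Suc n) m + r (n-1) m \<noteq> 0"
    and "m \<noteq> 0 \<Longrightarrow> r n (Suc m) + r n (m-1) \<noteq> 0"
proof -
  have hwt: "hwt n m * d n m = of_real (real n * r (Suc n) m / (r (Suc n) m + r (n-1) m))"
  proof (cases n)
    case (Suc k)
    have "u (Suc (Suc k)) m = of_real (r (Suc n) m)" "u k m = of_real (r (n-1) m)"
      using assms u_even[of "Suc n" m] u_even[of k m] Suc by auto
    then have "d n m = u n m * of_real (r (Suc n) m)" "d (n-1) m = u n m * of_real (r (n-1) m)"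
      by (auto simp: Suc d_eq)
    then show ?thesis by (simp add: hwt_def flip: distrib_left)
  qed (simp add: hwt_def)
  have vwt: "vwt n m * e n m = of_real (real m * r n (Suc m) / (r n (Suc m) + r n (m-1)))"
  proof (cases m)
    case (Suc k)
    have "u n (Suc (Suc k)) = of_real (r n (Suc m))" "u n k = of_real (r n (m-1))"
      using assms u_even[of n "Suc m"] u_even[of n k] Suc by auto
    then have "e n m = b * u n m * of_real (r n (Suc m))" "e n (m-1) = b * u n m * of_real (r n (m-1))"
      by (auto simp: Suc e_eq)
    then show ?thesis by (simp add: vwt_def flip: distrib_left)
  qed (simp add: vwt_def)
  have "of_real (real n * r (Suc n) m / (r (Suc n) m + r (n-1) m) + real m * r n (Suc m) / (r n (Suc m) + r n (m-1)))
     = complex_of_real (s + (real (n + m) - 1) / 2)"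
    using flux_eq[of n m] assms unfolding flux_def hwt vwt by simp
  then show "real n * r (Suc n) m / (r (Suc n) m + r (n-1) m)
       + real m * r n (Suc m) / (r n (Suc m) + r n (m-1)) = s + (real (n + m) - 1) / 2"
    by (simp only: of_real_eq_iff)
  show "r (Suc n) m + r (n-1) m \<noteq> 0" if n: "n \<noteq> 0"
  proof -
    obtain k where k: "n = Suc k" using n by (cases n) auto
    have "d n m + d (n-1) m = u n m * of_real (r (Suc n) m + r (n-1) m)"
      using u_even[of "Suc n" m] u_even[of k m] assms k by (simp add: d_eq algebra_simps)
    then show ?thesis using hsum_nz[OF n, of m] by (metis mult_zero_right of_real_0)
  qed
  show "r n (Suc m) + r n (m-1) \<noteq> 0" if n: "m \<noteq> 0"
  proof -
    obtain k where k: "m = Suc k" using n by (cases m) auto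
    have "e n m + e n (m-1) = b * u n m * of_real (r n (Suc m) + r n (m-1))"
      using u_even[of n "Suc m"] u_even[of n k] assms k by (simp add: e_eq algebra_simps)
    then show ?thesis using vsum_nz[OF n, of n] by (metis mult_zero_right of_real_0)
  qed
qed

end

section \<open>Propagation of positivity and orthogonal polynomials\<close>

text \<open>The vertical term lies between 0 and \<open>m\<close>, so \<open>n * \<kappa>\<close>
  lies between \<open>s + (n - m - 1) / 2\<close> and \<open>s + (n + m - 1) / 2\<close>. For
  \<open>m < n\<close> and \<open>0 < s < 1\<close> this range is inside (0, n), so
  \<open>0 < \<kappa> < 1\<close> and \<open>x\<close> has the sign of \<open>y\<close>. The second
  conclusion is the quantitative form that survives the limit c = 2.\<close>

lemma radius_ratio:
  fixes x y p q s :: real and n m :: nat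
  assumes eq: "real n * x / (x + y) + real m * p / (p + q) = s + (real (n + m) - 1) / 2"
    and nz: "x + y \<noteq> 0" and y: "y > 0" and pq: "m \<noteq> 0 \<Longrightarrow> p > 0 \<and> q > 0"
    and nm: "m < n" and s: "0 < s" "s < 1"
  shows "x > 0" and "(s + (real n - real m - 1) / 2) * y \<le> real n * x"
proof -
  define \<kappa> where "\<kappa> = x / (x + y)"
  define T where "T = real m * p / (p + q)"
  have T: "0 \<le> T" "T \<le> real m"
    using pq by (cases "m = 0"; auto simp: T_def field_simps)+
  have k: "real n * \<kappa> = s + (real (n + m) - 1) / 2 - T"
    using eq by (simp add: \<kappa>_def T_def)
  have nm': "real m + 1 \<le> real n" using nm by linarith
  have T': "T < real m \<or> m = 0"
    using pq by (cases "m = 0") (auto simp: T_def field_simps)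
  have low: "s + (real n - real m - 1) / 2 \<le> real n * \<kappa>" using k T by (simp add: field_simps)
  have "0 < s + (real n - real m - 1) / 2" using nm' s(1) by (simp add: add_pos_nonneg)
  then have "0 < real n * \<kappa>" using low by (rule less_le_trans)
  then have k0: "\<kappa> > 0" by (simp add: zero_less_mult_iff)
  have "(real (n + m) - 1) / 2 \<le> real n - 1" using nm' by simp
  then have "real n * \<kappa> < real n * 1" unfolding k using T(1) s(2) by linarith
  then have k1: "\<kappa> < 1" by (simp only: mult_less_cancel_left)
  have x: "x * (1 - \<kappa>) = \<kappa> * y" using nz by (simp add: \<kappa>_def field_simps)
  then have "x * (1 - \<kappa>) > 0" using k0 y by simp
  then show x0: "x > 0" using k1 by (simp add: zero_less_mult_iff)
  have "\<kappa> * x > 0" using x0 k0 by simp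
  then have "\<kappa> * y \<le> x" using x by (simp add: algebra_simps)
  then have "real n * (\<kappa> * y) \<le> real n * x" by (intro mult_left_mono) auto
  moreover have "(s + (real n - real m - 1) / 2) * y \<le> real n * \<kappa> * y"
    using low y by (intro mult_right_mono) auto
  ultimately show "(s + (real n - real m - 1) / 2) * y \<le> real n * x" by (simp add: mult.assoc)
qed

text \<open>At a vertex below the diagonal the ratio of the two horizontal neighbours is positive as soon as
  the vertical neighbours are, so positivity spreads from the diagonal.\<close>

lemma radius_propagation:
  fixes r :: "nat \<Rightarrow> nat \<Rightarrow> real"
  assumes s: "0 < s" "s < 1"
    and eq: "\<And>n m. odd (n + m) \<Longrightarrow> real n * r (Suc n) m / (r (Suc n) m + r (n-1) m)
       + real m * r n (Suc m) / (r n (Suc m) + r n (m-1)) = s + (real (n + m) - 1) / 2"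
    and nz: "\<And>n m. odd (n + m) \<Longrightarrow> n \<noteq> 0 \<Longrightarrow> r (Suc n) m + r (n-1) m \<noteq> 0"
    and diag: "\<And>n. r n n > 0"
    and "even (n + m)" "m \<le> n"
  shows "r n m > 0"
  using assms(6,7)
proof (induction n arbitrary: m rule: less_induct)
  case (less n)
  show ?case
  proof (cases "m = n")
    case False
    then obtain k where k: "n = Suc k" using less.prems by (cases n) auto
    then have km: "m \<le> k" using False less.prems by simp
    have odd: "odd (k + m)" using less.prems k by auto
    \<comment> \<open>Parity excludes \<open>m = k\<close>; therefore \<open>(k, Suc m)\<close>
      still lies on or below the diagonal and the induction hypothesis applies to it.\<close>
    then have mk: "m < k" using km by (cases "m = k") auto
    then obtain j where j: "k = Suc j" by (cases k) auto
    show ?thesis unfolding k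
    proof (rule radius_ratio(1)[OF eq[OF odd] nz[OF odd]])
      show "0 < r (k - 1) m"
        using less.IH[of j m] odd mk j k by auto
      show "0 < r k (Suc m) \<and> 0 < r k (m - 1)" if "m \<noteq> 0"
        using less.IH[of k "Suc m"] less.IH[of k "m - 1"] odd mk k that by auto
    qed (use mk s in auto)
  qed (simp add: diag)
qed

text \<open>\<open>g\<close> collects positive zeros with their multiplicities until the cofactor
  has no sign change on the half-axis. Used as a test polynomial it gives
  \<open>g * p = g * g * R\<close>, of constant sign; the condition on \<open>coeff g 0\<close>
  records that \<open>g\<close> is a product of factors t - root with positive roots.\<close>

lemma split_positive_roots:
  fixes p :: "real poly"
  shows "\<exists>g R. p = g * R \<and> lead_coeff g = 1 \<and> (-1) ^ degree g * coeff g 0 > 0 \<and>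
    ((\<forall>t>0. 0 \<le> poly R t) \<or> (\<forall>t>0. poly R t \<le> 0))"
proof (induction "degree p" arbitrary: p rule: less_induct)
  case less
  show ?case
  proof (cases "\<exists>t>0. poly p t = 0 \<and> p \<noteq> 0")
    case True
    then obtain t where t: "t > 0" "poly p t = 0" "p \<noteq> 0" by blast
    then obtain p' where p': "p = [:-t, 1:] * p'" by (auto simp: poly_eq_0_iff_dvd)
    then have "p' \<noteq> 0" using t by auto
    then have "degree p = Suc (degree p')" unfolding p' by (subst degree_mult_eq) auto
    then obtain g R where g: "p' = g * R" "lead_coeff g = 1" "(-1) ^ degree g * coeff g 0 > 0"
      "(\<forall>t>0. 0 \<le> poly R t) \<or> (\<forall>t>0. poly R t \<le> 0)"
      using less[of p'] by auto
    have g0: "g \<noteq> 0" using g by auto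
    show ?thesis
    proof (rule exI[of _ "[:-t, 1:] * g"], rule exI[of _ R], intro conjI)
      show "p = [:- t, 1:] * g * R" using g p' by (simp only: mult.assoc)
      show "lead_coeff ([:- t, 1:] * g) = 1" using g by (subst lead_coeff_mult) simp
      have "degree ([:-t, 1:] * g) = Suc (degree g)" using g0 by (subst degree_mult_eq) auto
      moreover have "coeff ([:-t, 1:] * g) 0 = - t * coeff g 0" by (simp add: coeff_mult)
      ultimately have "(-1) ^ degree ([:-t, 1:] * g) * coeff ([:-t, 1:] * g) 0
        = t * ((-1) ^ degree g * coeff g 0)" by simp
      then show "(-1) ^ degree ([:-t, 1:] * g) * coeff ([:-t, 1:] * g) 0 > 0"
        using g t by simp
    qed (use g in auto)
  next
    case False
    have "(\<forall>t>0. 0 \<le> poly p t) \<or> (\<forall>t>0. poly p t \<le> 0)"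
    proof (rule ccontr)
      assume "\<not> ?thesis"
      then obtain x y where xy: "x > 0" "y > 0" "poly p x < 0" "poly p y > 0" by force
      have "\<exists>t>0. poly p t = 0"
      proof (cases "x < y")
        case True
        then show ?thesis using poly_IVT_pos[OF True xy(3,4)] xy by (meson less_trans)
      next
        case False
        then have "y < x" using xy by (cases "x = y") auto
        then show ?thesis using poly_IVT_neg[of y x p] xy by (meson less_trans)
      qed
      moreover have "p \<noteq> 0" using xy by auto
      ultimately show False using \<open>\<not> (\<exists>t>0. poly p t = 0 \<and> p \<noteq> 0)\<close> by blast
    qed
    show ?thesis
    proof -
      have "p = 1 * p \<and> lead_coeff (1 :: real poly) = 1 \<and> (-1) ^ degree (1 :: real poly) * coeff (1 :: real poly) 0 > 0"
        by simp
      with \<open>(\<forall>t>0. 0 \<le> poly p t) \<or> (\<forall>t>0. poly p t \<le> 0)\<close> show ?thesis by blast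
    qed
  qed
qed

lemma poly_norm_bound:
  fixes p :: "complex poly"
  assumes "degree p \<le> k"
  shows "norm (poly p z) \<le> (\<Sum>i\<le>degree p. norm (coeff p i)) * max 1 (norm z) ^ k"
proof -
  have "norm (poly p z) \<le> (\<Sum>i\<le>degree p. norm (coeff p i * z ^ i))"
    unfolding poly_altdef by (rule norm_sum)
  also have "\<dots> \<le> (\<Sum>i\<le>degree p. norm (coeff p i) * max 1 (norm z) ^ k)"
  proof (rule sum_mono)
    fix i assume "i \<in> {..degree p}"
    then have "i \<le> k" using assms by auto
    have "norm z ^ i \<le> max 1 (norm z) ^ i" by (intro power_mono) auto
    also have "\<dots> \<le> max 1 (norm z) ^ k" using \<open>i \<le> k\<close> by (intro power_increasing) auto
    finally show "norm (coeff p i * z ^ i) \<le> norm (coeff p i) * max 1 (norm z) ^ k"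
      by (auto simp: norm_mult norm_power intro: mult_left_mono)
  qed
  finally show ?thesis by (simp add: sum_distrib_right)
qed

lemma mono_limits_zero:
  fixes \<theta> :: "real \<Rightarrow> real"
  assumes "mono \<theta>" "(\<theta> \<longlongrightarrow> 0) at_top" "(\<theta> \<longlongrightarrow> 0) at_bot"
  shows "\<theta> x = 0"
proof (rule antisym)
  show "\<theta> x \<le> 0"
    by (rule tendsto_lowerbound[OF assms(2)])
      (use assms(1) in \<open>auto simp: eventually_at_top_linorder mono_def intro!: exI[of _ x]\<close>)
  show "0 \<le> \<theta> x"
    by (rule tendsto_upperbound[OF assms(3)])
      (use assms(1) in \<open>auto simp: eventually_at_bot_linorder mono_def intro!: exI[of _ x]\<close>)
qed

text \<open>Stands in for integrating a function of one sign over the line: its primitive is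
  monotone with limit 0 at both ends, hence constant.\<close>

lemma signed_derivative_zero:
  fixes \<theta> \<theta>' :: "real \<Rightarrow> real"
  assumes D: "\<And>x. (\<theta> has_real_derivative \<theta>' x) (at x)"
    and sgn: "(\<forall>x. 0 \<le> \<theta>' x) \<or> (\<forall>x. \<theta>' x \<le> 0)"
    and lim: "(\<theta> \<longlongrightarrow> 0) at_top" "(\<theta> \<longlongrightarrow> 0) at_bot"
  shows "\<theta>' x = 0"
proof -
  have "\<theta> y = 0" for y
    using sgn
  proof
    assume "\<forall>x. 0 \<le> \<theta>' x"
    then have "mono \<theta>"
      unfolding mono_def using D by (meson DERIV_nonneg_imp_nondecreasing)
    then show ?thesis using mono_limits_zero lim by blast
  next
    assume neg: "\<forall>x. \<theta>' x \<le> 0"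
    have "mono (\<lambda>x. - \<theta> x)"
      unfolding mono_def using D neg
      by (metis DERIV_nonpos_imp_nonincreasing neg_le_iff_le)
    then have "- \<theta> y = 0"
      by (rule mono_limits_zero) (use lim in \<open>auto intro: tendsto_eq_intros\<close>)
    then show ?thesis by simp
  qed
  then have "\<theta> = (\<lambda>_. 0)" by auto
  then show ?thesis using D[of x] DERIV_unique DERIV_const by blast
qed

text \<open>A count of exponents. For x to infinity the two summands are of order exp (- s x) and
  exp (- x), for x to minus infinity the bound is exp ((1 - s) x). The degree bounds n for
  \<open>A\<close> and n - 1 for \<open>B\<close> and \<open>g\<close> are what yields decay at the
  right end.\<close>

lemma strip_decay:
  fixes A B g :: "complex poly" and \<kappa> :: complex
  assumes s: "0 < s" "s < 1" and n: "n \<ge> 1"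
    and deg: "degree A \<le> n" "degree B \<le> n - 1" "degree g \<le> n - 1"
    and F: "\<And>x y. x \<noteq> 0 \<Longrightarrow> \<bar>y\<bar> \<le> pi \<Longrightarrow> norm (F (Complex x y)) =
       exp ((1 - s) * x) * norm (poly g (- exp (Complex x y)))
       * norm (poly A (exp (Complex x y)) - \<kappa> * exp (of_real s * Complex x y) * poly B (exp (Complex x y)))
       / norm ((1 - exp (Complex x y - \<i> * a)) * (1 - exp (Complex x y + \<i> * of_real a))) ^ n"
  obtains N where "(N \<longlongrightarrow> (0::real)) at_top" "(N \<longlongrightarrow> 0) at_bot"
    "\<And>x y. \<bar>x\<bar> \<ge> 1 \<Longrightarrow> \<bar>y\<bar> \<le> pi \<Longrightarrow> norm (F (Complex x y)) \<le> N x"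
proof -
  define S :: "complex poly \<Rightarrow> real" where "S p = (\<Sum>i\<le>degree p. norm (coeff p i))" for p
  have S0: "S p \<ge> 0" for p by (auto simp: S_def intro: sum_nonneg)
  define N where "N x = (if x \<ge> 0 then 4 ^ n * S g * (S A * exp (- s * x) + norm \<kappa> * S B * exp (- x))
       else 4 ^ n * S g * (S A + norm \<kappa> * S B) * exp ((1 - s) * x))" for x :: real
  have e2: "exp (1::real) \<ge> 2" using exp_ge_add_one_self[of "1::real"] by simp
  have bnd: "norm (F (Complex x y)) \<le> N x" if x: "\<bar>x\<bar> \<ge> 1" and y: "\<bar>y\<bar> \<le> pi" for x y
  proof -
    let ?z = "Complex x y"
    have nz: "norm (exp ?z) = exp x" "norm (exp (?z - \<i> * a)) = exp x" "norm (exp (?z + \<i> * a)) = exp x"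
      "norm (exp (of_real s * ?z)) = exp (s * x)"
      by (simp_all add: norm_exp_eq_Re)
    let ?M = "max 1 (exp x)"
    have pg: "norm (poly g (- exp ?z)) \<le> S g * ?M ^ (n - 1)"
      using poly_norm_bound[OF deg(3), of "- exp ?z"] nz by (simp add: S_def)
    have "norm (poly A (exp ?z) - \<kappa> * exp (of_real s * ?z) * poly B (exp ?z))
       \<le> norm (poly A (exp ?z)) + norm (\<kappa> * exp (of_real s * ?z) * poly B (exp ?z))"
      by (rule norm_triangle_ineq4)
    also have "\<dots> \<le> S A * ?M ^ n + norm \<kappa> * exp (s * x) * (S B * ?M ^ (n - 1))"
      using poly_norm_bound[OF deg(1), of "exp ?z"] poly_norm_bound[OF deg(2), of "exp ?z"]
      unfolding norm_mult nz by (intro add_mono mult_left_mono) (auto simp: S_def nz)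
    finally have pA: "norm (poly A (exp ?z) - \<kappa> * exp (of_real s * ?z) * poly B (exp ?z))
       \<le> S A * ?M ^ n + norm \<kappa> * exp (s * x) * (S B * ?M ^ (n - 1))" .
    \<comment> \<open>Away from \<bar>x\<bar> < 1 each factor of the denominator is at least half of
      \<open>max 1 (exp x)\<close>, because exp 1 \<ge> 2. Two factors to the power n produce the
      4^n in \<open>N\<close>.\<close>
    have low: "?M / 2 \<le> norm (1 - exp w)" if "norm (exp w) = exp x" for w :: complex
    proof (cases "x \<ge> 1")
      case True
      then have "exp x \<ge> 2" using e2 by (meson exp_le_cancel_iff order_trans)
      moreover have "norm (exp w) - norm (1::complex) \<le> norm (exp w - 1)" by (rule norm_triangle_ineq2)
      ultimately show ?thesis using that by (simp add: norm_minus_commute max_def)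
    next
      case False
      then have "exp x \<le> exp (- 1)" using x by simp
      also have "\<dots> \<le> 1 / 2" using e2 by (simp add: exp_minus field_simps)
      finally have "exp x \<le> 1 / 2" .
      moreover have "norm (1::complex) - norm (exp w) \<le> norm (1 - exp w)" by (rule norm_triangle_ineq2)
      ultimately show ?thesis using that by (simp add: max_def)
    qed
    have "(?M / 2) * (?M / 2) \<le> norm ((1 - exp (?z - \<i> * a)) * (1 - exp (?z + \<i> * a)))"
      unfolding norm_mult by (intro mult_mono low) (auto simp: nz)
    then have W: "((?M / 2) * (?M / 2)) ^ n \<le> norm ((1 - exp (?z - \<i> * a)) * (1 - exp (?z + \<i> * a))) ^ n"
      by (intro power_mono) auto
    have Mpos: "?M > 0" by auto
    have "norm (F ?z) \<le> exp ((1 - s) * x) * (S g * ?M ^ (n - 1))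
        * (S A * ?M ^ n + norm \<kappa> * exp (s * x) * (S B * ?M ^ (n - 1))) / ((?M / 2) * (?M / 2)) ^ n"
    proof -
      have "x \<noteq> 0" using x by auto
      show ?thesis
        unfolding F[OF \<open>x \<noteq> 0\<close> y]
        using S0 Mpos by (intro frac_le mult_mono pg pA W order_refl)
          (auto intro!: mult_nonneg_nonneg add_nonneg_nonneg)
    qed
    also have "((?M / 2) * (?M / 2)) ^ n = ?M ^ n * ?M ^ n / 4 ^ n"
      by (simp add: power_mult_distrib power_divide flip: power_mult_distrib)
    also have "exp ((1 - s) * x) * (S g * ?M ^ (n - 1))
        * (S A * ?M ^ n + norm \<kappa> * exp (s * x) * (S B * ?M ^ (n - 1))) / (?M ^ n * ?M ^ n / 4 ^ n) \<le> N x"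
    proof (cases "x \<ge> 0")
      case True
      then have M: "?M = exp x" by (simp add: max_def)
      obtain k where k: "n = Suc k" using n by (cases n) auto
      have es: "exp ((1 - s) * x) = exp x * exp (- s * x)" "exp (- s * x) * exp (s * x) = 1"
        by (simp_all add: algebra_simps flip: exp_add)
      have "exp ((1 - s) * x) * (S g * exp x ^ k) * (S A * exp x ^ n + norm \<kappa> * exp (s * x) * (S B * exp x ^ k))
        = S g * exp x ^ n * (S A * exp x ^ n * exp (- s * x) + norm \<kappa> * S B * exp x ^ k * (exp (- s * x) * exp (s * x)))"
        unfolding es(1) k by (simp add: algebra_simps)
      also have "\<dots> = S g * (S A * exp (- s * x) + norm \<kappa> * S B * exp (- x)) * (exp x ^ n * exp x ^ n)"
        unfolding es(2) k by (simp add: algebra_simps exp_minus)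
      finally have *: "exp ((1 - s) * x) * (S g * exp x ^ k) * (S A * exp x ^ n + norm \<kappa> * exp (s * x) * (S B * exp x ^ k))
        = S g * (S A * exp (- s * x) + norm \<kappa> * S B * exp (- x)) * (exp x ^ n * exp x ^ n)" .
      have "n - 1 = k" using k by simp
      show ?thesis unfolding M N_def \<open>n - 1 = k\<close> * using True by simp
    next
      case False
      then have M: "?M = 1" by (simp add: max_def)
      have "exp (s * x) \<le> 1" "exp (s * x) > 0" using False s by (auto simp: mult_le_0_iff)
      have "S A + norm \<kappa> * exp (s * x) * S B \<le> S A + norm \<kappa> * S B"
        using \<open>exp (s * x) \<le> 1\<close> S0[of B] by (auto intro!: mult_right_mono mult_left_le)
      then have "4 ^ n * (exp ((1 - s) * x) * S g) * (S A + norm \<kappa> * exp (s * x) * S B)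
          \<le> 4 ^ n * (exp ((1 - s) * x) * S g) * (S A + norm \<kappa> * S B)"
        using S0[of g] by (intro mult_left_mono) auto
      then show ?thesis unfolding M N_def using False by (simp add: mult_ac)
    qed
    finally show ?thesis .
  qed
  show thesis
  proof (rule that[OF _ _ bnd])
    have "((\<lambda>x. 4 ^ n * S g * (S A * exp (- s * x) + norm \<kappa> * S B * exp (- x))) \<longlongrightarrow> 4 ^ n * S g * (S A * 0 + norm \<kappa> * S B * 0)) at_top"
      using s by (intro tendsto_intros; real_asymp)
    then show "(N \<longlongrightarrow> 0) at_top"
      by (subst filterlim_cong[OF refl refl, where g="\<lambda>x. 4 ^ n * S g * (S A * exp (- s * x) + norm \<kappa> * S B * exp (- x))"])
         (auto simp: N_def eventually_at_top_linorder intro!: exI[of _ 0])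
    have "((\<lambda>x. 4 ^ n * S g * (S A + norm \<kappa> * S B) * exp ((1 - s) * x)) \<longlongrightarrow> 4 ^ n * S g * (S A + norm \<kappa> * S B) * 0) at_bot"
      using s by (intro tendsto_intros; real_asymp)
    then show "(N \<longlongrightarrow> 0) at_bot"
      by (subst filterlim_cong[OF refl refl, where g="\<lambda>x. 4 ^ n * S g * (S A + norm \<kappa> * S B) * exp ((1 - s) * x)"])
         (auto simp: N_def eventually_at_bot_linorder intro!: exI[of _ "-1"])
  qed auto
qed

lemma holomorphic_on_poly_comp:
  fixes p :: "complex poly"
  assumes "h holomorphic_on S"
  shows "(\<lambda>z. poly p (h z)) holomorphic_on S"
  by (induction p) (auto intro!: holomorphic_on_add holomorphic_on_mult holomorphic_on_const assms)

lemma Re_poly_of_real: "Re (poly p (of_real t)) = poly (map_poly Re p) t"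
  by (induction p) (auto simp: map_poly_pCons)

lemma factor_pair:
  fixes p m c X :: "'a :: comm_ring_1"
  assumes "p + m = 2 * c" "p * m = 1"
  shows "(1 - - X * m) * (1 - - X * p) = 1 + 2 * c * X + X * X"
proof -
  have "(1 - - X * m) * (1 - - X * p) = 1 + (p + m) * X + (p * m) * (X * X)"
    by (simp add: algebra_simps)
  then show ?thesis by (simp add: assms)
qed

text \<open>Here \<open>E1\<close> and \<open>E2\<close> are exp ((1 - s) z) and exp (s z). Their
  product exp z takes the same value \<open>- X\<close> on both border lines of the strip, so the
  \<open>B\<close> term is identical there and \<open>cancel_common\<close> removes it from the
  jump.\<close>

lemma merge_exponents:
  fixes A B g \<kappa> w X :: complex
  assumes "E1 * E2 = - X"
  shows "E1 * g * ((A - \<kappa> * E2 * B) / w) = g * (E1 * A + \<kappa> * X * B) / w"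
proof -
  have "E1 * g * (A - \<kappa> * E2 * B) = g * (E1 * A - \<kappa> * (E1 * E2) * B)"
    by (simp add: algebra_simps)
  then show ?thesis by (simp add: assms)
qed

lemma cancel_common:
  fixes A g w Y :: complex
  shows "K * (g * (Ep * A + Y) / w - g * (Em * A + Y) / w) = K * (Ep - Em) * (g / w * A)"
proof -
  have "g * (Ep * A + Y) - g * (Em * A + Y) = (Ep - Em) * (g * A)" by (simp add: algebra_simps)
  then show ?thesis unfolding diff_divide_distrib[symmetric] by simp
qed

text \<open>The jump of a primitive of the quotient across the strip \<open>\<bar>Im z\<bar> \<le> \<pi>\<close> tends to \<open>0\<close> at both ends,
  and its derivative is a positive weight times \<open>Re (A(-exp x))\<close> times a test polynomial of degree
  less than \<open>n\<close>.  So \<open>Re (A(-t))\<close> is an orthogonal polynomial on \<open>(0,\<infinity>)\<close> and all its zeros are positive.\<close>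

lemma orthogonality_sign:
  fixes A B :: "complex poly" and s a R :: real and \<kappa> :: complex
  assumes s: "0 < s" "s < 1" and n: "n \<ge> 1" and a: "0 < a" "a < pi"
    and deg: "degree A \<le> n" "degree B \<le> n - 1" and A0: "coeff A 0 = 1" and An: "coeff A n = of_real R"
    and G: "G holomorphic_on {z. \<bar>Im z\<bar> < 2 * pi - a}"
    and eq: "\<And>z. \<bar>Im z\<bar> < 2 * pi - a \<Longrightarrow> poly A (exp z) - \<kappa> * exp (of_real s * z) * poly B (exp z)
        = ((1 - exp (z - \<i> * a)) * (1 - exp (z + \<i> * of_real a))) ^ n * G z"
  shows "R > 0"
proof -
  define S where "S = {z. \<bar>Im z\<bar> < 2 * pi - a}"
  have S_eq: "S = Im -` {-(2 * pi - a)<..<2 * pi - a}" by (auto simp: S_def)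
  have "open S" unfolding S_eq by (intro open_vimage continuous_intros)
  have "convex S" unfolding S_eq by (auto intro!: convex_linear_vimage bounded_linear.linear bounded_linear_Im)
  define PA where "PA = map_poly Re (A \<circ>\<^sub>p [:0, -1:])"
  have PA: "poly PA t = Re (poly A (- of_real t))" for t
    unfolding PA_def Re_poly_of_real[symmetric] poly_pcompose by simp
  have PAc: "coeff PA i = (-1) ^ i * Re (coeff A i)" for i
    by (cases "even i") (auto simp: PA_def coeff_map_poly coeff_pcompose_linear)
  obtain g Q where gQ: "PA = g * Q" "lead_coeff g = 1" "(-1) ^ degree g * coeff g 0 > 0"
    "(\<forall>t>0. 0 \<le> poly Q t) \<or> (\<forall>t>0. poly Q t \<le> 0)"
    using split_positive_roots by metis
  have "PA \<noteq> 0" using PAc[of 0] A0 by auto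
  then have nz: "g \<noteq> 0" "Q \<noteq> 0" using gQ by auto
  have degPA: "degree PA \<le> n"
    by (rule degree_le) (use deg in \<open>auto simp: PAc coeff_eq_0\<close>)
  have degm: "degree PA = degree g + degree Q" unfolding gQ(1) using nz by (rule degree_mult_eq)
  \<comment> \<open>Otherwise \<open>g\<close> has a degree admissible for a test polynomial, and a
    one-signed integrand \<open>g\<^sup>2 * Q\<close> times a positive weight would have integral
    0.\<close>
  have "degree g \<ge> n"
  proof (rule ccontr)
    assume "\<not> n \<le> degree g"
    then have dg: "degree g \<le> n - 1" by simp
    define gc :: "complex poly" where "gc = map_poly of_real g"
    have gc: "poly gc (of_real t) = of_real (poly g t)" for t
      unfolding gc_def by (induction g) (auto simp: map_poly_pCons)
    have dgc: "degree gc \<le> n - 1" using dg by (intro degree_le) (auto simp: gc_def coeff_map_poly coeff_eq_0)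
    \<comment> \<open>\<open>G\<close> is what remains after division by the n-fold zeros at i a and
      - i a, so \<open>F\<close> has no poles in the strip. On the lines Im z = \<pi> and Im z =
      -\<pi> the number \<open>- exp z\<close> is the same positive real, where \<open>g\<close>
      takes a real value.\<close>
    define F where "F z = exp ((1 - of_real s) * z) * poly gc (- exp z) * G z" for z
    have "F holomorphic_on S"
      unfolding F_def
    proof (intro holomorphic_on_mult)
      show "(\<lambda>z. exp ((1 - of_real s) * z)) holomorphic_on S" by (intro holomorphic_intros)
      show "(\<lambda>z. poly gc (- exp z)) holomorphic_on S"
        by (intro holomorphic_on_poly_comp holomorphic_intros)
      show "G holomorphic_on S" using G by (simp add: S_def)
    qed
    then obtain \<Phi> where "\<And>z. z \<in> S \<Longrightarrow> (\<Phi> has_field_derivative F z) (at z within S)"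
      by (rule holomorphic_convex_primitive'[OF \<open>convex S\<close> \<open>open S\<close>]) (rule that)
    then have \<Phi>: "\<And>z. z \<in> S \<Longrightarrow> (\<Phi> has_field_derivative F z) (at z)"
      using \<open>open S\<close> at_within_open by metis
    have inS: "Complex x y \<in> S" if "\<bar>y\<bar> \<le> pi" for x y
      using that a by (auto simp: S_def)
    have exp1: "1 - exp w \<noteq> 0" if "Re w \<noteq> 0" for w
      using that by (auto simp: exp_eq_1)
    have Fn: "norm (F (Complex x y)) =
       exp ((1 - s) * x) * norm (poly gc (- exp (Complex x y)))
       * norm (poly A (exp (Complex x y)) - \<kappa> * exp (of_real s * Complex x y) * poly B (exp (Complex x y)))
       / norm ((1 - exp (Complex x y - \<i> * a)) * (1 - exp (Complex x y + \<i> * of_real a))) ^ n"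
      if "x \<noteq> 0" "\<bar>y\<bar> \<le> pi" for x y
    proof -
      have ne: "norm (exp ((1 - of_real s) * Complex x y)) = exp ((1 - s) * x)"
        by (simp add: norm_exp_eq_Re)
      have "1 - exp (Complex x y - \<i> * a) \<noteq> 0" "1 - exp (Complex x y + \<i> * a) \<noteq> 0"
        using exp1[of "Complex x y - \<i> * a"] exp1[of "Complex x y + \<i> * a"] that(1) by simp_all
      then have Wnz: "norm ((1 - exp (Complex x y - \<i> * a)) * (1 - exp (Complex x y + \<i> * a))) ^ n \<noteq> 0"
        by (simp only: norm_mult norm_eq_zero power_eq_0_iff mult_eq_0_iff) blast
      have "\<bar>Im (Complex x y)\<bar> < 2 * pi - a" using inS[of y x] that by (simp add: S_def)
      then show ?thesis unfolding F_def eq[OF \<open>\<bar>Im (Complex x y)\<bar> < 2 * pi - a\<close>]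
          norm_mult[of _ "G _"] norm_mult[of "exp _"] ne norm_power using Wnz
        by (simp only: mult.assoc times_divide_eq_right nonzero_mult_div_cancel_left) auto
    qed
    obtain N where N: "(N \<longlongrightarrow> (0::real)) at_top" "(N \<longlongrightarrow> 0) at_bot"
      "\<And>x y. \<bar>x\<bar> \<ge> 1 \<Longrightarrow> \<bar>y\<bar> \<le> pi \<Longrightarrow> norm (F (Complex x y)) \<le> N x"
      using strip_decay[OF s n deg dgc Fn] by blast
    \<comment> \<open>Normalises the jump of exp ((1 - s) z) between the two lines, which is exp ((1
      - s) x) times 2 i sin (pi s).\<close>
    define K where "K = 1 / (2 * \<i> * of_real (sin (pi * s)))"
    have sin_pos: "sin (pi * s) > 0" using s by (intro sin_gt_zero) auto
    define \<theta> where "\<theta> x = Re (K * (\<Phi> (of_real x + \<i> * pi) - \<Phi> (of_real x - \<i> * pi)))" for x :: real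
    \<comment> \<open>The common value of the denominator
      \<open>(1 - exp (z - \<i> * a)) * (1 - exp (z + \<i> * a))\<close> on the two lines; as a sum
      of two squares it is positive.\<close>
    define \<omega> where "\<omega> x = 1 + 2 * cos a * exp x + exp (2 * x)" for x :: real
    define \<theta>' where "\<theta>' x = exp ((1 - s) * x) * poly g (exp x) * poly PA (exp x) / \<omega> x ^ n" for x
    have xi: "of_real x + \<i> * pi = Complex x pi" "of_real x - \<i> * pi = Complex x (- pi)" for x
      by (auto simp: complex_eq_iff)
    have bnd: "\<bar>\<theta> x\<bar> \<le> norm K * (N x * (2 * pi))" if "\<bar>x\<bar> \<ge> 1" for x
    proof -
      define T where "T = {z. Re z = x \<and> \<bar>Im z\<bar> \<le> pi}"
      have "T = Re -` {x} \<inter> Im -` {-pi..pi}" by (auto simp: T_def)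
      then have "convex T"
        by (auto intro!: convex_Int convex_linear_vimage bounded_linear.linear bounded_linear_Im bounded_linear_Re)
      have "norm (\<Phi> (Complex x pi) - \<Phi> (Complex x (- pi))) \<le> N x * norm (Complex x pi - Complex x (- pi))"
      proof (rule field_differentiable_bound[OF \<open>convex T\<close>])
        fix z assume "z \<in> T"
        then have y: "Complex x (Im z) = z" "\<bar>Im z\<bar> \<le> pi"
          by (simp_all add: T_def complex_eq_iff)
        show "(\<Phi> has_field_derivative F z) (at z within T)"
          using \<Phi>[OF inS[OF y(2), of x]] unfolding y(1) by (rule has_field_derivative_at_within)
        show "norm (F z) \<le> N x"
          using N(3)[OF that y(2)] unfolding y(1) .
      qed (auto simp: T_def)
      also have "Complex x pi - Complex x (- pi) = of_real (2 * pi) * \<i>" by (simp add: complex_eq_iff)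
      also have "norm \<dots> = 2 * pi" by (simp add: norm_mult)
      finally have "norm (\<Phi> (Complex x pi) - \<Phi> (Complex x (- pi))) \<le> N x * (2 * pi)" .
      then have "norm (K * (\<Phi> (Complex x pi) - \<Phi> (Complex x (- pi)))) \<le> norm K * (N x * (2 * pi))"
        unfolding norm_mult by (intro mult_left_mono) auto
      then show ?thesis unfolding \<theta>_def xi by (rule order_trans[OF abs_Re_le_cmod])
    qed
    have N0: "((\<lambda>x. norm K * (N x * (2 * pi))) \<longlongrightarrow> norm K * (0 * (2 * pi))) at_top"
      "((\<lambda>x. norm K * (N x * (2 * pi))) \<longlongrightarrow> norm K * (0 * (2 * pi))) at_bot"
      by (rule tendsto_mult[OF tendsto_const tendsto_mult[OF N(1) tendsto_const]])
         (rule tendsto_mult[OF tendsto_const tendsto_mult[OF N(2) tendsto_const]])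
    have lim: "(\<theta> \<longlongrightarrow> 0) at_top" "(\<theta> \<longlongrightarrow> 0) at_bot"
    proof -
      have "\<forall>\<^sub>F x in at_top. norm (\<theta> x) \<le> norm K * (N x * (2 * pi))"
        using eventually_ge_at_top[of 1] by eventually_elim (use bnd in auto)
      then show "(\<theta> \<longlongrightarrow> 0) at_top" using N0(1) unfolding mult_zero_left mult_zero_right by (rule Lim_null_comparison)
      have "\<forall>\<^sub>F x in at_bot. norm (\<theta> x) \<le> norm K * (N x * (2 * pi))"
        using eventually_le_at_bot[of "-1"] by eventually_elim (use bnd in auto)
      then show "(\<theta> \<longlongrightarrow> 0) at_bot" using N0(2) unfolding mult_zero_left mult_zero_right by (rule Lim_null_comparison)
    qed
    have \<omega>_pos: "\<omega> x > 0" for x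
    proof -
      have "\<omega> x = (exp x + cos a)\<^sup>2 + (sin a)\<^sup>2"
        by (simp add: \<omega>_def exp_double sin_squared_eq power2_sum)
      moreover have "sin a > 0" using a by (intro sin_gt_zero)
      ultimately show ?thesis by (auto intro!: add_nonneg_pos)
    qed
    have eval: "K * (F (of_real x + \<i> * pi) - F (of_real x - \<i> * pi))
        = of_real (exp ((1 - s) * x) * poly g (exp x) / \<omega> x ^ n) * poly A (- of_real (exp x))" for x
    proof -
      let ?zp = "of_real x + \<i> * of_real pi" and ?zm = "of_real x - \<i> * of_real pi"
      let ?A = "poly A (- of_real (exp x))" and ?B = "poly B (- of_real (exp x))"
      have e: "exp ?zp = - of_real (exp x)" "exp ?zm = - of_real (exp x)"
        by (simp_all add: exp_add exp_diff exp_of_real)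
      have W: "(1 - exp (z - \<i> * a)) * (1 - exp (z + \<i> * a)) = of_real (\<omega> x)"
        if "exp z = - of_real (exp x)" for z
      proof -
        have 1: "exp (\<i> * a) + exp (- (\<i> * a)) = 2 * of_real (cos a)"
          by (simp add: complex_eq_iff Re_exp Im_exp)
        have 2: "exp (\<i> * a) * exp (- (\<i> * a)) = 1" by (simp flip: exp_add)
        have 3: "exp (z - \<i> * a) = - of_real (exp x) * exp (- (\<i> * a))"
          "exp (z + \<i> * a) = - of_real (exp x) * exp (\<i> * a)"
          unfolding that[symmetric] by (simp_all flip: exp_add)
        have "exp (2 * x) = exp x * exp x" by (simp flip: exp_add)
        then have 4: "complex_of_real (\<omega> x) = 1 + 2 * of_real (cos a) * of_real (exp x) + of_real (exp x) * of_real (exp x)"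
          by (simp add: \<omega>_def)
        show ?thesis unfolding 3 4 using factor_pair[OF 1 2] .
      qed
      have zin: "\<bar>Im ?zp\<bar> < 2 * pi - a" "\<bar>Im ?zm\<bar> < 2 * pi - a" using a by auto
      have \<omega>nz: "complex_of_real (\<omega> x) ^ n \<noteq> 0" using \<omega>_pos[of x] by simp
      have Gp: "G ?zp = (?A - \<kappa> * exp (of_real s * ?zp) * ?B) / of_real (\<omega> x) ^ n"
        using eq[OF zin(1)] \<omega>nz unfolding W[OF e(1)] e by (metis nonzero_mult_div_cancel_left)
      have Gm: "G ?zm = (?A - \<kappa> * exp (of_real s * ?zm) * ?B) / of_real (\<omega> x) ^ n"
        using eq[OF zin(2)] \<omega>nz unfolding W[OF e(2)] e by (metis nonzero_mult_div_cancel_left)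
      have es: "exp ((1 - of_real s) * z) * exp (of_real s * z) = exp z" for z :: complex
        by (simp add: algebra_simps flip: exp_add)
      have gcE: "poly gc (- (- of_real (exp x))) = of_real (poly g (exp x))"
        using gc by simp
      have Fp: "F ?zp = of_real (poly g (exp x)) * (exp ((1 - of_real s) * ?zp) * ?A + \<kappa> * of_real (exp x) * ?B) / of_real (\<omega> x) ^ n"
        unfolding F_def Gp e gcE using es[of ?zp] unfolding e by (rule merge_exponents)
      have Fm: "F ?zm = of_real (poly g (exp x)) * (exp ((1 - of_real s) * ?zm) * ?A + \<kappa> * of_real (exp x) * ?B) / of_real (\<omega> x) ^ n"
        unfolding F_def Gm e gcE using es[of ?zm] unfolding e by (rule merge_exponents)
      have "exp ((1 - of_real s) * ?zp) - exp ((1 - of_real s) * ?zm)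
         = of_real (exp ((1 - s) * x)) * (2 * \<i> * of_real (sin (pi - pi * s)))"
        by (simp add: complex_eq_iff Re_exp Im_exp algebra_simps)
      then have "K * (exp ((1 - of_real s) * ?zp) - exp ((1 - of_real s) * ?zm)) = of_real (exp ((1 - s) * x))"
        using sin_pos by (simp add: K_def)
      moreover have "K * (F ?zp - F ?zm) = K * (exp ((1 - of_real s) * ?zp) - exp ((1 - of_real s) * ?zm))
          * (of_real (poly g (exp x)) / of_real (\<omega> x) ^ n * ?A)"
        unfolding Fp Fm by (rule cancel_common)
      ultimately show ?thesis by simp
    qed
    have D: "(\<theta> has_real_derivative \<theta>' x) (at x)" for x
    proof -
      have "((\<lambda>z. K * (\<Phi> (z + \<i> * pi) - \<Phi> (z - \<i> * pi))) has_field_derivative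
          K * (F (of_real x + \<i> * pi) - F (of_real x - \<i> * pi))) (at (of_real x))"
      proof -
        have "((\<lambda>z. \<Phi> (z + \<i> * pi)) has_field_derivative F (of_real x + \<i> * pi)) (at (of_real x))"
          using \<Phi>[OF inS[of pi x]] unfolding xi[symmetric] DERIV_shift by simp
        moreover have "((\<lambda>z. \<Phi> (z - \<i> * pi)) has_field_derivative F (of_real x - \<i> * pi)) (at (of_real x))"
          using \<Phi>[OF inS[of "- pi" x]] unfolding xi[symmetric] diff_conv_add_uminus DERIV_shift by simp
        ultimately show ?thesis by (intro DERIV_cmult DERIV_diff)
      qed
      then have "((\<lambda>x. K * (\<Phi> (of_real x + \<i> * pi) - \<Phi> (of_real x - \<i> * pi))) has_vector_derivative
          K * (F (of_real x + \<i> * pi) - F (of_real x - \<i> * pi))) (at x)"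
        by (rule has_vector_derivative_real_field)
      from bounded_linear.has_vector_derivative[OF bounded_linear_Re this]
      have "(\<theta> has_real_derivative Re (K * (F (of_real x + \<i> * pi) - F (of_real x - \<i> * pi)))) (at x)"
        unfolding \<theta>_def[abs_def] has_real_derivative_iff_has_vector_derivative .
      also have "Re (K * (F (of_real x + \<i> * pi) - F (of_real x - \<i> * pi))) = \<theta>' x"
        unfolding eval \<theta>'_def PA by simp
      finally show ?thesis .
    qed
    have \<theta>'_eq: "\<theta>' x = exp ((1 - s) * x) * (poly g (exp x))\<^sup>2 / \<omega> x ^ n * poly Q (exp x)" for x
      by (simp add: \<theta>'_def gQ(1) power2_eq_square)
    have "(\<forall>x. 0 \<le> \<theta>' x) \<or> (\<forall>x. \<theta>' x \<le> 0)"
    proof -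
      have "0 \<le> exp ((1 - s) * x) * (poly g (exp x))\<^sup>2 / \<omega> x ^ n" for x
        using \<omega>_pos[of x] by simp
      then show ?thesis unfolding \<theta>'_eq using gQ(4)
        by (meson exp_gt_zero mult_nonneg_nonneg mult_nonneg_nonpos)
    qed
    then have zero: "\<theta>' x = 0" for x using signed_derivative_zero[OF D _ lim] by blast
    \<comment> \<open>The vanishing derivative is a positive factor times
      \<open>g\<^sup>2 * Q\<close> at exp x, and exp x runs through the whole half-axis.\<close>
    have "{0<..} \<subseteq> {t. poly (g * Q) t = 0}"
    proof
      fix t :: real assume "t \<in> {0<..}"
      then have t: "exp (ln t) = t" by simp
      show "t \<in> {t. poly (g * Q) t = 0}"
        using zero[of "ln t"] \<omega>_pos[of "ln t"] unfolding \<theta>'_eq t by auto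
    qed
    moreover have "finite {t. poly (g * Q) t = 0}"
      by (rule poly_roots_finite) (use nz in auto)
    ultimately have "finite {0::real<..}" by (rule finite_subset)
    then show False using infinite_Ioi by blast
  qed
  \<comment> \<open>All zeros of \<open>PA\<close> are now positive and \<open>Q\<close> is a
    constant \<open>q = (-1) ^ n * R\<close>. Comparing constant coefficients with
    \<open>coeff A 0 = 1\<close> determines the sign of \<open>R\<close>.\<close>
  then have dQ: "degree Q = 0" "degree g = n" "degree PA = n" using degm degPA by auto
  then obtain q where q: "Q = [:q:]" by (metis degree_eq_zeroE)
  have "coeff PA n = q" using dQ gQ q by (simp add: mult.commute[of g])
  then have R: "(-1) ^ n * R = q" using PAc[of n] An by simp
  have "coeff PA 0 = q * coeff g 0" using gQ(1) q by simp
  then have "1 = q * coeff g 0" using PAc[of 0] A0 by simp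
  also have "\<dots> = R * ((-1) ^ degree g * coeff g 0)" using dQ by (simp flip: R)
  finally show "R > 0" using gQ(3) by (metis zero_less_mult_pos2 zero_less_one)
qed

section \<open>Lax matrices and the diagonal\<close>

abbreviation strip :: "complex set" where "strip \<equiv> {z. \<bar>Im z\<bar> < 2 * pi}"

lemma open_strip: "open {z. \<bar>Im z\<bar> < (C::real)}"
proof -
  have "{z. \<bar>Im z\<bar> < C} = Im -` {-C<..<C}" by auto
  then show ?thesis by (auto intro!: open_vimage continuous_intros)
qed

lemma exp_neq_1_strip: "z \<in> strip \<Longrightarrow> z \<noteq> 0 \<Longrightarrow> exp z \<noteq> 1"
proof
  assume z: "z \<in> strip" "z \<noteq> 0" "exp z = 1"
  then obtain n :: int where n: "Re z = 0" "Im z = of_int (2 * n) * pi" by (auto simp: exp_eq_1)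
  have "\<bar>of_int n\<bar> * (2 * pi) < 1 * (2 * pi)" using z(1) n(2) by (simp add: abs_mult)
  then have "\<bar>real_of_int n\<bar> < 1" by (simp only: mult_less_cancel_right) auto
  then have "n = 0" by linarith
  then have "z = 0" using n by (simp add: complex_eq_iff)
  then show False using z by simp
qed

text \<open>In the strip \<open>1 - exp z\<close> vanishes only at 0, and simply. The quotient is
  taken between two difference quotients, which removes the singularity.\<close>

lemma divide_one_minus_exp:
  assumes "h holomorphic_on strip" "h 0 = 0"
  obtains g where "g holomorphic_on strip" "\<And>z. z \<in> strip \<Longrightarrow> h z = (1 - exp z) * g z"
proof -
  define E where "E z = 1 - exp z" for z :: complex
  have E: "E holomorphic_on strip" unfolding E_def by (intro holomorphic_intros)
  have dE: "deriv E 0 = -1"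
    unfolding E_def[abs_def] by (rule DERIV_imp_deriv) (auto intro!: derivative_eq_intros)
  define g1 where "g1 z = (if z = 0 then deriv h 0 else (h z - h 0) / (z - 0))" for z
  define g2 where "g2 z = (if z = 0 then deriv E 0 else (E z - E 0) / (z - 0))" for z
  have hol: "g1 holomorphic_on strip" "g2 holomorphic_on strip"
    unfolding g1_def g2_def by (intro pole_lemma_open open_strip assms E)+
  have nz: "g2 z \<noteq> 0" if "z \<in> strip" for z
    using exp_neq_1_strip[OF that] by (auto simp: g2_def dE E_def)
  show thesis
  proof (rule that)
    show "(\<lambda>z. g1 z / g2 z) holomorphic_on strip" using hol nz by (intro holomorphic_on_divide)
    fix z assume z: "z \<in> strip"
    show "h z = (1 - exp z) * (g1 z / g2 z)"
      using exp_neq_1_strip[OF z] assms(2) by (cases "z = 0") (auto simp: g1_def g2_def E_def)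
  qed
qed

text \<open>The recursion multiplies by the Lax matrix of an edge \<open>\<delta>\<close>; its determinant \<open>1 - \<lambda>\<close> vanishes at
  \<open>\<lambda> = exp z = 1\<close>.  The similarity constraint provides a Fuchsian system
  \<open>(1 - \<lambda>) y' = R y\<close> whose residue at \<open>\<lambda> = 1\<close> forces every factor to raise the order of the zero.\<close>

lemma fuchsian_step:
  fixes d :: complex
  assumes d: "d \<noteq> 0" and 1: "p' * d' * d = sf'" and 2: "sf = p * d * e" and 3: "sf' = sf + s * d"
    and 4: "p' * d = p * d + 1 - s"
    and 5: "(1 - l) * D1 = - l * p * d * y1 + sf * y2"
    and 6: "(1 - l) * D2 = l * p * y1 + (s * (1 - l) - l * p * e) * y2"
  shows "(1 - l) * (D1 + d * D2) = - l * p' * d' * (y1 + d * y2) + sf' * (l / d * y1 + y2)"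
    and "(1 - l) * (l / d * y1 + l / d * D1 + D2)
        = l * p' * (y1 + d * y2) + (s * (1 - l) - l * p' * d) * (l / d * y1 + y2)"
proof -
  \<comment> \<open>With \<open>k\<close> in place of \<open>l / d\<close> all identities become
    polynomial.\<close>
  obtain k where k: "l = k * d" using d by (metis nonzero_eq_divide_eq)
  have kl: "l / d = k" using d k by simp
  have "(1 - l) * (D1 + d * D2) = ((1 - l) * D1) + d * ((1 - l) * D2)" by algebra
  also have "\<dots> = - l * p' * d' * (y1 + d * y2) + sf' * (k * y1 + y2)"
    unfolding 5 6 using 1 2 3 k by algebra
  finally show "(1 - l) * (D1 + d * D2) = - l * p' * d' * (y1 + d * y2) + sf' * (l / d * y1 + y2)"
    unfolding kl .
  have "(1 - l) * (k * y1 + k * D1 + D2) = (1 - l) * k * y1 + k * ((1 - l) * D1) + ((1 - l) * D2)" by algebra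
  also have "\<dots> = l * p' * (y1 + d * y2) + (s * (1 - l) - l * p' * d) * (k * y1 + y2)"
    unfolding 5 6 using 2 4 k by algebra
  finally show "(1 - l) * (l / d * y1 + l / d * D1 + D2)
        = l * p' * (y1 + d * y2) + (s * (1 - l) - l * p' * d) * (l / d * y1 + y2)"
    unfolding kl .
qed

text \<open>Used with \<open>l = 1 - exp z\<close> and \<open>L = l ^ (n - 1)\<close>. The
  derivative of a function with the factor \<open>l * L\<close> is compared with its value from the
  differential equation; the cofactor is the relation between the leading terms.\<close>

lemma leading_order:
  fixes D E L N w dw l p \<delta> sf w' :: complex
  assumes "D = N * (- E * L) * w + dw * (l * L)"
    and "l * D = - E * p * \<delta> * (l * L * w) + sf * (l * L * w')"
  shows "l * L * (l * dw - N * E * w - (- E * p * \<delta> * w + sf * w')) = 0"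
  using assms by algebra

text \<open>Write y n = (1 - exp z)^n w. At z = 0 the first row of the Fuchsian system, together
  with the constraint in terms of \<open>p n\<close>, puts w(0) into the span of
  (\<open>\<delta> n\<close>, -1). That is the kernel of the next Lax matrix at \<lambda> = 1, so
  the next step gains a factor \<open>1 - exp z\<close>.\<close>

lemma axis_vanishing:
  fixes \<delta> \<phi> :: "nat \<Rightarrow> complex" and s :: complex and y1 y2 :: "nat \<Rightarrow> complex \<Rightarrow> complex"
  assumes \<delta>: "\<And>n. \<delta> n \<noteq> 0" "\<delta> 0 = 1" and \<phi>0: "\<phi> 0 = 0" and \<phi>: "\<And>n. \<phi> (Suc n) = \<phi> n + \<delta> n"
    and nz: "\<And>n. n \<noteq> 0 \<Longrightarrow> \<delta> n + \<delta> (n-1) \<noteq> 0"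
    and con: "\<And>n. s * \<phi> n = of_nat n / (\<delta> n + \<delta> (n-1)) * \<delta> n * \<delta> (n-1)"
    and y0: "\<And>z. y1 0 z = 1" "\<And>z. y2 0 z = - exp (s * z)"
    and y: "\<And>n z. y1 (Suc n) z = y1 n z + \<delta> n * y2 n z" "\<And>n z. y2 (Suc n) z = exp z / \<delta> n * y1 n z + y2 n z"
  shows "\<exists>w1 w2. w1 holomorphic_on strip \<and> w2 holomorphic_on strip \<and>
     (\<forall>z\<in>strip. y1 n z = (1 - exp z) ^ n * w1 z \<and> y2 n z = (1 - exp z) ^ n * w2 z)"
proof -
  define p where "p n = of_nat n / (\<delta> n + \<delta> (n-1))" for n
  have con': "s * \<phi> n = p n * \<delta> n * \<delta> (n-1)" for n unfolding p_def by (rule con)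
  have p: "p n * (\<delta> n + \<delta> (n-1)) = of_nat n" for n
    using nz[of n] by (cases "n = 0") (auto simp: p_def)
  have pS: "p (Suc n) * \<delta> (Suc n) * \<delta> n = s * \<phi> (Suc n)" for n using con'[of "Suc n"] by simp
  have p4: "p (Suc n) * \<delta> n = p n * \<delta> n + 1 - s" for n
  proof -
    have "\<delta> n * (p (Suc n) * \<delta> n) = \<delta> n * (p n * \<delta> n + 1 - s)"
      using p[of "Suc n"] p[of n] pS[of n] con'[of n] \<phi>[of n] unfolding of_nat_Suc diff_Suc_1 by algebra
    then show ?thesis using \<delta> by simp
  qed
  \<comment> \<open>At n = 0 the system holds for (1, - exp (s z)) because \<open>p 0\<close> and
    \<open>\<phi> 0\<close> vanish; \<open>fuchsian_step\<close> carries it on.\<close>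
  have ode: "\<exists>D1 D2. (y1 n has_field_derivative D1) (at z) \<and> (y2 n has_field_derivative D2) (at z) \<and>
     (1 - exp z) * D1 = - exp z * p n * \<delta> n * y1 n z + s * \<phi> n * y2 n z \<and>
     (1 - exp z) * D2 = exp z * p n * y1 n z + (s * (1 - exp z) - exp z * p n * \<delta> (n-1)) * y2 n z" for n z
  proof (induction n)
    case 0
    have y10: "y1 0 = (\<lambda>_. 1)" "y2 0 = (\<lambda>z. - exp (s * z))" using y0 by auto
    have "((\<lambda>z. - exp (s * z)) has_field_derivative - (s * exp (s * z))) (at z)"
      by (auto intro!: derivative_eq_intros)
    then show ?case unfolding y10
      by (intro exI[of _ 0] exI[of _ "- (s * exp (s * z))"]) (simp add: p_def \<phi>0)
  next
    case (Suc n)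
    then obtain D1 D2 where D: "(y1 n has_field_derivative D1) (at z)" "(y2 n has_field_derivative D2) (at z)"
      "(1 - exp z) * D1 = - exp z * p n * \<delta> n * y1 n z + s * \<phi> n * y2 n z"
      "(1 - exp z) * D2 = exp z * p n * y1 n z + (s * (1 - exp z) - exp z * p n * \<delta> (n-1)) * y2 n z" by blast
    have yS: "y1 (Suc n) = (\<lambda>z. y1 n z + \<delta> n * y2 n z)" "y2 (Suc n) = (\<lambda>z. exp z / \<delta> n * y1 n z + y2 n z)"
      using y by auto
    have sf: "s * \<phi> (Suc n) = s * \<phi> n + s * \<delta> n" by (simp add: \<phi> distrib_left)
    note st = fuchsian_step[OF \<delta>(1)[of n] pS[of n] con'[of n] sf p4[of n] D(3,4)]
    show ?case
    proof (intro exI conjI)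
      show "(y1 (Suc n) has_field_derivative D1 + \<delta> n * D2) (at z)"
        unfolding yS using D(1,2) by (auto intro!: derivative_eq_intros)
      show "(y2 (Suc n) has_field_derivative exp z / \<delta> n * y1 n z + exp z / \<delta> n * D1 + D2) (at z)"
        unfolding yS using D(1,2) \<delta>(1)[of n] by (auto intro!: derivative_eq_intros simp: add_divide_distrib)
      show "(1 - exp z) * (D1 + \<delta> n * D2) = - exp z * p (Suc n) * \<delta> (Suc n) * y1 (Suc n) z + s * \<phi> (Suc n) * y2 (Suc n) z"
        unfolding y by (rule st(1))
      show "(1 - exp z) * (exp z / \<delta> n * y1 n z + exp z / \<delta> n * D1 + D2) = exp z * p (Suc n) * y1 (Suc n) z
          + (s * (1 - exp z) - exp z * p (Suc n) * \<delta> (Suc n - 1)) * y2 (Suc n) z"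
        unfolding y diff_Suc_1 by (rule st(2))
    qed
  qed
  show ?thesis
  proof (induction n)
    case 0
    then show ?case
      by (intro exI[of _ "\<lambda>_. 1"] exI[of _ "\<lambda>z. - exp (s * z)"]) (auto simp: y0 intro!: holomorphic_intros)
  next
    case (Suc n)
    then obtain w1 w2 where w: "w1 holomorphic_on strip" "w2 holomorphic_on strip"
      "\<And>z. z \<in> strip \<Longrightarrow> y1 n z = (1 - exp z) ^ n * w1 z"
      "\<And>z. z \<in> strip \<Longrightarrow> y2 n z = (1 - exp z) ^ n * w2 z" by blast
    \<comment> \<open>For n = 0 the differential equation says nothing about the leading term; there
      w(0) = (1, -1) and \<open>\<delta> 0 = 1\<close> give the claim directly.\<close>
    have zero: "w1 0 + \<delta> n * w2 0 = 0"
    proof (cases n)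
      case 0
      have "1 = w1 0" "-1 = w2 0" using w(3)[of 0] w(4)[of 0] y0 0 by simp_all
      then show ?thesis using 0 \<delta>(2) by (metis mult_1 add.right_inverse)
    next
      case (Suc m)
      \<comment> \<open>The equation for the leading terms. It holds off 0, where the power of
        \<open>1 - exp z\<close> can be cancelled, and extends to 0 by continuity.\<close>
      define K where "K z = (1 - exp z) * deriv w1 z - of_nat n * exp z * w1 z
          - (- exp z * p n * \<delta> n * w1 z + s * \<phi> n * w2 z)" for z
      have K0: "K z = 0" if z: "z \<in> strip" "z \<noteq> 0" for z
      proof -
        let ?l = "1 - exp z"
        have l: "?l \<noteq> 0" using exp_neq_1_strip[OF z] by simp
        obtain D1 where D1: "(y1 n has_field_derivative D1) (at z)"
          "?l * D1 = - exp z * p n * \<delta> n * y1 n z + s * \<phi> n * y2 n z" using ode[of n z] by blast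
        have "(w1 has_field_derivative deriv w1 z) (at z)"
          using w(1) z open_strip by (metis holomorphic_derivI)
        moreover have "((\<lambda>z. (1 - exp z) ^ n) has_field_derivative of_nat n * (- exp z * ?l ^ m)) (at z)"
        proof -
          have "((\<lambda>z. 1 - exp z) has_field_derivative - exp z) (at z)"
            by (auto intro!: derivative_eq_intros)
          from DERIV_power[OF this, of n] show ?thesis
            unfolding Suc by (simp only: diff_Suc_Suc minus_nat.diff_0)
        qed
        ultimately have "((\<lambda>z. (1 - exp z) ^ n * w1 z) has_field_derivative
            of_nat n * (- exp z * ?l ^ m) * w1 z + deriv w1 z * ?l ^ n) (at z)"
          by (rule DERIV_mult[rotated])
        then have "(y1 n has_field_derivative
            of_nat n * (- exp z * ?l ^ m) * w1 z + deriv w1 z * ?l ^ n) (at z)"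
          by (rule has_field_derivative_transform_within_open[OF _ open_strip z(1)]) (simp add: w(3))
        then have "D1 = of_nat n * (- exp z * ?l ^ m) * w1 z + deriv w1 z * (?l * ?l ^ m)"
          using DERIV_unique[OF D1(1)] unfolding Suc power_Suc by blast
        moreover have "?l * D1 = - exp z * p n * \<delta> n * (?l * ?l ^ m * w1 z) + s * \<phi> n * (?l * ?l ^ m * w2 z)"
          using D1(2) unfolding w(3)[OF z(1)] w(4)[OF z(1)] unfolding Suc power_Suc .
        ultimately have "?l * ?l ^ m * K z = 0"
          unfolding K_def by (rule leading_order)
        then show ?thesis using l by simp
      qed
      have "K holomorphic_on strip"
      proof -
        have "deriv w1 holomorphic_on strip" by (rule holomorphic_deriv[OF w(1) open_strip])
        then show ?thesis
          unfolding K_def using w(1,2) by (intro holomorphic_intros open_strip)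
      qed
      then have "isCont K 0"
      proof -
        have "\<forall>z\<in>strip. isCont K z"
          using holomorphic_on_imp_continuous_on[OF \<open>K holomorphic_on strip\<close>]
          unfolding continuous_on_eq_continuous_at[OF open_strip] .
        then show ?thesis by simp
      qed
      then have "(K \<longlongrightarrow> K 0) (at 0)" by (simp add: isCont_def)
      moreover have "(K \<longlongrightarrow> 0) (at 0)"
      proof (rule tendsto_eventually)
        have "\<forall>\<^sub>F x in at 0. x \<in> strip - {0}"
          by (rule eventually_at_in_open[OF open_strip]) simp
        then show "\<forall>\<^sub>F x in at 0. K x = 0" by eventually_elim (use K0 in auto)
      qed
      ultimately have "K 0 = 0" by (rule LIM_unique)
      then have K: "p n * \<delta> n * w1 0 = of_nat n * w1 0 + s * \<phi> n * w2 0"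
      proof -
        have "K 0 = p n * \<delta> n * w1 0 - (of_nat n * w1 0 + s * \<phi> n * w2 0)"
          by (simp add: K_def)
        with \<open>K 0 = 0\<close> show ?thesis by simp
      qed
      have "of_nat n * (w1 0 + \<delta> n * w2 0) = 0"
      proof -
        have "p n * \<delta> (n-1) * (w1 0 + \<delta> n * w2 0) = 0"
        proof -
          have "p n * \<delta> (n-1) * (w1 0 + \<delta> n * w2 0)
              = p n * (\<delta> n + \<delta> (n-1)) * w1 0 + p n * \<delta> n * \<delta> (n-1) * w2 0 - p n * \<delta> n * w1 0"
            by (simp add: algebra_simps)
          also have "\<dots> = 0" unfolding p con'[symmetric] K by simp
          finally show ?thesis .
        qed
        moreover have "\<delta> (n - 1) \<noteq> 0" by (rule \<delta>(1))
        moreover have "p n \<noteq> 0" using p[of n] Suc by (metis mult_zero_left of_nat_eq_0_iff nat.distinct(2))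
        ultimately show ?thesis by simp
      qed
      then show ?thesis using Suc by (simp del: of_nat_Suc)
    qed
    define h1 where "h1 z = w1 z + \<delta> n * w2 z" for z
    define h2 where "h2 z = exp z / \<delta> n * w1 z + w2 z" for z
    have h: "h1 holomorphic_on strip" "h2 holomorphic_on strip"
      unfolding h1_def h2_def
      by (intro holomorphic_on_add holomorphic_on_mult holomorphic_on_divide holomorphic_on_const
            holomorphic_on_exp w(1) w(2) \<delta>(1))+
    have "h1 0 = 0" using zero by (simp add: h1_def)
    \<comment> \<open>At \<lambda> = 1 the rows of the Lax matrix are proportional, so one condition
      makes both components vanish.\<close>
    have "\<delta> n * h2 0 = h1 0" using \<delta>(1)[of n] by (simp add: h1_def h2_def distrib_left)
    then have "h2 0 = 0" using \<open>h1 0 = 0\<close> \<delta>(1)[of n] by simp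
    obtain g1 where g1: "g1 holomorphic_on strip" "\<And>z. z \<in> strip \<Longrightarrow> h1 z = (1 - exp z) * g1 z"
      using divide_one_minus_exp[OF h(1) \<open>h1 0 = 0\<close>] by blast
    obtain g2 where g2: "g2 holomorphic_on strip" "\<And>z. z \<in> strip \<Longrightarrow> h2 z = (1 - exp z) * g2 z"
      using divide_one_minus_exp[OF h(2) \<open>h2 0 = 0\<close>] by blast
    have "y1 (Suc n) z = (1 - exp z) ^ Suc n * g1 z" "y2 (Suc n) z = (1 - exp z) ^ Suc n * g2 z"
      if z: "z \<in> strip" for z
    proof -
      have "y1 (Suc n) z = (1 - exp z) ^ n * h1 z"
        unfolding y w(3)[OF z] w(4)[OF z] h1_def by (simp only: distrib_left mult_ac)
      then show "y1 (Suc n) z = (1 - exp z) ^ Suc n * g1 z" using g1(2)[OF z] by simp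
      have "y2 (Suc n) z = (1 - exp z) ^ n * h2 z"
        unfolding y w(3)[OF z] w(4)[OF z] h2_def by (simp only: distrib_left mult_ac)
      then show "y2 (Suc n) z = (1 - exp z) ^ Suc n * g2 z" using g2(2)[OF z] by simp
    qed
    with g1(1) g2(1) show ?case by blast
  qed
qed

text \<open>Since \<open>f1\<close> and \<open>f2\<close> have no common zero, the sets where
  \<open>f1\<close> or \<open>f2\<close> is nonzero cover \<open>T\<close>. Dividing by the
  nonvanishing factor on each gives two quotients that agree on the overlap.\<close>

lemma combine_zeros:
  fixes f1 f2 g1 g2 :: "complex \<Rightarrow> complex"
  assumes T: "open T" and hol: "f1 holomorphic_on T" "f2 holomorphic_on T" "g1 holomorphic_on T" "g2 holomorphic_on T"
    and eq: "\<And>z. z \<in> T \<Longrightarrow> f1 z ^ n * g1 z = f2 z ^ n * g2 z"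
    and disj: "\<And>z. z \<in> T \<Longrightarrow> f1 z \<noteq> 0 \<or> f2 z \<noteq> 0"
  obtains G where "G holomorphic_on T" "\<And>z. z \<in> T \<Longrightarrow> f1 z ^ n * g1 z = (f1 z * f2 z) ^ n * G z"
proof -
  define T1 where "T1 = T \<inter> f1 -` (- {0})"
  define T2 where "T2 = T \<inter> f2 -` (- {0})"
  have op: "open T1" "open T2"
    unfolding T1_def T2_def using hol T
    by (auto intro!: continuous_open_preimage holomorphic_on_imp_continuous_on)
  have sub: "T1 \<subseteq> T" "T2 \<subseteq> T" and un: "T1 \<union> T2 = T"
    using disj by (auto simp: T1_def T2_def)
  define G where "G z = (if z \<in> T1 then g2 z / f1 z ^ n else g1 z / f2 z ^ n)" for z
  have "(\<lambda>z. g2 z / f1 z ^ n) holomorphic_on T1"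
    by (intro holomorphic_on_divide holomorphic_on_power hol[THEN holomorphic_on_subset] sub) (auto simp: T1_def)
  moreover have "(\<lambda>z. g1 z / f2 z ^ n) holomorphic_on T2"
    by (intro holomorphic_on_divide holomorphic_on_power hol[THEN holomorphic_on_subset] sub) (auto simp: T2_def)
  moreover have "g2 z / f1 z ^ n = g1 z / f2 z ^ n" if "z \<in> T1" "z \<in> T2" for z
    using eq[of z] that by (simp add: T1_def T2_def frac_eq_eq mult.commute)
  ultimately have "G holomorphic_on T1 \<union> T2"
    unfolding G_def using op by (intro holomorphic_on_If_Un)
  moreover have "f1 z ^ n * g1 z = (f1 z * f2 z) ^ n * G z" if z: "z \<in> T" for z
  proof (cases "z \<in> T1")
    case True
    then show ?thesis using eq[OF z] by (simp add: G_def T1_def power_mult_distrib)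
  next
    case False
    then have "z \<in> T2" using z un by auto
    then show ?thesis using False by (simp add: G_def T2_def power_mult_distrib)
  qed
  ultimately show thesis using that un by simp
qed

section \<open>Zero curvature, the wave function and its diagonal\<close>

definition lax :: "complex \<Rightarrow> complex \<Rightarrow> complex \<times> complex \<Rightarrow> complex \<times> complex" where
  "lax \<delta> l v = (fst v + \<delta> * snd v, l / \<delta> * fst v + snd v)"

text \<open>The zero curvature condition. Scaling the spectral parameter by \<open>q\<close> on the
  vertical edges encodes the cross-ratio, and the two ways around a quadrilateral then
  agree.\<close>

lemma lax_commute:
  assumes nz: "d \<noteq> 0" "e \<noteq> 0" "d' \<noteq> 0" "e' \<noteq> 0" and cl: "d + e' = e + d'" and q: "q * d * d' = e * e'"
  shows "lax e' (q * l) (lax d l v) = lax d' l (lax e (q * l) v)"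
proof -
  obtain p w where v: "v = (p, w)" by (cases v)
  obtain D D' where D: "D = 1 / d" "D' = 1 / d'" by simp
  have DD: "d * D = 1" "d' * D' = 1" using nz by (simp_all add: D)
  have "q * l / e' = l * (e * D * D')" "q * l / e = l * (e' * D * D')" "l / d = l * D" "l / d' = l * D'"
    using nz q by (simp_all add: D field_simps)
  then show ?thesis
    unfolding v lax_def fst_conv snd_conv prod.inject using cl DD by (intro conjI; algebra)
qed

lemma lax_scale: "lax \<delta> l (k * p, k * w) = (k * (p + \<delta> * w), k * (l / \<delta> * p + w))"
  by (simp add: lax_def distrib_left mult_ac)

definition vanishes :: "(complex \<Rightarrow> complex) \<Rightarrow> nat \<Rightarrow> (complex \<Rightarrow> complex \<times> complex) \<Rightarrow> bool" where
  "vanishes k n v \<longleftrightarrow> (\<exists>w1 w2. w1 holomorphic_on strip \<and> w2 holomorphic_on strip \<and>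
     (\<forall>z\<in>strip. v z = (k z ^ n * w1 z, k z ^ n * w2 z)))"

lemma vanishesI:
  assumes "w1 holomorphic_on strip" "w2 holomorphic_on strip"
    and "\<And>z. z \<in> strip \<Longrightarrow> fst (v z) = k z ^ n * w1 z" "\<And>z. z \<in> strip \<Longrightarrow> snd (v z) = k z ^ n * w2 z"
  shows "vanishes k n v"
  unfolding vanishes_def
proof (rule exI[of _ w1], rule exI[of _ w2], intro conjI ballI)
  fix z assume "z \<in> strip"
  from assms(3,4)[OF this] show "v z = (k z ^ n * w1 z, k z ^ n * w2 z)" by (simp add: prod_eq_iff)
qed (use assms in auto)

lemma vanishes_lax:
  assumes "vanishes k n v" "l holomorphic_on strip" "\<delta> \<noteq> 0"
  shows "vanishes k n (\<lambda>z. lax \<delta> (l z) (v z))"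
proof -
  obtain w1 w2 where w: "w1 holomorphic_on strip" "w2 holomorphic_on strip"
     "\<And>z. z \<in> strip \<Longrightarrow> v z = (k z ^ n * w1 z, k z ^ n * w2 z)"
    using assms(1) unfolding vanishes_def by blast
  have "(\<lambda>z. w1 z + \<delta> * w2 z) holomorphic_on strip" "(\<lambda>z. l z / \<delta> * w1 z + w2 z) holomorphic_on strip"
    using w assms by (intro holomorphic_intros; simp)+
  moreover have "lax \<delta> (l z) (v z) = (k z ^ n * (w1 z + \<delta> * w2 z), k z ^ n * (l z / \<delta> * w1 z + w2 z))"
    if "z \<in> strip" for z unfolding w(3)[OF that] by (rule lax_scale)
  ultimately show ?thesis unfolding vanishes_def by blast
qed

lemma coeff_mult_linear:
  "coeff (p * [:x, y:]) k = x * coeff p k + (case k of 0 \<Rightarrow> 0 | Suc j \<Rightarrow> y * coeff p j)"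
  for x y :: "'a :: comm_ring_1"
  by (simp add: coeff_pCons split: nat.splits)

context discrete_power
begin

text \<open>\<open>z\<close> is the logarithm of the spectral parameter, which turns
  \<open>\<lambda>\<^sup>s\<close> into an entire function. The recursion fixes one path to each
  vertex, along the horizontal axis and then up; \<open>Y_right\<close> provides the independence of
  the path.\<close>

fun Y :: "nat \<Rightarrow> nat \<Rightarrow> complex \<Rightarrow> complex \<times> complex" where
  "Y 0 0 z = (1, - exp (of_real s * z))"
| "Y (Suc n) 0 z = lax (d n 0) (exp z) (Y n 0 z)"
| "Y n (Suc m) z = lax (e n m) (b\<^sup>2 * exp z) (Y n m z)"

lemma Y_right: "Y (Suc n) m z = lax (d n m) (exp z) (Y n m z)"
proof (induction m)
  case (Suc m)
  have "Y (Suc n) (Suc m) z = lax (e (Suc n) m) (b\<^sup>2 * exp z) (lax (d n m) (exp z) (Y n m z))"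
    using Suc by simp
  also have "\<dots> = lax (d n (Suc m)) (exp z) (lax (e n m) (b\<^sup>2 * exp z) (Y n m z))"
    by (rule lax_commute) (use edges_nz closure quad in auto)
  finally show ?case by simp
qed simp

text \<open>The order n is reached on the horizontal axis; the vertical matrices act from the left
  and preserve it.\<close>

lemma Y_vanishes_1: "vanishes (\<lambda>z. 1 - exp z) n (Y n m)"
proof (induction m)
  case 0
  have "\<exists>w1 w2. w1 holomorphic_on strip \<and> w2 holomorphic_on strip \<and>
     (\<forall>z\<in>strip. fst (Y n 0 z) = (1 - exp z) ^ n * w1 z \<and> snd (Y n 0 z) = (1 - exp z) ^ n * w2 z)"
  proof (rule axis_vanishing[where \<delta>="\<lambda>n. d n 0" and \<phi>="\<lambda>n. f n 0" and s="of_real s"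
        and ?y1.0="\<lambda>n z. fst (Y n 0 z)" and ?y2.0="\<lambda>n z. snd (Y n 0 z)"])
    show "of_real s * f n 0 = of_nat n / (d n 0 + d (n-1) 0) * d n 0 * d (n-1) 0" for n
      using constraint'[of n 0] by (simp add: hwt_def vwt_def)
    show "d 0 0 = 1" by (simp add: hedge_def f10)
    show "f (Suc n) 0 = f n 0 + d n 0" for n by (simp add: hedge_def)
    show "d n 0 + d (n-1) 0 \<noteq> 0" if "n \<noteq> 0" for n using hsum_nz that by blast
  qed (simp_all add: edges_nz lax_def)
  then obtain w1 w2 where w: "w1 holomorphic_on strip" "w2 holomorphic_on strip"
     "\<And>z. z \<in> strip \<Longrightarrow> fst (Y n 0 z) = (1 - exp z) ^ n * w1 z"
     "\<And>z. z \<in> strip \<Longrightarrow> snd (Y n 0 z) = (1 - exp z) ^ n * w2 z" by blast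
  show ?case by (rule vanishesI[OF w])
next
  case (Suc m)
  have "vanishes (\<lambda>z. 1 - exp z) n (\<lambda>z. lax (e n m) (b\<^sup>2 * exp z) (Y n m z))"
    using Suc edges_nz by (intro vanishes_lax holomorphic_intros) auto
  then show ?case by simp
qed

lemma b2_exp: "b\<^sup>2 * exp (z - 2 * \<i> * of_real a) = exp z"
  unfolding b_def cis_conv_exp by (simp flip: exp_double exp_add)

text \<open>The shift by 2 i a turns \<open>b\<^sup>2 * exp z\<close> into \<open>exp z\<close>.
  After division of all edges by the first one, \<open>\<kappa>\<close>, the vertical axis looks
  like the horizontal one, and the factor \<open>\<kappa>\<close> in the second component restores
  the initial vector (1, - exp (s z)).\<close>

lemma Y_vanishes_2: "vanishes (\<lambda>z. 1 - exp z) m (\<lambda>z. Y n m (z - 2 * \<i> * of_real a))"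
proof (induction n)
  case 0
  define \<kappa> where "\<kappa> = cis (c * a)"
  let ?Y = "\<lambda>m z. Y 0 m (z - 2 * \<i> * of_real a)"
  have \<kappa>: "\<kappa> \<noteq> 0" by (simp add: \<kappa>_def)
  have e00: "e 0 0 = \<kappa>" by (simp add: vedge_def f01 \<kappa>_def)
  have "\<exists>w1 w2. w1 holomorphic_on strip \<and> w2 holomorphic_on strip \<and>
     (\<forall>z\<in>strip. fst (?Y m z) = (1 - exp z) ^ m * w1 z \<and> \<kappa> * snd (?Y m z) = (1 - exp z) ^ m * w2 z)"
  proof (rule axis_vanishing[where \<delta>="\<lambda>m. e 0 m / \<kappa>" and \<phi>="\<lambda>m. f 0 m / \<kappa>" and s="of_real s"
        and ?y1.0="\<lambda>m z. fst (?Y m z)" and ?y2.0="\<lambda>m z. \<kappa> * snd (?Y m z)"])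
    fix n :: nat and z :: complex
    show "e 0 n / \<kappa> \<noteq> 0" using edges_nz \<kappa> by simp
    show "e 0 0 / \<kappa> = 1" using e00 \<kappa> by simp
    show "f 0 0 / \<kappa> = 0" by simp
    show "f 0 (Suc n) / \<kappa> = f 0 n / \<kappa> + e 0 n / \<kappa>" by (simp add: vedge_def diff_divide_distrib)
    show "e 0 n / \<kappa> + e 0 (n-1) / \<kappa> \<noteq> 0" if "n \<noteq> 0"
      using vsum_nz[OF that, of 0] \<kappa> by (simp flip: add_divide_distrib)
    show "of_real s * (f 0 n / \<kappa>) = of_nat n / (e 0 n / \<kappa> + e 0 (n-1) / \<kappa>) * (e 0 n / \<kappa>) * (e 0 (n-1) / \<kappa>)"
      using constraint'[of 0 n] \<kappa> by (simp add: hwt_def vwt_def flip: add_divide_distrib)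
    show "fst (?Y 0 z) = 1" by simp
    have "\<kappa> = exp (of_real s * (2 * \<i> * of_real a))"
      by (simp add: \<kappa>_def cis_conv_exp s_def mult_ac)
    then have "\<kappa> * exp (of_real s * (z - 2 * \<i> * of_real a)) = exp (of_real s * z)"
      by (simp only: flip: exp_add) (simp add: algebra_simps)
    then show "\<kappa> * snd (?Y 0 z) = - exp (of_real s * z)" by simp
    show "fst (?Y (Suc n) z) = fst (?Y n z) + e 0 n / \<kappa> * (\<kappa> * snd (?Y n z))"
      using \<kappa> by (simp add: lax_def)
    show "\<kappa> * snd (?Y (Suc n) z) = exp z / (e 0 n / \<kappa>) * fst (?Y n z) + \<kappa> * snd (?Y n z)"
      unfolding Y.simps lax_def b2_exp by (simp add: distrib_left)
  qed
  then obtain w1 w2 where w: "w1 holomorphic_on strip" "w2 holomorphic_on strip"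
     "\<And>z. z \<in> strip \<Longrightarrow> fst (?Y m z) = (1 - exp z) ^ m * w1 z"
     "\<And>z. z \<in> strip \<Longrightarrow> \<kappa> * snd (?Y m z) = (1 - exp z) ^ m * w2 z" by blast
  have "snd (?Y m z) = (1 - exp z) ^ m * (w2 z / \<kappa>)" if "z \<in> strip" for z
    using w(4)[OF that] \<kappa> by (simp add: eq_divide_eq mult.commute)
  moreover have "(\<lambda>z. w2 z / \<kappa>) holomorphic_on strip" using w(2) \<kappa> by (intro holomorphic_intros) auto
  ultimately show ?case using vanishesI[OF w(1) _ w(3)] by blast
next
  case (Suc n)
  have "vanishes (\<lambda>z. 1 - exp z) m (\<lambda>z. lax (d n m) (exp (z - 2 * \<i> * of_real a)) (Y n m (z - 2 * \<i> * of_real a)))"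
    using Suc edges_nz by (intro vanishes_lax holomorphic_intros) auto
  then show ?case by (simp only: Y_right)
qed

definition \<rho> :: "nat \<Rightarrow> complex" where "\<rho> n = of_real (r (Suc n) (Suc n) / r n n)"

text \<open>A column of the product of Lax matrices along the diagonal, two edges per step, as
  polynomials in \<mu> = exp z when \<open>Y\<close> is taken at z - i a. This centring makes the
  diagonal entries 1 + \<open>\<rho> n\<close> \<mu> and 1 + \<mu> / \<open>\<rho> n\<close> of each
  step real polynomials.\<close>

fun col :: "complex poly \<times> complex poly \<Rightarrow> nat \<Rightarrow> complex poly \<times> complex poly" where
  "col v 0 = v"
| "col v (Suc n) = (fst (col v n) * [:1, \<rho> n:] + smult (d n n + e (Suc n) n) (snd (col v n)),
     fst (col v n) * [:0, (b\<^sup>2 / e (Suc n) n + 1 / d n n) / b:] + snd (col v n) * [:1, 1 / \<rho> n:])"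

lemma \<rho>: "e (Suc n) n = \<rho> n * d n n * b" "\<rho> n \<noteq> 0"
proof -
  have "u (Suc n) (Suc n) = of_real (r (Suc n) (Suc n))" "u n n = of_real (r n n)"
    by (auto intro!: u_even)
  then show "e (Suc n) n = \<rho> n * d n n * b"
    using r_nz[of n n] by (simp add: e_eq d_eq \<rho>_def)
  show "\<rho> n \<noteq> 0" using r_nz[of n n] r_nz[of "Suc n" "Suc n"] by (simp add: \<rho>_def)
qed

lemma Y_diag:
  fixes z
  defines "k \<equiv> exp (of_real s * (z - \<i> * of_real a))" and "\<mu> \<equiv> exp z"
  shows "Y n n (z - \<i> * of_real a) =
    (poly (fst (col (1, 0) n)) \<mu> - k * poly (fst (col (0, 1) n)) \<mu>,
     poly (snd (col (1, 0) n)) \<mu> - k * poly (snd (col (0, 1) n)) \<mu>)"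
proof (induction n)
  case 0 show ?case by (simp add: k_def)
next
  case (Suc n)
  define l where "l = exp (z - \<i> * of_real a)"
  have l: "\<mu> = l * b" unfolding l_def \<mu>_def b_def cis_conv_exp by (simp flip: exp_add)
  let ?e = "e (Suc n) n" and ?d = "d n n"
  have nz: "?e \<noteq> 0" "?d \<noteq> 0" using edges_nz by auto
  have 1: "?e * (l / ?d) = \<rho> n * \<mu>" using nz unfolding \<rho>(1) l by simp
  have 2: "b\<^sup>2 * l / ?e * ?d = \<mu> / \<rho> n" using nz \<rho>(2)[of n] unfolding \<rho>(1) l by (simp add: power2_eq_square)
  have 3: "b\<^sup>2 * l / ?e + l / ?d = (b\<^sup>2 / ?e + 1 / ?d) / b * \<mu>"
  proof -
    have "X / b * (l * b) = X * l" for X by simp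
    then have "(b\<^sup>2 / ?e + 1 / ?d) / b * \<mu> = (b\<^sup>2 / ?e + 1 / ?d) * l" unfolding l .
    then show ?thesis by (simp only: distrib_right times_divide_eq_left mult_1)
  qed
  have step: "lax ?e (b\<^sup>2 * l) (lax ?d l (x, w)) = ((1 + \<rho> n * \<mu>) * x + (?d + ?e) * w,
      (b\<^sup>2 / ?e + 1 / ?d) / b * \<mu> * x + (1 + \<mu> / \<rho> n) * w)" for x w
    unfolding lax_def fst_conv snd_conv 1[symmetric] 2[symmetric] 3[symmetric] by (simp add: algebra_simps add_divide_distrib)
  have Y: "Y (Suc n) (Suc n) (z - \<i> * of_real a) = lax ?e (b\<^sup>2 * l) (lax ?d l (Y n n (z - \<i> * of_real a)))"
    by (simp add: Y_right l_def)
  obtain \<kappa> where \<kappa>: "(b\<^sup>2 / ?e + 1 / ?d) / b = \<kappa>" by simp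
  show ?case unfolding Y Suc step col.simps fst_conv snd_conv \<kappa> by (simp add: algebra_simps)
qed

text \<open>The leading coefficient of the upper left entry is the telescoping product of the ratios
  \<open>\<rho>\<close>, which starts from \<open>r 0 0 = 1\<close>. The lower entry has too small a
  degree to contribute to it.\<close>

lemma col_coeffs:
  "(\<forall>k>n. coeff (fst (col (1, 0) n)) k = 0 \<and> coeff (snd (col (1, 0) n)) k = 0) \<and>
   (\<forall>k\<ge>n. coeff (fst (col (0, 1) n)) k = 0) \<and> (\<forall>k>n. coeff (snd (col (0, 1) n)) k = 0) \<and>
   coeff (fst (col (1, 0) n)) 0 = 1 \<and> coeff (snd (col (1, 0) n)) 0 = 0 \<and>
   coeff (fst (col (1, 0) n)) n = of_real (r n n)"
proof (induction n)
  case 0 show ?case by (auto simp: r_def coeff_eq_0)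
next
  case (Suc n)
  have "\<rho> n * of_real (r n n) = of_real (r (Suc n) (Suc n))" using r_nz[of n n] by (simp add: \<rho>_def)
  with Suc show ?case by (auto simp: coeff_mult_linear simp del: mult_pCons_right split: nat.splits)
qed

lemma diag_pos: "r n n > 0"
proof (cases "n = 0")
  case True then show ?thesis by (simp add: r_def)
next
  case False
  \<comment> \<open>This width keeps both z - i a and z + i a in the strip on which the zeros of
    \<open>Y\<close> were divided out.\<close>
  define T where "T = {z. \<bar>Im z\<bar> < 2 * pi - a}"
  have "open T" unfolding T_def by (rule open_strip)
  obtain v1 v2 where v: "v1 holomorphic_on strip" "\<And>z. z \<in> strip \<Longrightarrow> Y n n z = ((1 - exp z) ^ n * v1 z, (1 - exp z) ^ n * v2 z)"
    using Y_vanishes_1[of n n] unfolding vanishes_def by blast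
  obtain w1 w2 where w: "w1 holomorphic_on strip"
     "\<And>z. z \<in> strip \<Longrightarrow> Y n n (z - 2 * \<i> * of_real a) = ((1 - exp z) ^ n * w1 z, (1 - exp z) ^ n * w2 z)"
    using Y_vanishes_2[of n n] unfolding vanishes_def by blast
  have sub: "z - \<i> * of_real a \<in> strip" "z + \<i> * of_real a \<in> strip" if "z \<in> T" for z
    using that a by (auto simp: T_def)
  have 1: "fst (Y n n (z - \<i> * of_real a)) = (1 - exp (z - \<i> * of_real a)) ^ n * v1 (z - \<i> * of_real a)" if "z \<in> T" for z
    using v(2)[OF sub(1)[OF that]] by simp
  have 2: "fst (Y n n (z - \<i> * of_real a)) = (1 - exp (z + \<i> * of_real a)) ^ n * w1 (z + \<i> * of_real a)" if "z \<in> T" for z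
  proof -
    have "z + \<i> * of_real a - 2 * \<i> * of_real a = z - \<i> * of_real a" by simp
    then show ?thesis using w(2)[OF sub(2)[OF that]] by simp
  qed
  obtain G where G: "G holomorphic_on T" "\<And>z. z \<in> T \<Longrightarrow>
     (1 - exp (z - \<i> * of_real a)) ^ n * v1 (z - \<i> * of_real a)
      = ((1 - exp (z - \<i> * of_real a)) * (1 - exp (z + \<i> * of_real a))) ^ n * G z"
  proof (rule combine_zeros[OF \<open>open T\<close>])
    show "(\<lambda>z. 1 - exp (z - \<i> * of_real a)) holomorphic_on T" "(\<lambda>z. 1 - exp (z + \<i> * of_real a)) holomorphic_on T"
      by (intro holomorphic_intros)+
    show "(\<lambda>z. v1 (z - \<i> * of_real a)) holomorphic_on T"
    proof -
      have "(\<lambda>z. z - \<i> * of_real a) holomorphic_on T" by (intro holomorphic_intros)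
      moreover have "(\<lambda>z. z - \<i> * of_real a) ` T \<subseteq> strip" using sub(1) by blast
      ultimately have "(v1 \<circ> (\<lambda>z. z - \<i> * of_real a)) holomorphic_on T"
        using holomorphic_on_compose_gen v(1) by blast
      then show ?thesis by (simp add: o_def)
    qed
    show "(\<lambda>z. w1 (z + \<i> * of_real a)) holomorphic_on T"
    proof -
      have "(\<lambda>z. z + \<i> * of_real a) holomorphic_on T" by (intro holomorphic_intros)
      moreover have "(\<lambda>z. z + \<i> * of_real a) ` T \<subseteq> strip" using sub(2) by blast
      ultimately have "(w1 \<circ> (\<lambda>z. z + \<i> * of_real a)) holomorphic_on T"
        using holomorphic_on_compose_gen w(1) by blast
      then show ?thesis by (simp add: o_def)
    qed
    show "(1 - exp (z - \<i> * of_real a)) ^ n * v1 (z - \<i> * of_real a) = (1 - exp (z + \<i> * of_real a)) ^ n * w1 (z + \<i> * of_real a)"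
      if "z \<in> T" for z using 1[OF that] 2[OF that] by simp
    \<comment> \<open>The two exponentials differ by the factor \<open>b\<^sup>2 \<noteq> 1\<close>,
      so they cannot both equal 1.\<close>
    show "1 - exp (z - \<i> * of_real a) \<noteq> 0 \<or> 1 - exp (z + \<i> * of_real a) \<noteq> 0" for z
    proof (rule ccontr)
      assume "\<not> ?thesis"
      then have "exp (z - \<i> * of_real a) = 1" "exp (z + \<i> * of_real a) = 1" by auto
      moreover have "exp (z + \<i> * of_real a) = b\<^sup>2 * exp (z - \<i> * of_real a)"
        unfolding b_def cis_conv_exp by (simp add: add.commute flip: exp_double exp_add)
      ultimately show False using b2_neq_1 by simp
    qed
  qed (use that in blast)
  show ?thesis
  proof (rule orthogonality_sign[OF s _ a, where A="fst (col (1,0) n)" and B="fst (col (0,1) n)" and n=n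
        and \<kappa>="exp (- of_real s * \<i> * of_real a)" and G=G])
    show "1 \<le> n" using False by simp
    show "degree (fst (col (1, 0) n)) \<le> n" using col_coeffs[of n] by (intro degree_le) auto
    show "degree (fst (col (0, 1) n)) \<le> n - 1" using col_coeffs[of n] False by (intro degree_le) auto
    show "coeff (fst (col (1, 0) n)) 0 = 1" "coeff (fst (col (1, 0) n)) n = of_real (r n n)"
      using col_coeffs[of n] by auto
    show "G holomorphic_on {z. \<bar>Im z\<bar> < 2 * pi - a}" using G(1) by (simp add: T_def)
    fix z assume "\<bar>Im z\<bar> < 2 * pi - a"
    then have z: "z \<in> T" by (simp add: T_def)
    have k: "exp (of_real s * (z - \<i> * of_real a)) = exp (- of_real s * \<i> * of_real a) * exp (of_real s * z)"
      by (simp add: algebra_simps flip: exp_add)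
    show "poly (fst (col (1, 0) n)) (exp z) - exp (- of_real s * \<i> * of_real a) * exp (of_real s * z) * poly (fst (col (0, 1) n)) (exp z)
       = ((1 - exp (z - \<i> * of_real a)) * (1 - exp (z + \<i> * of_real a))) ^ n * G z"
      using 1[OF z] G(2)[OF z] unfolding Y_diag fst_conv k by simp
  qed
qed

end

section \<open>Kites and sectors\<close>

definition sector :: "complex \<Rightarrow> real \<Rightarrow> real \<Rightarrow> complex set" where
  "sector A \<phi> \<psi> = {A + of_real t * cis \<theta> | t \<theta>. t > 0 \<and> \<phi> < \<theta> \<and> \<theta> < \<psi>}"

lemma sectorI: "t > 0 \<Longrightarrow> \<phi> < \<theta> \<Longrightarrow> \<theta> < \<psi> \<Longrightarrow> A + of_real t * cis \<theta> \<in> sector A \<phi> \<psi>"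
  by (auto simp: sector_def)

lemma polar_unique:
  assumes "of_real t * cis x = of_real t' * cis y" "t > 0" "t' > 0"
  shows "t = t'" "cis x = cis y"
proof -
  have "norm (of_real t * cis x) = norm (of_real t' * cis y)" using assms(1) by simp
  then show "t = t'" using assms(2,3) by (simp add: norm_mult)
  then show "cis x = cis y" using assms by simp
qed

lemma sector_disjoint:
  assumes "\<phi>3 - \<phi>1 \<le> 2 * pi"
  shows "sector A \<phi>1 \<phi>2 \<inter> sector A \<phi>2 \<phi>3 = {}"
proof (rule ccontr)
  assume "\<not> ?thesis"
  then obtain p where "p \<in> sector A \<phi>1 \<phi>2" "p \<in> sector A \<phi>2 \<phi>3" by blast
  then obtain t x t' y where p: "p = A + of_real t * cis x" "p = A + of_real t' * cis y"
    and t: "t > 0" "t' > 0" and xy: "\<phi>1 < x" "x < \<phi>2" "\<phi>2 < y" "y < \<phi>3"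
    unfolding sector_def by blast
  have "cis x = cis y" using polar_unique(2)[of t x t' y] p t by simp
  then have "cis (y - x) = 1" by (simp flip: cis_divide)
  then have "cos (y - x) = 1" by (metis cis.simps(1) one_complex.simps(1))
  then obtain n :: int where n: "y - x = of_int n * 2 * pi" by (auto simp: cos_one_2pi_int)
  have "0 < y - x" "y - x < 2 * pi" using xy assms by linarith+
  then have "0 < real_of_int n * (2 * pi)" "real_of_int n * (2 * pi) < 1 * (2 * pi)" unfolding n by simp_all
  then have "0 < real_of_int n" "real_of_int n < 1"
    by (simp_all only: zero_less_mult_iff mult_less_cancel_right) auto
  then have "0 < n" "n < 1" by simp_all
  then show False by simp
qed

lemma winding_number_zero_ray:
  assumes "path \<gamma>" "pathfinish \<gamma> = pathstart \<gamma>" "p \<noteq> A"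
    and ray: "\<And>t. t \<ge> 1 \<Longrightarrow> A + of_real t * (p - A) \<notin> path_image \<gamma>"
  shows "winding_number \<gamma> p = 0"
proof -
  define R where "R = (\<lambda>t. A + of_real t * (p - A)) ` {1..}"
  have conn: "connected R"
    unfolding R_def by (intro connected_continuous_image continuous_intros) auto
  have "p \<in> R" unfolding R_def by (rule image_eqI[of _ _ 1]) auto
  moreover have "R \<subseteq> - path_image \<gamma>" using ray by (auto simp: R_def)
  ultimately have sub: "R \<subseteq> connected_component_set (- path_image \<gamma>) p"
    using conn by (intro connected_component_maximal)
  have "\<not> bounded R"
  proof
    assume "bounded R"
    then obtain B where B: "\<And>x. x \<in> R \<Longrightarrow> norm x \<le> B" by (auto simp: bounded_iff)
    define t where "t = max 1 ((\<bar>B\<bar> + norm A + 1) / norm (p - A))"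
    have pos: "norm (p - A) > 0" using assms(3) by simp
    have "norm (A + of_real t * (p - A)) \<le> B" by (rule B) (auto simp: R_def t_def)
    moreover have "norm (of_real t * (p - A)) - norm A \<le> norm (A + of_real t * (p - A))"
      by (metis add.commute norm_diff_ineq)
    moreover have "\<bar>B\<bar> + norm A + 1 \<le> t * norm (p - A)"
      using pos by (simp add: t_def max_def field_simps)
    moreover have "norm (of_real t * (p - A)) = t * norm (p - A)"
      by (simp add: norm_mult t_def)
    ultimately show False by linarith
  qed
  then have "\<not> bounded (connected_component_set (- path_image \<gamma>) p)"
    using sub bounded_subset by blast
  then have "p \<in> outside (path_image \<gamma>)" by (simp add: outside)
  then show ?thesis using assms(1,2) by (intro winding_number_zero_in_outside)
qed

text \<open>The sector is a cone at \<open>A\<close> and the two segments are star-shaped about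
  \<open>A\<close>. If \<open>p\<close> avoids them, so does the part of the ray from
  \<open>A\<close> that lies beyond \<open>p\<close>, and \<open>p\<close> escapes to infinity
  without meeting the path. Neither convexity nor simplicity of the path enters.\<close>

lemma winding_in_sector:
  assumes path: "path \<gamma>" "pathfinish \<gamma> = pathstart \<gamma>"
    and im: "path_image \<gamma> \<subseteq> closed_segment A P \<union> closed_segment A Q \<union> sector A \<phi> \<psi>"
    and seg: "closed_segment A P \<subseteq> path_image \<gamma>" "closed_segment A Q \<subseteq> path_image \<gamma>"
    and p: "p \<notin> path_image \<gamma>" "winding_number \<gamma> p \<noteq> 0"
  shows "p \<in> sector A \<phi> \<psi>"
proof (rule ccontr)
  assume np: "p \<notin> sector A \<phi> \<psi>"
  have "p \<noteq> A" using p(1) seg(1) by auto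
  have scale: "p = A + of_real (1 / t) * (A + of_real t * (p - A) - A)" if "t \<ge> 1" for t
    using that by simp
  have noseg: "A + of_real t * (p - A) \<notin> closed_segment A X"
    if t: "t \<ge> 1" and X: "closed_segment A X \<subseteq> path_image \<gamma>" for t X
  proof
    assume "A + of_real t * (p - A) \<in> closed_segment A X"
    then obtain v where v: "0 \<le> v" "v \<le> 1" "A + of_real t * (p - A) = (1 - v) *\<^sub>R A + v *\<^sub>R X"
      by (auto simp: in_segment)
    have "p = A + of_real (1 / t) * ((1 - v) *\<^sub>R A + v *\<^sub>R X - A)" using scale[OF t] v(3) by simp
    also have "\<dots> = (1 - v / t) *\<^sub>R A + (v / t) *\<^sub>R X" by (simp add: scaleR_conv_of_real algebra_simps)
    finally have "p = (1 - v / t) *\<^sub>R A + (v / t) *\<^sub>R X" .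
    moreover have "0 \<le> v / t" "v / t \<le> 1" using v t by auto
    ultimately have "p \<in> closed_segment A X" unfolding in_segment by blast
    then show False using X p(1) by blast
  qed
  have "winding_number \<gamma> p = 0"
  proof (rule winding_number_zero_ray[OF path \<open>p \<noteq> A\<close>])
    fix t :: real assume t: "t \<ge> 1"
    have "A + of_real t * (p - A) \<notin> sector A \<phi> \<psi>"
    proof
      assume "A + of_real t * (p - A) \<in> sector A \<phi> \<psi>"
      then obtain \<tau> \<theta> where \<tau>: "A + of_real t * (p - A) = A + of_real \<tau> * cis \<theta>" "\<tau> > 0" "\<phi> < \<theta>" "\<theta> < \<psi>"
        unfolding sector_def by blast
      have "p = A + of_real (1 / t) * (of_real \<tau> * cis \<theta>)" using scale[OF t] \<tau>(1) by simp
      then have "p = A + of_real (\<tau> / t) * cis \<theta>" by simp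
      moreover have "\<tau> / t > 0" using \<tau> t by simp
      ultimately show False using np sectorI \<tau> by metis
    qed
    then show "A + of_real t * (p - A) \<notin> path_image \<gamma>"
      using im noseg[OF t seg(1)] noseg[OF t seg(2)] by blast
  qed
  then show False using p(2) by simp
qed

lemma cone_polar:
  assumes \<theta>: "0 < \<theta>" "\<theta> < pi" and xy: "0 \<le> x" "0 < y"
  obtains \<tau> \<psi> where "of_real x + of_real y * cis \<theta> = of_real \<tau> * cis \<psi>" "\<tau> > 0" "0 < \<psi>" "\<psi> \<le> \<theta>"
    "x > 0 \<Longrightarrow> \<psi> < \<theta>"
proof -
  define w where "w = of_real x + of_real y * cis \<theta>"
  have sin: "sin \<theta> > 0" using \<theta> by (intro sin_gt_zero)
  have Im: "Im w > 0" using sin xy by (simp add: w_def)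
  then have w0: "w \<noteq> 0" by auto
  have w: "w = of_real (norm w) * cis (Arg w)" using w0 by (metis cis_Arg rcis_cmod_Arg rcis_def)
  have Arg: "0 < Arg w" "Arg w < pi" using Im Arg_lt_pi Arg_less_0
    by (metis Arg_eq_0_pi Arg_le_pi Im_complex_of_real complex_is_Real_iff less_irrefl less_le not_less)+
  \<comment> \<open>The left side is the norm of \<open>w\<close> times sin (\<theta> - Arg w), so
    its sign compares the argument of \<open>w\<close> with \<theta>.\<close>
  have "Im (cis \<theta> * cnj w) = x * sin \<theta>"
    using sin_cos_squared_add[of \<theta>] by (simp add: w_def algebra_simps)
  moreover have "cis \<theta> * cnj w = of_real (norm w) * cis (\<theta> - Arg w)"
    by (subst w) (simp add: cis_cnj cis_mult[symmetric] divide_inverse flip: cis_divide)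
  ultimately have s: "norm w * sin (\<theta> - Arg w) = x * sin \<theta>" by simp
  have "\<not> Arg w > \<theta>"
  proof
    assume "Arg w > \<theta>"
    then have "sin (Arg w - \<theta>) > 0" using Arg \<theta> by (intro sin_gt_zero) auto
    moreover have "sin (\<theta> - Arg w) = - sin (Arg w - \<theta>)" by (metis minus_diff_eq sin_minus)
    ultimately have "norm w * sin (\<theta> - Arg w) < 0" using w0 by simp
    moreover have "x * sin \<theta> \<ge> 0" using sin xy by simp
    ultimately show False using s by linarith
  qed
  moreover have "Arg w \<noteq> \<theta>" if "x > 0"
  proof
    assume "Arg w = \<theta>"
    then have "x * sin \<theta> = 0" using s by simp
    then show False using that sin by simp
  qed
  ultimately show thesis
    using that[of "norm w" "Arg w"] w w0 Arg(1) unfolding w_def by force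
qed

text \<open>\<open>A\<close> and \<open>B\<close> are centres of circles of radii \<open>r\<close> and \<open>\<rho>\<close> meeting in \<open>P\<close> and \<open>Q\<close>; the angle of the
  kite at \<open>P\<close> and \<open>Q\<close> is \<open>\<pi> - \<delta>\<close>, hence half its angle at \<open>A\<close> is less than \<open>\<delta>\<close>.\<close>

definition kite :: "complex \<Rightarrow> complex \<Rightarrow> complex \<Rightarrow> complex \<Rightarrow> real \<Rightarrow> bool" where
  "kite A P B Q \<delta> \<longleftrightarrow> (\<exists>r \<rho> D D'. r > 0 \<and> \<rho> > 0 \<and> norm D = 1 \<and>
     P = A + of_real r * D \<and> B = A + D * (of_real r + of_real \<rho> * cis \<delta>) \<and>
     Q = A + of_real r * D' \<and> B = A + D' * (of_real r + of_real \<rho> * cis (- \<delta>)))"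

lemma segment_param:
  assumes "x \<in> closed_segment (A + p) (A + q)"
  obtains t where "0 \<le> t" "t \<le> 1" "x = A + ((1 - of_real t) * p + of_real t * q)"
proof -
  obtain t where "0 \<le> t" "t \<le> 1" "x = (1 - t) *\<^sub>R (A + p) + t *\<^sub>R (A + q)"
    using assms by (auto simp: in_segment)
  then show thesis by (intro that[of t]) (auto simp: scaleR_conv_of_real algebra_simps)
qed

text \<open>The triangle \<open>A\<close>, \<open>P\<close>, \<open>B\<close> has exterior angle
  \<delta> at \<open>P\<close>, so its angle \<theta> at \<open>A\<close> is less than \<delta>;
  reflection in the line through \<open>A\<close> and \<open>B\<close> gives the other half. The
  last conclusion accepts any polar form of \<open>P\<close>, so that the sector of a neighbouring
  kite can start where this one ends.\<close>

lemma kite_sector: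
  assumes "kite A P B Q \<delta>" and \<delta>: "0 < \<delta>" "\<delta> < pi"
  obtains \<theta> where "0 < \<theta>" "\<theta> < \<delta>" "Q - A = (P - A) * cis (2 * \<theta>)"
    "\<And>r \<phi>. r > 0 \<Longrightarrow> P = A + of_real r * cis \<phi> \<Longrightarrow>
       closed_segment P B \<union> closed_segment B Q \<subseteq>
       closed_segment A P \<union> closed_segment A Q \<union> sector A \<phi> (\<phi> + 2 * \<theta>)"
proof -
  obtain r \<rho> D D' where r: "r > 0" "\<rho> > 0" "norm D = 1" and P: "P = A + of_real r * D"
    and B: "B = A + D * (of_real r + of_real \<rho> * cis \<delta>)" and Q: "Q = A + of_real r * D'"
    and B': "B = A + D' * (of_real r + of_real \<rho> * cis (- \<delta>))"
    using assms(1) unfolding kite_def by blast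
  obtain R \<theta> where R: "of_real r + of_real \<rho> * cis \<delta> = of_real R * cis \<theta>" "R > 0" "0 < \<theta>" "\<theta> < \<delta>"
    by (rule cone_polar[OF \<delta>, of r \<rho>]) (use r in auto)
  have R': "of_real r + of_real \<rho> * cis (- \<delta>) = of_real R * cis (- \<theta>)"
    using arg_cong[OF R(1), of cnj] by (simp add: cis_cnj)
  have "D * (of_real R * cis \<theta>) = D' * (of_real R * cis (- \<theta>))"
    using B B' unfolding R(1) R' by (metis add_left_imp_eq)
  then have "D' * cis (- \<theta>) = D * cis \<theta>" using R(2) by simp
  then have "D' * (cis (- \<theta>) * cis \<theta>) = D * (cis \<theta> * cis \<theta>)" by (simp only: mult.assoc[symmetric])
  then have D': "D' = D * cis (2 * \<theta>)" by (simp add: cis_mult)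
  have \<theta>pi: "\<theta> < pi" using R \<delta> by linarith
  show thesis
  proof (rule that[OF R(3,4)])
    show "Q - A = (P - A) * cis (2 * \<theta>)" by (simp add: P Q D')
    fix r' \<phi> assume r': "r' > 0" "P = A + of_real r' * cis \<phi>"
    have "of_real r * D = of_real r' * cis \<phi>" using P r' by simp
    moreover from this have "norm (of_real r * D) = norm (of_real r' * cis \<phi>)" by simp
    then have "r' = r" using r r' by (simp add: norm_mult)
    ultimately have D: "D = cis \<phi>" using r by simp
    have Bc: "B = A + cis \<phi> * (of_real R * cis \<theta>)" using B unfolding R(1) D .
    have Qc: "Q = A + cis \<phi> * (of_real r * cis (2 * \<theta>))" using Q unfolding D' D by (simp add: mult_ac)
    have Pc: "P = A + cis \<phi> * of_real r" using P D by (simp add: mult.commute)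
    have 1: "x \<in> closed_segment A P \<union> sector A \<phi> (\<phi> + 2 * \<theta>)" if x: "x \<in> closed_segment P B" for x
    proof -
      obtain t where t: "0 \<le> t" "t \<le> 1"
        "x = A + ((1 - of_real t) * (cis \<phi> * of_real r) + of_real t * (cis \<phi> * (of_real R * cis \<theta>)))"
        using x unfolding Pc Bc by (rule segment_param)
      show ?thesis
      proof (cases "t = 0")
        case True
        then have "x = P" using t(3) Pc by simp
        then show ?thesis by simp
      next
        case False
        obtain \<tau> \<psi> where \<tau>: "of_real ((1 - t) * r) + of_real (t * R) * cis \<theta> = of_real \<tau> * cis \<psi>" "\<tau> > 0" "0 < \<psi>" "\<psi> \<le> \<theta>"
          by (rule cone_polar[OF R(3) \<theta>pi, of "(1 - t) * r" "t * R"]) (use t False r R in auto)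
        have "x = A + cis \<phi> * (of_real ((1 - t) * r) + of_real (t * R) * cis \<theta>)"
          unfolding t(3) by (simp add: algebra_simps)
        also have "\<dots> = A + of_real \<tau> * cis (\<phi> + \<psi>)" unfolding \<tau>(1) by (simp add: cis_mult[symmetric])
        also have "\<dots> \<in> sector A \<phi> (\<phi> + 2 * \<theta>)" using \<tau> R by (intro sectorI) auto
        finally show ?thesis by simp
      qed
    qed
    have 2: "x \<in> closed_segment A Q \<union> sector A \<phi> (\<phi> + 2 * \<theta>)" if x: "x \<in> closed_segment B Q" for x
    proof -
      obtain t where t: "0 \<le> t" "t \<le> 1"
        "x = A + ((1 - of_real t) * (cis \<phi> * (of_real r * cis (2 * \<theta>))) + of_real t * (cis \<phi> * (of_real R * cis \<theta>)))"
        using x unfolding Qc Bc closed_segment_commute[of "A + cis \<phi> * (of_real R * cis \<theta>)"] by (rule segment_param)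
      show ?thesis
      proof (cases "t = 0")
        case True
        then have "x = Q" using t(3) Qc by simp
        then show ?thesis by simp
      next
        case False
        obtain \<tau> \<psi> where \<tau>: "of_real ((1 - t) * r) + of_real (t * R) * cis \<theta> = of_real \<tau> * cis \<psi>" "\<tau> > 0" "0 < \<psi>" "\<psi> \<le> \<theta>"
          by (rule cone_polar[OF R(3) \<theta>pi, of "(1 - t) * r" "t * R"]) (use t False r R in auto)
        have \<tau>': "of_real ((1 - t) * r) + of_real (t * R) * cis (- \<theta>) = of_real \<tau> * cis (- \<psi>)"
          using arg_cong[OF \<tau>(1), of cnj] by (simp add: cis_cnj)
        have "cis (2 * \<theta>) * cis (- \<theta>) = cis \<theta>" by (simp add: cis_mult)
        then have "x = A + cis \<phi> * cis (2 * \<theta>) * (of_real ((1 - t) * r) + of_real (t * R) * cis (- \<theta>))"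
          unfolding t(3) by (simp add: distrib_left mult_ac)
        also have "\<dots> = A + of_real \<tau> * cis (\<phi> + (2 * \<theta> - \<psi>))" unfolding \<tau>' by (simp add: cis_mult add_diff_eq)
        also have "\<dots> \<in> sector A \<phi> (\<phi> + 2 * \<theta>)" using \<tau> R by (intro sectorI) auto
        finally show ?thesis by simp
      qed
    qed
    show "closed_segment P B \<union> closed_segment B Q \<subseteq>
       closed_segment A P \<union> closed_segment A Q \<union> sector A \<phi> (\<phi> + 2 * \<theta>)"
      using 1 2 by blast
  qed
qed

text \<open>Confinement to a sector depends only on the set of boundary points; this allows starting
  vertex and orientation to be changed freely.\<close>

definition boundary :: "complex \<Rightarrow> complex \<Rightarrow> complex \<Rightarrow> complex \<Rightarrow> complex set" where
  "boundary a b c d = closed_segment a b \<union> closed_segment b c \<union> closed_segment c d \<union> closed_segment d a"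

lemma quad_interior_in_sector:
  assumes "boundary a b c d = boundary A P B Q"
    and sub: "closed_segment P B \<union> closed_segment B Q \<subseteq> closed_segment A P \<union> closed_segment A Q \<union> sector A \<phi> \<psi>"
  shows "quad_interior a b c d \<subseteq> sector A \<phi> \<psi>"
proof
  fix p assume p: "p \<in> quad_interior a b c d"
  define g where "g = linepath a b +++ linepath b c +++ linepath c d +++ linepath d a"
  have im: "path_image g = boundary A P B Q"
    unfolding assms(1)[symmetric] by (simp add: g_def boundary_def path_image_join Un_assoc)
  have "p \<notin> path_image g" "winding_number g p \<noteq> 0" using p by (auto simp: quad_interior_def g_def Let_def)
  then show "p \<in> sector A \<phi> \<psi>"
  proof (rule winding_in_sector[rotated 5])
    show "path g" "pathfinish g = pathstart g" by (simp_all add: g_def)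
    show "path_image g \<subseteq> closed_segment A P \<union> closed_segment A Q \<union> sector A \<phi> \<psi>"
      unfolding im boundary_def using sub closed_segment_commute[of Q A] by blast
    show "closed_segment A P \<subseteq> path_image g" "closed_segment A Q \<subseteq> path_image g"
      unfolding im boundary_def using closed_segment_commute[of Q A] by blast+
  qed
qed

lemma kite_polar:
  assumes "kite A P B Q \<delta>"
  obtains r \<phi> where "r > 0" "P = A + of_real r * cis \<phi>"
proof -
  obtain r D where r: "r > 0" "norm D = 1" "P = A + of_real r * D"
    using assms unfolding kite_def by blast
  have "D = cis (Arg D)" using r(2) by (metis cis_Arg complex_sgn_def div_by_1 norm_zero zero_neq_one sgn_div_norm inverse_1 scaleR_one)
  then show thesis using that r by metis
qed

text \<open>The two sectors meet along the ray through \<open>Q\<close>. Their total opening 2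
  \<theta> + 2 \<theta>' is less than 2 (\<delta> + \<delta>') \<le> 2 pi, so they do not overlap on
  the far side either.\<close>

lemma adjacent_kites_disjoint:
  assumes K: "kite A P B Q \<delta>" "kite A Q B' Q' \<delta>'" and \<delta>: "0 < \<delta>" "0 < \<delta>'" "\<delta> + \<delta>' \<le> pi"
    and bd: "boundary a b c d = boundary A P B Q" "boundary a' b' c' d' = boundary A Q B' Q'"
  shows "quad_interior a b c d \<inter> quad_interior a' b' c' d' = {}"
proof -
  have \<delta>pi: "\<delta> < pi" "\<delta>' < pi" using \<delta> by linarith+
  obtain \<theta> where \<theta>: "0 < \<theta>" "\<theta> < \<delta>" "Q - A = (P - A) * cis (2 * \<theta>)"
    "\<And>r \<phi>. r > 0 \<Longrightarrow> P = A + of_real r * cis \<phi> \<Longrightarrow> closed_segment P B \<union> closed_segment B Q \<subseteq>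
       closed_segment A P \<union> closed_segment A Q \<union> sector A \<phi> (\<phi> + 2 * \<theta>)"
    by (rule kite_sector[OF K(1) \<delta>(1) \<delta>pi(1)]) (rule that)
  obtain \<theta>' where \<theta>': "0 < \<theta>'" "\<theta>' < \<delta>'"
    "\<And>r \<phi>. r > 0 \<Longrightarrow> Q = A + of_real r * cis \<phi> \<Longrightarrow> closed_segment Q B' \<union> closed_segment B' Q' \<subseteq>
       closed_segment A Q \<union> closed_segment A Q' \<union> sector A \<phi> (\<phi> + 2 * \<theta>')"
    by (rule kite_sector[OF K(2) \<delta>(2) \<delta>pi(2)]) (rule that)
  obtain r \<phi> where r: "r > 0" "P = A + of_real r * cis \<phi>" using kite_polar[OF K(1)] by blast
  have Q: "Q = A + of_real r * cis (\<phi> + 2 * \<theta>)"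
    using \<theta>(3) r(2) by (simp add: algebra_simps flip: cis_mult)
  have 1: "quad_interior a b c d \<subseteq> sector A \<phi> (\<phi> + 2 * \<theta>)"
    by (rule quad_interior_in_sector[OF bd(1) \<theta>(4)[OF r]])
  have 2: "quad_interior a' b' c' d' \<subseteq> sector A (\<phi> + 2 * \<theta>) (\<phi> + 2 * \<theta> + 2 * \<theta>')"
    by (rule quad_interior_in_sector[OF bd(2) \<theta>'(3)[OF r(1) Q]])
  have "sector A \<phi> (\<phi> + 2 * \<theta>) \<inter> sector A (\<phi> + 2 * \<theta>) (\<phi> + 2 * \<theta> + 2 * \<theta>') = {}"
    by (rule sector_disjoint) (use \<theta> \<theta>' \<delta> in linarith)
  then show ?thesis using 1 2 by blast
qed

lemma boundary_rotate: "boundary a b c d = boundary b c d a"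
  by (auto simp: boundary_def)

lemma boundary_reverse: "boundary a b c d = boundary a d c b"
  by (auto simp: boundary_def closed_segment_commute)

text \<open>If \<open>origin\<close> is false, nothing is assumed about the circle centred at the vertex \<open>(0,0)\<close>, which
  degenerates to a point for \<open>Z\<^sup>2\<close> and to a line for \<open>Log\<close>.\<close>

locale circle_pattern =
  fixes \<alpha> :: real and f u :: "nat \<Rightarrow> nat \<Rightarrow> complex" and R :: "nat \<Rightarrow> nat \<Rightarrow> real" and origin :: bool
  assumes \<alpha>: "0 < \<alpha>" "\<alpha> < pi"
    and hor: "\<And>n m. origin \<or> n + m \<noteq> 0 \<Longrightarrow> f (Suc n) m - f n m = u n m * u (Suc n) m"
    and ver: "\<And>n m. origin \<or> n + m \<noteq> 0 \<Longrightarrow> f n (Suc m) - f n m = cis \<alpha> * u n m * u n (Suc m)"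
    and odd: "\<And>n m. odd (n + m) \<Longrightarrow> norm (u n m) = 1"
    and even: "\<And>n m. even (n + m) \<Longrightarrow> origin \<or> n + m \<noteq> 0 \<Longrightarrow> u n m = of_real (R n m) \<and> R n m > 0"
begin

lemma cis_compl: "cis (pi - \<alpha>) = - cis (- \<alpha>)" "cis (- (pi - \<alpha>)) = - cis \<alpha>"
  by (simp_all add: complex_eq_iff)

lemma cis_inv: "cis \<alpha> * cis (- \<alpha>) = 1" "cis \<alpha> * (cis (- \<alpha>) * x) = x"
  by (simp_all add: cis_mult mult.assoc[symmetric])

text \<open>A quadrilateral is a kite seen from either of its even vertices. The four lemmas are
  named after the direction from the apex, with the corners in counterclockwise order. The angle is
  \<alpha> if the even corners are the lower left and upper right ones and pi - \<alpha> otherwise;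
  only in the first case can the origin be among them.\<close>

lemma kite_NE:
  assumes "even (n + m)" "origin \<or> n + m \<noteq> 0"
  shows "kite (f n m) (f (Suc n) m) (f (Suc n) (Suc m)) (f n (Suc m)) \<alpha>"
  unfolding kite_def
proof (intro exI conjI)
  have A: "u n m = of_real (R n m)" "R n m > 0" using even[OF assms] by auto
  have B: "u (Suc n) (Suc m) = of_real (R (Suc n) (Suc m))" "R (Suc n) (Suc m) > 0"
    using even[of "Suc n" "Suc m"] assms by auto
  show "R n m > 0" "R (Suc n) (Suc m) > 0" using A B by auto
  show "norm (u (Suc n) m) = 1" using odd[of "Suc n" m] assms by simp
  show 1: "f (Suc n) m = f n m + of_real (R n m) * u (Suc n) m"
    using hor[OF assms(2)] A by (simp add: algebra_simps)
  show 2: "f n (Suc m) = f n m + of_real (R n m) * (cis \<alpha> * u n (Suc m))"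
    using ver[OF assms(2)] A by (simp add: algebra_simps)
  show "f (Suc n) (Suc m) = f n m + u (Suc n) m * (of_real (R n m) + of_real (R (Suc n) (Suc m)) * cis \<alpha>)"
    using ver[of "Suc n" m] 1 B by (simp add: algebra_simps)
  show "f (Suc n) (Suc m) = f n m + cis \<alpha> * u n (Suc m) * (of_real (R n m) + of_real (R (Suc n) (Suc m)) * cis (- \<alpha>))"
    using hor[of n "Suc m"] 2 B by (simp add: algebra_simps cis_inv)
qed

lemma kite_NW:
  assumes "even (Suc n + m)"
  shows "kite (f (Suc n) m) (f (Suc n) (Suc m)) (f n (Suc m)) (f n m) (pi - \<alpha>)"
  unfolding kite_def
proof (intro exI conjI)
  have A: "u (Suc n) m = of_real (R (Suc n) m)" "R (Suc n) m > 0" using even[OF assms] by auto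
  have B: "u n (Suc m) = of_real (R n (Suc m))" "R n (Suc m) > 0"
    using even[of n "Suc m"] assms by auto
  have nm: "origin \<or> n + m \<noteq> 0" using assms by (cases "n + m = 0") auto
  show "R (Suc n) m > 0" "R n (Suc m) > 0" using A B by auto
  show "norm (cis \<alpha> * u (Suc n) (Suc m)) = 1" using odd[of "Suc n" "Suc m"] assms by (simp add: norm_mult)
  show 1: "f (Suc n) (Suc m) = f (Suc n) m + of_real (R (Suc n) m) * (cis \<alpha> * u (Suc n) (Suc m))"
    using ver[of "Suc n" m] A by (simp add: algebra_simps)
  show 2: "f n m = f (Suc n) m + of_real (R (Suc n) m) * (- u n m)"
    using hor[OF nm] A by (simp add: algebra_simps)
  show "f n (Suc m) = f (Suc n) m + cis \<alpha> * u (Suc n) (Suc m) * (of_real (R (Suc n) m) + of_real (R n (Suc m)) * cis (pi - \<alpha>))"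
    using hor[of n "Suc m"] 1 B unfolding cis_compl by (simp add: algebra_simps cis_inv)
  show "f n (Suc m) = f (Suc n) m + - u n m * (of_real (R (Suc n) m) + of_real (R n (Suc m)) * cis (- (pi - \<alpha>)))"
    using ver[OF nm] 2 B unfolding cis_compl by (simp add: algebra_simps)
qed

lemma kite_SW:
  assumes "even (n + m)" "origin \<or> n + m \<noteq> 0"
  shows "kite (f (Suc n) (Suc m)) (f n (Suc m)) (f n m) (f (Suc n) m) \<alpha>"
  unfolding kite_def
proof (intro exI conjI)
  have A: "u (Suc n) (Suc m) = of_real (R (Suc n) (Suc m))" "R (Suc n) (Suc m) > 0"
    using even[of "Suc n" "Suc m"] assms by auto
  have B: "u n m = of_real (R n m)" "R n m > 0" using even[OF assms] by auto
  show "R (Suc n) (Suc m) > 0" "R n m > 0" using A B by auto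
  show "norm (- u n (Suc m)) = 1" using odd[of n "Suc m"] assms by simp
  show 1: "f n (Suc m) = f (Suc n) (Suc m) + of_real (R (Suc n) (Suc m)) * (- u n (Suc m))"
    using hor[of n "Suc m"] A by (simp add: algebra_simps)
  show 2: "f (Suc n) m = f (Suc n) (Suc m) + of_real (R (Suc n) (Suc m)) * (- (cis \<alpha> * u (Suc n) m))"
    using ver[of "Suc n" m] A by (simp add: algebra_simps)
  show "f n m = f (Suc n) (Suc m) + - u n (Suc m) * (of_real (R (Suc n) (Suc m)) + of_real (R n m) * cis \<alpha>)"
    using ver[OF assms(2)] 1 B by (simp add: algebra_simps)
  show "f n m = f (Suc n) (Suc m) + - (cis \<alpha> * u (Suc n) m) * (of_real (R (Suc n) (Suc m)) + of_real (R n m) * cis (- \<alpha>))"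
    using hor[OF assms(2)] 2 B by (simp add: algebra_simps cis_inv)
qed

lemma kite_SE:
  assumes "even (n + Suc m)"
  shows "kite (f n (Suc m)) (f n m) (f (Suc n) m) (f (Suc n) (Suc m)) (pi - \<alpha>)"
  unfolding kite_def
proof (intro exI conjI)
  have A: "u n (Suc m) = of_real (R n (Suc m))" "R n (Suc m) > 0" using even[OF assms] by auto
  have B: "u (Suc n) m = of_real (R (Suc n) m)" "R (Suc n) m > 0"
    using even[of "Suc n" m] assms by auto
  have nm: "origin \<or> n + m \<noteq> 0" using assms by (cases "n + m = 0") auto
  show "R n (Suc m) > 0" "R (Suc n) m > 0" using A B by auto
  show "norm (- (cis \<alpha> * u n m)) = 1" using odd[of n m] assms by (simp add: norm_mult)
  show 1: "f n m = f n (Suc m) + of_real (R n (Suc m)) * (- (cis \<alpha> * u n m))"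
    using ver[OF nm] A by (simp add: algebra_simps)
  show 2: "f (Suc n) (Suc m) = f n (Suc m) + of_real (R n (Suc m)) * u (Suc n) (Suc m)"
    using hor[of n "Suc m"] A by (simp add: algebra_simps)
  show "f (Suc n) m = f n (Suc m) + - (cis \<alpha> * u n m) * (of_real (R n (Suc m)) + of_real (R (Suc n) m) * cis (pi - \<alpha>))"
    using hor[OF nm] 1 B unfolding cis_compl by (simp add: algebra_simps cis_inv)
  show "f (Suc n) m = f n (Suc m) + u (Suc n) (Suc m) * (of_real (R n (Suc m)) + of_real (R (Suc n) m) * cis (- (pi - \<alpha>)))"
    using ver[of "Suc n" m] 2 B unfolding cis_compl by (simp add: algebra_simps)
qed

definition Quad :: "nat \<Rightarrow> nat \<Rightarrow> complex set" where
  "Quad n m = quad_interior (f n m) (f (Suc n) m) (f (Suc n) (Suc m)) (f n (Suc m))"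

text \<open>Exactly one end of the common edge is even. It is the apex of both kites, and their
  angle parameters are \<alpha> and pi - \<alpha> in some order.\<close>

lemma Quad_disjoint:
  assumes nm: "origin \<or> n + m \<noteq> 0"
  shows "Quad n m \<inter> Quad (Suc n) m = {}" "Quad n m \<inter> Quad n (Suc m) = {}"
proof -
  have pi: "0 < \<alpha>" "0 < pi - \<alpha>" "\<alpha> + (pi - \<alpha>) \<le> pi" "pi - \<alpha> + \<alpha> \<le> pi" using \<alpha> by auto
  show "Quad n m \<inter> Quad (Suc n) m = {}"
  proof (cases "even (n + m)")
    case True
    have SE: "even (Suc n + Suc m)" using True by simp
    show ?thesis unfolding Quad_def
      by (rule adjacent_kites_disjoint[OF kite_SW[OF True nm] kite_SE[OF SE] pi(1,2,3)])
         (metis boundary_rotate boundary_reverse)+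
  next
    case False
    have e: "even (Suc n + m)" using False by simp
    have "Quad (Suc n) m \<inter> Quad n m = {}" unfolding Quad_def
      by (rule adjacent_kites_disjoint[OF kite_NE[OF e] kite_NW[OF e] pi(1,2,3)])
         (simp | metis boundary_rotate boundary_reverse)+
    then show ?thesis by blast
  qed
  show "Quad n m \<inter> Quad n (Suc m) = {}"
  proof (cases "even (n + m)")
    case True
    have e: "even (Suc n + Suc m)" using True by simp
    have "Quad n (Suc m) \<inter> Quad n m = {}" unfolding Quad_def
      by (rule adjacent_kites_disjoint[OF kite_NW[OF e] kite_SW[OF True nm] pi(2,1,4)])
         (metis boundary_rotate boundary_reverse)+
    then show ?thesis by blast
  next
    case False
    have e: "even (n + Suc m)" using False by simp
    show ?thesis unfolding Quad_def
      by (rule adjacent_kites_disjoint[OF kite_SE[OF e] kite_NE[OF e] pi(2,1,4)])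
         (simp | metis boundary_rotate boundary_reverse)+
  qed
qed

end

section \<open>The limit \<open>c = 2\<close> and the logarithm\<close>

text \<open>The hypothesis says that sin (\<alpha> - \<bar>Arg \<zeta>\<bar>), multiplied by the
  norm of \<zeta>, is positive. This form covers acute and obtuse \<alpha> alike.\<close>

lemma wedge_in_sector:
  assumes \<alpha>: "0 < \<alpha>" "\<alpha> < pi" and pos: "sin \<alpha> * Re \<zeta> - cos \<alpha> * \<bar>Im \<zeta>\<bar> > 0"
  shows "A - \<zeta> \<in> sector A (pi - \<alpha>) (pi + \<alpha>)"
proof -
  define w where "w = Complex (Re \<zeta>) \<bar>Im \<zeta>\<bar>"
  have w0: "w \<noteq> 0" using pos by (auto simp: w_def complex_eq_iff)
  have w: "w = of_real (norm w) * cis (Arg w)" using w0 by (metis rcis_cmod_Arg rcis_def)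
  have "Im w \<ge> 0" by (simp add: w_def)
  then have Arg: "0 \<le> Arg w" "Arg w \<le> pi" using Arg_less_0[of w] Arg_le_pi[of w] by auto
  have "norm w * sin (\<alpha> - Arg w) = sin \<alpha> * Re w - cos \<alpha> * Im w"
    using arg_cong[OF w, of Re] arg_cong[OF w, of Im] by (simp add: sin_diff algebra_simps)
  also have "\<dots> > 0" using pos by (simp add: w_def)
  finally have s: "sin (\<alpha> - Arg w) > 0" using w0 by (simp add: zero_less_mult_iff)
  have lt: "Arg w < \<alpha>"
  proof (rule ccontr)
    assume "\<not> Arg w < \<alpha>"
    then have "sin (Arg w - \<alpha>) \<ge> 0" using Arg \<alpha> by (intro sin_ge_zero) auto
    moreover have "sin (\<alpha> - Arg w) = - sin (Arg w - \<alpha>)" by (metis minus_diff_eq sin_minus)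
    ultimately show False using s by simp
  qed
  have cis_pi: "- cis x = cis (pi + x)" for x by (simp add: complex_eq_iff)
  show ?thesis
  proof (cases "Im \<zeta> \<ge> 0")
    case True
    then have "\<zeta> = w" by (simp add: w_def complex_eq_iff)
    then have *: "A - \<zeta> = A + of_real (norm w) * cis (pi + Arg w)"
      using w unfolding cis_pi[symmetric] by simp
    show ?thesis unfolding * using lt Arg w0 \<alpha> by (intro sectorI) auto
  next
    case False
    then have "\<zeta> = cnj w" by (simp add: w_def complex_eq_iff)
    also have "\<dots> = of_real (norm w) * cis (- Arg w)" by (subst w) (simp add: cis_cnj)
    finally have *: "A - \<zeta> = A + of_real (norm w) * cis (pi + - Arg w)"
      unfolding cis_pi[symmetric] by simp
    show ?thesis unfolding * using lt Arg w0 \<alpha> by (intro sectorI) auto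
  qed
qed

text \<open>The rays from \<open>S\<close> and \<open>W\<close> run parallel to the bisector of the
  sector and so stay inside it. The closing edge does too once \<open>r < T\<close>, which puts it
  to the left of \<open>A\<close> even for obtuse \<alpha>.\<close>

lemma quad_interior_inf_in_sector:
  assumes \<alpha>: "0 < \<alpha>" "\<alpha> < pi" and r: "r > 0"
    and S: "S = A - of_real r * cis \<alpha>" and W: "W = A - of_real r * cis (- \<alpha>)"
  shows "quad_interior_inf (-1) S A W \<subseteq> sector A (pi - \<alpha>) (pi + \<alpha>)"
proof
  fix p assume "p \<in> quad_interior_inf (-1) S A W"
  define g where "g T = linepath (S + of_real T * (-1)) S +++ linepath S A +++ linepath A W
                   +++ linepath W (W + of_real T * (-1)) +++ linepath (W + of_real T * (-1)) (S + of_real T * (-1))" for T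
  have "\<forall>\<^sub>F T in at_top. p \<notin> path_image (g T) \<and> winding_number (g T) p \<noteq> 0"
    using \<open>p \<in> _\<close> by (simp add: quad_interior_inf_def g_def Let_def)
  then have "\<forall>\<^sub>F T in at_top. r < T \<and> p \<notin> path_image (g T) \<and> winding_number (g T) p \<noteq> 0"
    using eventually_gt_at_top[of r] by eventually_elim auto
  then obtain T where T: "r < T" "p \<notin> path_image (g T)" "winding_number (g T) p \<noteq> 0"
    using eventually_happens'[OF trivial_limit_at_top_linorder] by blast
  have sin: "sin \<alpha> > 0" using \<alpha> by (intro sin_gt_zero)
  let ?C = "sector A (pi - \<alpha>) (pi + \<alpha>)"
  have im: "path_image (g T) = closed_segment (S - of_real T) S \<union> closed_segment S A \<union> closed_segment A W
      \<union> closed_segment W (W - of_real T) \<union> closed_segment (W - of_real T) (S - of_real T)"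
    by (simp add: g_def path_image_join Un_assoc)
  have ray: "X \<in> {S} \<union> ?C" if X: "X = S - of_real t" "t \<ge> 0" for X t
  proof (cases "t = 0")
    case False
    then have "t * sin \<alpha> > 0" using sin that by simp
    moreover have "r * sin \<alpha> > 0" using r sin by simp
    ultimately have "A - (of_real r * cis \<alpha> + of_real t) \<in> ?C"
      by (intro wedge_in_sector \<alpha>) (simp add: algebra_simps)
    moreover have "X = A - (of_real r * cis \<alpha> + of_real t)" using X S by simp
    ultimately show ?thesis by simp
  qed (use X in simp)
  have ray': "X \<in> {W} \<union> ?C" if X: "X = W - of_real t" "t \<ge> 0" for X t
  proof (cases "t = 0")
    case False
    then have "t * sin \<alpha> > 0" using sin that by simp
    moreover have "r * sin \<alpha> > 0" using r sin by simp
    ultimately have "A - (of_real r * cis (- \<alpha>) + of_real t) \<in> ?C"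
      by (intro wedge_in_sector \<alpha>) (simp add: algebra_simps)
    moreover have "X = A - (of_real r * cis (- \<alpha>) + of_real t)" using X W by simp
    ultimately show ?thesis by simp
  qed (use X in simp)
  have far: "X \<in> ?C" if X: "X \<in> closed_segment (W - of_real T) (S - of_real T)" for X
  proof -
    obtain v where v: "0 \<le> v" "v \<le> 1" "X = (1 - v) *\<^sub>R (W - of_real T) + v *\<^sub>R (S - of_real T)"
      using X by (auto simp: in_segment)
    define \<zeta> where "\<zeta> = A - X"
    have \<zeta>: "Re \<zeta> = T + r * cos \<alpha>" "Im \<zeta> = (2 * v - 1) * (r * sin \<alpha>)"
      by (simp_all add: \<zeta>_def v(3) S W algebra_simps)
    have "\<bar>2 * v - 1\<bar> * (r * sin \<alpha>) \<le> 1 * (r * sin \<alpha>)" using v r sin by (intro mult_right_mono) auto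
    then have Im: "\<bar>Im \<zeta>\<bar> \<le> r * sin \<alpha>" using r sin by (simp add: \<zeta> abs_mult)
    have "r * (- 1) \<le> r * cos \<alpha>" using r by (intro mult_left_mono) auto
    then have Re: "Re \<zeta> > 0" using T(1) \<zeta> by simp
    have "sin \<alpha> * Re \<zeta> - cos \<alpha> * \<bar>Im \<zeta>\<bar> > 0"
    proof (cases "cos \<alpha> \<ge> 0")
      case True
      then have "cos \<alpha> * \<bar>Im \<zeta>\<bar> \<le> cos \<alpha> * (r * sin \<alpha>)" using Im by (intro mult_left_mono)
      moreover have "sin \<alpha> * Re \<zeta> = sin \<alpha> * T + cos \<alpha> * (r * sin \<alpha>)" by (simp add: \<zeta> algebra_simps)
      moreover have "sin \<alpha> * T > 0" using sin T r by simp
      ultimately show ?thesis by linarith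
    next
      case False
      then have "cos \<alpha> * \<bar>Im \<zeta>\<bar> \<le> 0" by (intro mult_nonpos_nonneg) auto
      moreover have "sin \<alpha> * Re \<zeta> > 0" using sin Re by simp
      ultimately show ?thesis by linarith
    qed
    then have "A - \<zeta> \<in> ?C" by (intro wedge_in_sector \<alpha>)
    then show ?thesis by (simp add: \<zeta>_def)
  qed
  have seg: "\<exists>t\<ge>0. x = X - of_real t" if x: "x \<in> closed_segment X (X - of_real T)" for x X :: complex
  proof -
    obtain v where v: "0 \<le> v" "x = (1 - v) *\<^sub>R X + v *\<^sub>R (X - of_real T)" using x by (auto simp: in_segment)
    have "x = X - of_real (v * T)" by (simp add: v(2) scaleR_conv_of_real algebra_simps)
    moreover have "v * T \<ge> 0" using v T r by simp
    ultimately show ?thesis by blast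
  qed
  show "p \<in> ?C"
  proof (rule winding_in_sector[OF _ _ _ _ _ T(2,3)])
    show "path (g T)" "pathfinish (g T) = pathstart (g T)" by (simp_all add: g_def)
    show "closed_segment A S \<subseteq> path_image (g T)" "closed_segment A W \<subseteq> path_image (g T)"
      unfolding im by (auto simp: closed_segment_commute)
    have "closed_segment (S - of_real T) S \<subseteq> {S} \<union> ?C"
    proof
      fix x assume "x \<in> closed_segment (S - of_real T) S"
      then obtain t where "t \<ge> 0" "x = S - of_real t"
        using seg[of x S] closed_segment_commute[of S] by metis
      then show "x \<in> {S} \<union> ?C" by (intro ray)
    qed
    moreover have "closed_segment W (W - of_real T) \<subseteq> {W} \<union> ?C"
    proof
      fix x assume "x \<in> closed_segment W (W - of_real T)"
      then obtain t where "t \<ge> 0" "x = W - of_real t" using seg[of x W] by metis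
      then show "x \<in> {W} \<union> ?C" by (intro ray')
    qed
    moreover have "S \<in> closed_segment A S" "W \<in> closed_segment A W" by simp_all
    ultimately show "path_image (g T) \<subseteq> closed_segment A S \<union> closed_segment A W \<union> ?C"
      unfolding im closed_segment_commute[of S A] using far by blast
  qed
qed

text \<open>If a diagonal radius vanished in the limit, the equation at the vertex below it would make
  the next radius to the right infinite.\<close>

lemma limit_radii_pos:
  fixes r :: "real \<Rightarrow> nat \<Rightarrow> nat \<Rightarrow> real" and R :: "nat \<Rightarrow> nat \<Rightarrow> real" and \<kappa> :: "real \<Rightarrow> real"
  assumes lim: "\<And>n m. even (n + m) \<Longrightarrow> ((\<lambda>c. \<kappa> c * r c n m) \<longlongrightarrow> R n m) (at_left 2)"
    and pos: "\<And>c n m. 1 < c \<Longrightarrow> c < 2 \<Longrightarrow> even (n + m) \<Longrightarrow> r c n m > 0"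
    and \<kappa>: "\<And>c. 1 < c \<Longrightarrow> c < 2 \<Longrightarrow> \<kappa> c > 0"
    and eq: "\<And>c n m. 1 < c \<Longrightarrow> c < 2 \<Longrightarrow> odd (n + m) \<Longrightarrow>
       real n * r c (Suc n) m / (r c (Suc n) m + r c (n-1) m)
       + real m * r c n (Suc m) / (r c n (Suc m) + r c n (m-1)) = c / 2 + (real (n + m) - 1) / 2"
    and R20: "R (Suc (Suc 0)) 0 > 0" and R11: "R (Suc 0) (Suc 0) > 0"
    and nm: "even (n + m)" "m \<le> n" "n + m \<noteq> 0"
  shows "R n m > 0"
proof -
  have ev: "\<forall>\<^sub>F c in at_left 2. 1 < c \<and> c < (2::real)"
    using eventually_at_left_real[of 1 "2::real"] by simp
  have clim: "((\<lambda>c::real. c) \<longlongrightarrow> 2) (at_left 2)" by (rule tendsto_ident_at)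
  have nonneg: "R i j \<ge> 0" if "even (i + j)" for i j
  proof (rule tendsto_lowerbound[OF lim[OF that]])
    show "\<forall>\<^sub>F c in at_left 2. 0 \<le> \<kappa> c * r c i j"
      using ev by eventually_elim (use pos \<kappa> that in \<open>simp add: less_imp_le\<close>)
  qed simp
  \<comment> \<open>The lower bound of \<open>radius_ratio\<close> is homogeneous in the radii, so
    it passes to the rescaled limit and transports positivity to the right.\<close>
  have off: "R (Suc i) j > 0" if ij: "odd (i + j)" "j < i" and R: "R (i-1) j > 0" for i j
  proof -
    obtain k where k: "i = Suc k" using ij by (cases i) auto
    have e: "even (Suc i + j)" "even (i - 1 + j)" using ij k by auto
    have "(2 / 2 + (real i - real j - 1) / 2) * R (i-1) j \<le> real i * R (Suc i) j"
    proof (rule tendsto_le)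
      show "((\<lambda>c. (c / 2 + (real i - real j - 1) / 2) * (\<kappa> c * r c (i-1) j)) \<longlongrightarrow>
          (2 / 2 + (real i - real j - 1) / 2) * R (i-1) j) (at_left 2)"
        by (intro tendsto_intros clim lim e) auto
      show "((\<lambda>c. real i * (\<kappa> c * r c (Suc i) j)) \<longlongrightarrow> real i * R (Suc i) j) (at_left 2)"
        by (intro tendsto_intros lim e)
      show "\<forall>\<^sub>F c in at_left 2. (c / 2 + (real i - real j - 1) / 2) * (\<kappa> c * r c (i-1) j) \<le> real i * (\<kappa> c * r c (Suc i) j)"
        using ev
      proof eventually_elim
        fix c :: real assume c: "1 < c \<and> c < 2"
        have p: "r c (Suc i) j > 0" "r c (i-1) j > 0" using pos e c by auto
        have "(c / 2 + (real i - real j - 1) / 2) * r c (i-1) j \<le> real i * r c (Suc i) j"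
        proof (rule radius_ratio(2))
          show "real i * r c (Suc i) j / (r c (Suc i) j + r c (i-1) j)
             + real j * r c i (Suc j) / (r c i (Suc j) + r c i (j-1)) = c / 2 + (real (i + j) - 1) / 2"
            using eq c ij by blast
          show "0 < r c i (Suc j) \<and> 0 < r c i (j-1)" if "j \<noteq> 0"
          proof -
            obtain l where "j = Suc l" using \<open>j \<noteq> 0\<close> by (cases j) auto
            then show ?thesis using pos[of c i "Suc j"] pos[of c i l] c ij by auto
          qed
        qed (use p c ij in auto)
        then have "\<kappa> c * ((c / 2 + (real i - real j - 1) / 2) * r c (i-1) j) \<le> \<kappa> c * (real i * r c (Suc i) j)"
          using \<kappa>[of c] c by (intro mult_left_mono) auto
        then show "(c / 2 + (real i - real j - 1) / 2) * (\<kappa> c * r c (i-1) j) \<le> real i * (\<kappa> c * r c (Suc i) j)"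
          by (simp only: mult_ac)
      qed
    qed simp
    moreover have "(2 / 2 + (real i - real j - 1) / 2) * R (i-1) j > 0"
    proof (intro mult_pos_pos R)
      have "real j + 1 \<le> real i" using ij(2) by linarith
      then show "2 / 2 + (real i - real j - 1) / 2 > 0" by (simp add: field_simps)
    qed
    ultimately have "real i * R (Suc i) j > 0" by linarith
    then show ?thesis by (simp add: zero_less_mult_iff)
  qed
  have diag_step: "R (Suc i) (Suc i) > 0" if "i \<ge> 1" "R i i > 0" "R (Suc i) (i-1) > 0" for i
  proof -
    obtain k where k: "i = Suc k" using \<open>i \<ge> 1\<close> by (cases i) auto
    have e: "even (Suc (Suc i) + i)" "even (i + i)" "even (Suc i + Suc i)" "even (Suc i + (i - 1))" using k by auto
    \<comment> \<open>The radius equation cleared of its denominators, which might vanish in the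
      limit. It is homogeneous of degree 2, and at \<open>P = 0\<close> it reduces to - (i + 1)
      \<open>Y\<close> \<open>Q\<close>.\<close>
    let ?G = "\<lambda>c X Y P Q. real (Suc i) * X * (P + Q) + real i * P * (X + Y) - (c / 2 + real i) * (X + Y) * (P + Q)"
    have "?G 2 (R (Suc (Suc i)) i) (R i i) (R (Suc i) (Suc i)) (R (Suc i) (i-1)) = 0"
    proof (rule tendsto_unique)
      show "((\<lambda>c. ?G c (\<kappa> c * r c (Suc (Suc i)) i) (\<kappa> c * r c i i) (\<kappa> c * r c (Suc i) (Suc i)) (\<kappa> c * r c (Suc i) (i-1)))
         \<longlongrightarrow> ?G 2 (R (Suc (Suc i)) i) (R i i) (R (Suc i) (Suc i)) (R (Suc i) (i-1))) (at_left 2)"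
        by (intro tendsto_intros clim lim e) auto
      show "((\<lambda>c. ?G c (\<kappa> c * r c (Suc (Suc i)) i) (\<kappa> c * r c i i) (\<kappa> c * r c (Suc i) (Suc i)) (\<kappa> c * r c (Suc i) (i-1)))
         \<longlongrightarrow> 0) (at_left 2)"
      proof (rule tendsto_eventually)
        show "\<forall>\<^sub>F c in at_left 2. ?G c (\<kappa> c * r c (Suc (Suc i)) i) (\<kappa> c * r c i i) (\<kappa> c * r c (Suc i) (Suc i)) (\<kappa> c * r c (Suc i) (i-1)) = 0"
          using ev
        proof eventually_elim
          fix c :: real assume c: "1 < c \<and> c < 2"
          define X Y P Q where XY: "X = r c (Suc (Suc i)) i" "Y = r c i i" "P = r c (Suc i) (Suc i)" "Q = r c (Suc i) (i-1)"
          have p: "X > 0" "Y > 0" "P > 0" "Q > 0" unfolding XY using pos e c by auto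
          have "real (Suc i) * X / (X + Y) + real i * P / (P + Q) = c / 2 + real i"
            using eq[of c "Suc i" i] c unfolding XY by simp
          then have "(real (Suc i) * X / (X + Y) + real i * P / (P + Q)) * ((X + Y) * (P + Q)) = (c / 2 + real i) * ((X + Y) * (P + Q))"
            by simp
          moreover have "(real (Suc i) * X / (X + Y) + real i * P / (P + Q)) * ((X + Y) * (P + Q))
             = real (Suc i) * X * (P + Q) + real i * P * (X + Y)"
          proof -
            have "x / (X + Y) * ((X + Y) * (P + Q)) = x * (P + Q)" "x / (P + Q) * ((X + Y) * (P + Q)) = x * (X + Y)" for x
              using p by simp_all
            then show ?thesis by (simp only: distrib_right[of "_ / _"])
          qed
          ultimately have "?G c X Y P Q = 0" by (simp only: mult.assoc)
          moreover have "?G c (\<kappa> c * X) (\<kappa> c * Y) (\<kappa> c * P) (\<kappa> c * Q) = \<kappa> c * \<kappa> c * ?G c X Y P Q"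
          proof -
            have "x * (k * X) * (k * P + k * Q) + y * (k * P) * (k * X + k * Y) - h * (k * X + k * Y) * (k * P + k * Q)
              = k * k * (x * X * (P + Q) + y * P * (X + Y) - h * (X + Y) * (P + Q))" for x y h k :: real
              by (simp add: algebra_simps)
            then show ?thesis by blast
          qed
          ultimately show "?G c (\<kappa> c * r c (Suc (Suc i)) i) (\<kappa> c * r c i i) (\<kappa> c * r c (Suc i) (Suc i)) (\<kappa> c * r c (Suc i) (i-1)) = 0"
            unfolding XY[symmetric] by simp
        qed
      qed
    qed simp
    moreover have False if "R (Suc i) (Suc i) = 0"
    proof -
      have "?G 2 X Y 0 Q = - (real (Suc i) * (Y * Q))" for X Y Q :: real by (simp add: algebra_simps)
      then have "real (Suc i) * (R i i * R (Suc i) (i-1)) = 0" using calculation that by simp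
      then show False using \<open>R i i > 0\<close> \<open>R (Suc i) (i-1) > 0\<close> by (simp del: of_nat_Suc)
    qed
    ultimately show ?thesis using nonneg[OF e(3)] by (auto simp: less_le)
  qed
  \<comment> \<open>A diagonal radius needs its predecessor and the radius two places to the right
    of the one before that. The latter comes from \<open>off\<close>, except next to the origin,
    where \<open>R20\<close> takes its place.\<close>
  have diag: "R (Suc k) (Suc k) > 0" for k
  proof (induction k rule: less_induct)
    case (less k)
    show ?case
    proof (cases k)
      case (Suc j)
      have "R (Suc (Suc j)) j > 0"
      proof (cases j)
        case (Suc l)
        then show ?thesis using off[of "Suc j" j] less.IH[of l] \<open>k = Suc j\<close> by simp
      qed (use R20 in simp)
      then show ?thesis using diag_step[of "Suc j"] less.IH[of j] Suc by simp
    qed (use R11 in simp)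
  qed
  have gen: "R (m + 2 * j) m > 0" if "m + 2 * j + m \<noteq> 0" for j
    using that
  proof (induction j)
    case 0
    then show ?case using diag[of "m - 1"] by simp
  next
    case (Suc j)
    show ?case
    proof (cases "m + 2 * j + m = 0")
      case True
      then show ?thesis using R20 by (simp add: numeral_2_eq_2)
    next
      case False
      then show ?thesis using off[of "Suc (m + 2 * j)" m] Suc.IH by simp
    qed
  qed
  have "even (n - m)" using nm by simp
  then obtain j where "n - m = 2 * j" unfolding dvd_def by blast
  then have "n = m + 2 * j" using nm by simp
  then show ?thesis using gen[of j] nm by simp
qed

section \<open>Immersion for 0 < c < 2\<close>

lemma Zc_discrete_power:
  assumes z: "is_Zc a1 a2 a c z" and a: "0 < a" "a < pi" and c: "0 < c" "c < 2"
  shows "discrete_power a c (\<lambda>n m. z (int n, 0, - int m))"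
proof -
  define f where "f n m = z (int n, 0, - int m)" for n m
  have con: "Zc_constraint c z" and cr: "crossratio_eqs a1 a2 a z" using z by (auto simp: is_Zc_def)
  have fS: "z (int n + 1, 0, - int m) = f (Suc n) m" "z (int n, 0, - int m - 1) = f n (Suc m)"
    "z (int n + 1, 0, - int m - 1) = f (Suc n) (Suc m)" "z (int n, 0, - int m) = f n m" for n m
  proof -
    have "int n + 1 = int (Suc n)" "- int m - 1 = - int (Suc m)" by simp_all
    then show "z (int n + 1, 0, - int m) = f (Suc n) m" "z (int n, 0, - int m - 1) = f n (Suc m)"
      "z (int n + 1, 0, - int m - 1) = f (Suc n) (Suc m)" "z (int n, 0, - int m) = f n m"
      unfolding f_def by (simp_all only:)
  qed
  have fP: "z (int n - 1, 0, - int m) = f (n - 1) m" if "n \<noteq> 0" for n m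
    using that by (cases n) (simp_all add: f_def)
  have fQ: "z (int n, 0, - int m + 1) = f n (m - 1)" if "m \<noteq> 0" for n m
    using that by (cases m) (simp_all add: f_def)
  have hs: "hedge f n m + hedge f (n-1) m = f (Suc n) m - f (n-1) m" if "n \<noteq> 0" for n m
    using that by (cases n) (simp_all add: hedge_def)
  have vs: "vedge f n m + vedge f n (m-1) = f n (Suc m) - f n (m-1)" if "m \<noteq> 0" for n m
    using that by (cases m) (simp_all add: vedge_def)
  have inQ: "inQ (int n, 0, - int m)" for n m by (simp add: inQ_def)
  note C = con[unfolded Zc_constraint_def, THEN spec, THEN spec, THEN spec, THEN mp, OF inQ]
  have "discrete_power a c f"
  proof
    fix n m :: nat
    have "crossratio (z (int n,0,- int m)) (z (int n + 1,0,- int m)) (z (int n + 1,0,- int m - 1)) (z (int n,0,- int m - 1))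
       = exp (- 2 * \<i> * of_real a)"
      using cr unfolding crossratio_eqs_def by simp
    then show "crossratio (f n m) (f (Suc n) m) (f (Suc n) (Suc m)) (f n (Suc m)) = exp (- 2 * \<i> * of_real a)"
      unfolding fS .
    show "hedge f n m + hedge f (n-1) m \<noteq> 0" if "n \<noteq> 0"
      using C[of n m] that unfolding hs[OF that] fS fP[OF that] by simp
    show "vedge f n m + vedge f n (m-1) \<noteq> 0" if "m \<noteq> 0"
      using C[of n m] that unfolding vs[OF that] fS fQ[OF that] by auto
    have t1: "2 * of_nat n * (z (int n + 1,0,- int m) - z (int n,0,- int m)) * (z (int n,0,- int m) - z (int n - 1,0,- int m))
         / (z (int n + 1,0,- int m) - z (int n - 1,0,- int m))
        = 2 * of_nat n * hedge f n m * hedge f (n-1) m / (hedge f n m + hedge f (n-1) m)"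
    proof (cases "n = 0")
      case False
      then have "hedge f (n-1) m = f n m - f (n-1) m" by (cases n) (simp_all add: hedge_def)
      then show ?thesis unfolding hs[OF False] fS fP[OF False] by (simp add: hedge_def)
    qed simp
    have t2: "2 * (- of_nat m) * (z (int n,0,- int m + 1) - z (int n,0,- int m)) * (z (int n,0,- int m) - z (int n,0,- int m - 1))
         / (z (int n,0,- int m + 1) - z (int n,0,- int m - 1))
        = 2 * of_nat m * vedge f n m * vedge f n (m-1) / (vedge f n m + vedge f n (m-1))"
    proof (cases "m = 0")
      case False
      have v: "f n (m-1) - f n m = - vedge f n (m-1)" using False by (cases m) (simp_all add: vedge_def)
      have v': "f n m - f n (Suc m) = - vedge f n m" by (simp add: vedge_def)
      have v'': "f n (m-1) - f n (Suc m) = - (vedge f n m + vedge f n (m-1))" unfolding vs[OF False] by simp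
      \<comment> \<open>Reversing the coordinate changes the sign of the coefficient, of both edges
        and of the denominator; the four signs cancel.\<close>
      have "2 * - k * - x * - y / - S = 2 * k * y * x / S" for k x y S :: complex
        by (simp add: mult_ac)
      then show ?thesis unfolding fS fQ[OF False] v v' v'' .
    qed simp
    have "of_real c * z (int n,0,- int m) =
          2 * of_nat n * (z (int n + 1,0,- int m) - z (int n,0,- int m)) * (z (int n,0,- int m) - z (int n - 1,0,- int m))
              / (z (int n + 1,0,- int m) - z (int n - 1,0,- int m))
        + 2 * (- of_nat m) * (z (int n,0,- int m + 1) - z (int n,0,- int m)) * (z (int n,0,- int m) - z (int n,0,- int m - 1))
              / (z (int n,0,- int m + 1) - z (int n,0,- int m - 1))"
      using C[of n m] by simp
    then show "of_real c * f n m = 2 * of_nat n * hedge f n m * hedge f (n-1) m / (hedge f n m + hedge f (n-1) m)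
       + 2 * of_nat m * vedge f n m * vedge f n (m-1) / (vedge f n m + vedge f n (m-1))"
      unfolding t1 t2 unfolding fS .
    show "f (Suc 0) 0 = 1" using z by (simp add: is_Zc_def f_def)
    show "f 0 (Suc 0) = cis (c * a)" using z by (simp add: is_Zc_def f_def cis_conv_exp)
  qed (use a c in auto)
  then show ?thesis unfolding f_def .
qed

text \<open>The radius equation is symmetric in the two coordinates, so the half above the diagonal
  follows by reflection.\<close>

lemma (in discrete_power) r_pos:
  assumes "even (n + m)"
  shows "r n m > 0"
proof (cases "m \<le> n")
  case True
  show ?thesis
    by (rule radius_propagation[OF s radius_eq(1,2) diag_pos assms True])
next
  case False
  have "(\<lambda>n m. r m n) m n > 0"
  proof (rule radius_propagation[where r="\<lambda>n m. r m n" and n=m and m=n, OF s])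
    fix n m :: nat assume o: "odd (n + m)"
    then have o': "odd (m + n)" by simp
    show "real n * r m (Suc n) / (r m (Suc n) + r m (n - 1)) + real m * r (Suc m) n / (r (Suc m) n + r (m - 1) n)
        = s + (real (n + m) - 1) / 2"
      using radius_eq(1)[OF o'] by (simp add: add.commute)
    show "r m (Suc n) + r m (n - 1) \<noteq> 0" if "n \<noteq> 0" using radius_eq(3)[OF o'] that by simp
  qed (use False assms diag_pos in auto)
  then show ?thesis .
qed

lemma (in discrete_power) is_circle_pattern: "circle_pattern a f u r True"
proof
  fix n m :: nat
  show "f (Suc n) m - f n m = u n m * u (Suc n) m" using d_eq[of n m] by (simp add: hedge_def)
  show "f n (Suc m) - f n m = cis a * u n m * u n (Suc m)" using e_eq[of n m] by (simp add: vedge_def b_def)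
  show "u n m = of_real (r n m) \<and> 0 < r n m" if "even (n + m)" using u_even r_pos that by blast
qed (use a u_odd in auto)

lemma immersion_byI:
  assumes "\<And>n m. Qd (int n) (- int m) \<inter> Qd (int (Suc n)) (- int m) = {}"
    and "\<And>n m. Qd (int n) (- int m) \<inter> Qd (int n) (- int (Suc m)) = {}"
  shows "immersion_by Qd"
  unfolding immersion_by_def
proof (intro allI impI)
  fix k m :: int assume km: "0 \<le> k \<and> m \<le> 0"
  define i j where "i = nat k" "j = nat (- m)"
  have "k = int i" "m = - int j" "k + 1 = int (Suc i)" "m - 1 = - int (Suc j)" using km by (simp_all add: i_j_def)
  then show "Qd k m \<inter> Qd (k+1) m = {} \<and> Qd k m \<inter> Qd k (m-1) = {}" using assms by metis
qed

lemma grid_quad_nat: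
  "grid_quad (grid z) (int n) (- int m) = quad_interior (z (int n, 0, - int m)) (z (int (Suc n), 0, - int m))
     (z (int (Suc n), 0, - int (Suc m))) (z (int n, 0, - int (Suc m)))"
proof -
  have "int n + 1 = int (Suc n)" "- int m - 1 = - int (Suc m)" by simp_all
  then show ?thesis by (simp only: grid_quad_def grid_def)
qed

lemma Zc_immersion:
  assumes "is_Zc a1 a2 a c z" "0 < a" "a < pi" "0 < c" "c < 2"
  shows "sq_immersion (grid z)"
proof -
  interpret discrete_power a c "\<lambda>n m. z (int n, 0, - int m)" using assms by (rule Zc_discrete_power)
  interpret circle_pattern a "\<lambda>n m. z (int n, 0, - int m)" u r True by (rule is_circle_pattern)
  have Quad: "grid_quad (grid z) (int n) (- int m) = Quad n m" for n m
    unfolding grid_quad_nat Quad_def ..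
  show ?thesis unfolding sq_immersion_def
    by (rule immersion_byI) (unfold Quad, use Quad_disjoint in auto)
qed

section \<open>Passage to c = 2\<close>

lemma norm_cis_diff_le: "norm (cis x - cis y) \<le> \<bar>x - y\<bar>"
proof -
  have "cis x - cis y = cis y * (exp (\<i> * of_real (x - y)) - 1)"
    by (simp add: cis_conv_exp ring_distribs flip: exp_add)
  then have "norm (cis x - cis y) = norm (exp (\<i> * of_real (x - y)) - 1)" by (simp only: norm_mult norm_cis mult_1)
  also have "\<dots> = 2 * \<bar>sin ((x - y) / 2)\<bar>" by (rule dist_exp_i_1)
  also have "\<dots> \<le> 2 * \<bar>(x - y) / 2\<bar>" by (intro mult_left_mono abs_sin_x_le_abs_x) simp
  finally show ?thesis by simp
qed

text \<open>The first quadrilateral can be solved explicitly. The factor on the left is at most (2 -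
  c) a, so as c tends to 2 the radius grows at least like 1 / (2 - c) and stays positive after the
  rescaling.\<close>

lemma (in discrete_power) r_corner: "norm (cis (2 * a) - cis (c * a)) * r (Suc 0) (Suc 0) = norm (cis (c * a) - 1)"
proof -
  let ?k = "cis (c * a)"
  have d0: "d 0 0 = 1" and e0: "e 0 0 = ?k" by (simp_all add: hedge_def vedge_def f10 f01)
  have "b\<^sup>2 * d 0 (Suc 0) = ?k * e (Suc 0) 0" using quad[of 0 0] d0 e0 by simp
  moreover have "1 + e (Suc 0) 0 = ?k + d 0 (Suc 0)" using closure[of 0 0] d0 e0 by simp
  ultimately have "(b\<^sup>2 - ?k) * e (Suc 0) 0 = b\<^sup>2 * (?k - 1)" by algebra
  then have "norm (b\<^sup>2 - ?k) * norm (e (Suc 0) 0) = norm (b\<^sup>2) * norm (?k - 1)" by (metis norm_mult)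
  moreover have "norm (e (Suc 0) 0) = r (Suc 0) (Suc 0)"
    using u_odd[of "Suc 0" 0] u_even[of "Suc 0" "Suc 0"] r_pos[of "Suc 0" "Suc 0"] by (simp add: e_eq norm_mult)
  moreover have "b\<^sup>2 = cis (2 * a)" by (simp add: b_def power2_eq_square cis_mult)
  ultimately show ?thesis by (simp add: norm_power)
qed

text \<open>The reciprocal of the normalising factor (2 - c) / c: rescaled, these radii are 1 for
  every c.\<close>

lemma (in discrete_power) r_two: "r (Suc (Suc 0)) 0 = c / (2 - c)" "r 0 (Suc (Suc 0)) = c / (2 - c)"
proof -
  have r0: "r 0 0 = 1" by (simp add: r_def)
  have *: "x = c / (2 - c)" if "x / (x + 1) = c / 2" "x > 0" for x :: real
  proof -
    have "x = c / 2 * (x + 1)" using that by (simp add: divide_eq_eq)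
    then have "x * (2 - c) = c" by (simp add: algebra_simps)
    then show ?thesis using c by (simp add: eq_divide_eq)
  qed
  show "r (Suc (Suc 0)) 0 = c / (2 - c)"
    using radius_eq(1)[of "Suc 0" 0] r_pos[of "Suc (Suc 0)" 0] r0 by (intro *) (simp_all add: s_def)
  show "r 0 (Suc (Suc 0)) = c / (2 - c)"
    using radius_eq(1)[of 0 "Suc 0"] r_pos[of 0 "Suc (Suc 0)"] r0 by (intro *) (simp_all add: s_def)
qed

lemma Z2_pattern:
  assumes z: "is_Z2 a1 a2 a z" and a: "0 < a" "a < pi"
  defines "F \<equiv> \<lambda>n m. z (int n, 0, - int m)"
  obtains u R where "circle_pattern a F u R False" "u (Suc 0) 0 = 1" "u 0 (Suc 0) = cis a"
    "F 0 0 = 0" "F (Suc 0) 0 = 0" "F 0 (Suc 0) = 0"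
proof -
  obtain Zf where Zf: "\<And>c. 0 < c \<Longrightarrow> c < 2 \<Longrightarrow> is_Zc a1 a2 a c (Zf c)"
    and Zl: "\<And>p. inQ p \<Longrightarrow> ((\<lambda>c. of_real ((2 - c) / c) * Zf c p) \<longlongrightarrow> z p) (at_left 2)"
    using z unfolding is_Z2_def by blast
  define f where "f c n m = Zf c (int n, 0, - int m)" for c n m
  define k where "k c = (2 - c) / c" for c :: real
  define u where u_eq: "u c = discrete_power.u a (f c)" for c
  define r where r_eq: "r c = discrete_power.r a (f c)" for c
  have DP: "discrete_power a c (f c)" if "0 < c" "c < 2" for c
    unfolding f_def using Zc_discrete_power[OF Zf[OF that] a that] .
  have hd: "f c (Suc n) m - f c n m = u c n m * u c (Suc n) m"
    and ve: "f c n (Suc m) - f c n m = cis a * u c n m * u c n (Suc m)"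
    and uo: "odd (n + m) \<Longrightarrow> norm (u c n m) = 1"
    and ue: "even (n + m) \<Longrightarrow> u c n m = of_real (r c n m)"
    and rp: "even (n + m) \<Longrightarrow> r c n m > 0"
    if c: "0 < c" "c < 2" for c n m
  proof -
    interpret discrete_power a c "f c" by (rule DP[OF c])
    interpret cp: circle_pattern a "f c" "u c" "r c" True
      using is_circle_pattern unfolding u_eq r_eq .
    show "f c (Suc n) m - f c n m = u c n m * u c (Suc n) m"
      "f c n (Suc m) - f c n m = cis a * u c n m * u c n (Suc m)"
      using cp.hor cp.ver by auto
    show "odd (n + m) \<Longrightarrow> norm (u c n m) = 1" by (rule cp.odd)
    show "even (n + m) \<Longrightarrow> u c n m = of_real (r c n m)" "even (n + m) \<Longrightarrow> r c n m > 0"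
      using cp.even by auto
  qed
  have req: "real n * r c (Suc n) m / (r c (Suc n) m + r c (n-1) m)
       + real m * r c n (Suc m) / (r c n (Suc m) + r c n (m-1)) = c / 2 + (real (n + m) - 1) / 2"
    if "0 < c" "c < 2" "odd (n + m)" for c n m
    using discrete_power.radius_eq(1)[OF DP[OF that(1,2)] that(3)]
    unfolding r_eq discrete_power.s_def[OF DP[OF that(1,2)]] .
  have ev: "\<forall>\<^sub>F c in at_left 2. 0 < c \<and> c < (2::real)"
    using eventually_at_left_real[of 0 "2::real"] by simp
  have clim: "((\<lambda>c::real. c) \<longlongrightarrow> 2) (at_left 2)" by (rule tendsto_ident_at)
  have nt: "at_left (2::real) \<noteq> bot" by simp
  have "((\<lambda>c::real. (2 - c) / c) \<longlongrightarrow> (2 - 2) / 2) (at_left 2)" by (intro tendsto_intros clim) simp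
  then have k0: "(k \<longlongrightarrow> 0) (at_left 2)" by (simp add: k_def[abs_def])
  have kpos: "k c > 0" if "0 < c" "c < 2" for c using that by (simp add: k_def)
  have fl: "((\<lambda>c. of_real (k c) * f c n m) \<longlongrightarrow> F n m) (at_left 2)" for n m
    unfolding k_def f_def F_def by (rule Zl) (simp add: inQ_def)
  have dl: "((\<lambda>c. of_real (k c) * (f c (Suc n) m - f c n m)) \<longlongrightarrow> F (Suc n) m - F n m) (at_left 2)"
    and el: "((\<lambda>c. of_real (k c) * (f c n (Suc m) - f c n m)) \<longlongrightarrow> F n (Suc m) - F n m) (at_left 2)" for n m
    unfolding right_diff_distrib by (intro tendsto_diff fl)+
  \<comment> \<open>At an even vertex the horizontal edge has the length of the radius. This defines
    the limit radii from the limit points alone.\<close>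
  define R where "R n m = norm (F (Suc n) m - F n m)" for n m
  have Rl: "((\<lambda>c. k c * r c n m) \<longlongrightarrow> R n m) (at_left 2)" if e: "even (n + m)" for n m
  proof (rule Lim_transform_eventually)
    show "((\<lambda>c. norm (of_real (k c) * (f c (Suc n) m - f c n m))) \<longlongrightarrow> R n m) (at_left 2)"
      unfolding R_def by (intro tendsto_norm dl)
    show "\<forall>\<^sub>F c in at_left 2. norm (of_real (k c) * (f c (Suc n) m - f c n m)) = k c * r c n m"
      using ev
    proof eventually_elim
      fix c :: real assume "0 < c \<and> c < 2"
      then have c: "0 < c" "c < 2" by auto
      show "norm (of_real (k c) * (f c (Suc n) m - f c n m)) = k c * r c n m"
        using hd[OF c] ue[OF c e] rp[OF c e] uo[OF c, of "Suc n" m] e kpos[OF c]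
        by (simp add: norm_mult)
    qed
  qed
  have R2: "R (Suc (Suc 0)) 0 = 1" "R 0 (Suc (Suc 0)) = 1"
  proof -
    have "k c * r c (Suc (Suc 0)) 0 = 1" "k c * r c 0 (Suc (Suc 0)) = 1" if "0 < c \<and> c < 2" for c
      using discrete_power.r_two[OF DP] that by (simp_all add: k_def r_eq)
    then have "\<forall>\<^sub>F c in at_left 2. k c * r c (Suc (Suc 0)) 0 = 1"
      "\<forall>\<^sub>F c in at_left 2. k c * r c 0 (Suc (Suc 0)) = 1"
      by (auto intro: eventually_mono[OF ev])
    then have "((\<lambda>c. k c * r c (Suc (Suc 0)) 0) \<longlongrightarrow> 1) (at_left 2)" "((\<lambda>c. k c * r c 0 (Suc (Suc 0))) \<longlongrightarrow> 1) (at_left 2)"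
      by (auto intro: tendsto_eventually)
    then show "R (Suc (Suc 0)) 0 = 1" "R 0 (Suc (Suc 0)) = 1"
      using tendsto_unique[OF nt Rl] by auto
  qed
  have R11: "R (Suc 0) (Suc 0) > 0"
  proof -
    have cl: "((\<lambda>c. cis (c * a)) \<longlongrightarrow> cis (2 * a)) (at_left 2)"
      unfolding cis_conv_exp by (intro tendsto_intros clim)
    have "norm (cis (2 * a) - 1) / (2 * a) \<le> R (Suc 0) (Suc 0)"
    proof (rule tendsto_le[OF nt])
      show "((\<lambda>c. k c * r c (Suc 0) (Suc 0)) \<longlongrightarrow> R (Suc 0) (Suc 0)) (at_left 2)" by (rule Rl) simp
      show "((\<lambda>c. norm (cis (c * a) - 1) / (c * a)) \<longlongrightarrow> norm (cis (2 * a) - 1) / (2 * a)) (at_left 2)"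
        using a by (intro tendsto_intros clim cl) auto
      show "\<forall>\<^sub>F c in at_left 2. norm (cis (c * a) - 1) / (c * a) \<le> k c * r c (Suc 0) (Suc 0)"
        using ev
      proof eventually_elim
        fix c :: real assume "0 < c \<and> c < 2"
        then have c: "0 < c" "c < 2" by auto
        have r: "r c (Suc 0) (Suc 0) > 0" by (rule rp[OF c]) simp
        have "norm (cis (c * a) - 1) = norm (cis (2 * a) - cis (c * a)) * r c (Suc 0) (Suc 0)"
          using discrete_power.r_corner[OF DP[OF c]] by (simp add: r_eq)
        also have "\<dots> \<le> \<bar>2 * a - c * a\<bar> * r c (Suc 0) (Suc 0)"
          using r norm_cis_diff_le by (intro mult_right_mono) auto
        also have "\<bar>2 * a - c * a\<bar> = (2 - c) * a" using a c by (simp add: left_diff_distrib)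
        finally have "norm (cis (c * a) - 1) / (c * a) \<le> (2 - c) * a * r c (Suc 0) (Suc 0) / (c * a)"
          using a c by (intro divide_right_mono) auto
        also have "\<dots> = k c * r c (Suc 0) (Suc 0)" using a c by (simp add: k_def)
        finally show "norm (cis (c * a) - 1) / (c * a) \<le> k c * r c (Suc 0) (Suc 0)" .
      qed
    qed
    moreover have "cis (2 * a) \<noteq> 1"
      using discrete_power.b2_neq_1[OF DP[of 1]] discrete_power.b_def[OF DP[of 1]]
      by (simp add: power2_eq_square cis_mult)
    then have "norm (cis (2 * a) - 1) / (2 * a) > 0" using a by simp
    ultimately show ?thesis by linarith
  qed
  have Rpos: "R n m > 0" if e: "even (n + m)" "n + m \<noteq> 0" for n m
  proof (cases "m \<le> n")
    case True
    show ?thesis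
      by (rule limit_radii_pos[where \<kappa>=k and r=r, OF Rl _ _ _ _ R11 e(1) True e(2)])
         (use rp kpos req R2 in auto)
  next
    case False
    have "(\<lambda>n m. R m n) m n > 0"
    proof (rule limit_radii_pos[where \<kappa>=k and r="\<lambda>c n m. r c m n" and R="\<lambda>n m. R m n" and n=m and m=n])
      show "((\<lambda>c. k c * r c m n) \<longlongrightarrow> R m n) (at_left 2)" if "even (n + m)" for n m
        using Rl[of m n] that by (simp add: add.commute)
      show "real n * r c m (Suc n) / (r c m (Suc n) + r c m (n - 1)) +
          real m * r c (Suc m) n / (r c (Suc m) n + r c (m - 1) n) = c / 2 + (real (n + m) - 1) / 2"
        if "1 < c" "c < 2" "odd (n + m)" for c n m
        using req[of c m n] that by (simp add: add.commute)
    qed (use rp kpos R2 R11 e False in \<open>auto simp: add.commute\<close>)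
    then show ?thesis .
  qed
  \<comment> \<open>At odd vertices \<open>u\<close> is recovered from the edge to the right by
    division by a limit radius, which \<open>Rpos\<close> shows to be nonzero.\<close>
  define U where "U n m = (if even (n + m) then of_real (R n m) else (F (Suc n) m - F n m) / of_real (R (Suc n) m))" for n m
  have Ue: "((\<lambda>c. of_real (k c) * u c n m) \<longlongrightarrow> U n m) (at_left 2)" if e: "even (n + m)" for n m
  proof (rule Lim_transform_eventually)
    show "((\<lambda>c. complex_of_real (k c * r c n m)) \<longlongrightarrow> U n m) (at_left 2)"
      using Rl[OF e] e by (simp only: U_def if_True tendsto_of_real)
    show "\<forall>\<^sub>F c in at_left 2. complex_of_real (k c * r c n m) = of_real (k c) * u c n m"
      using ev by eventually_elim (use ue e in auto)
  qed
  have Uo: "((\<lambda>c. u c n m) \<longlongrightarrow> U n m) (at_left 2)" if o: "odd (n + m)" for n m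
  proof (rule Lim_transform_eventually)
    have e: "even (Suc n + m)" using o by simp
    have pos: "R (Suc n) m > 0" using Rpos[of "Suc n" m] o by simp
    have "((\<lambda>c. of_real (k c) * (f c (Suc n) m - f c n m) / of_real (k c * r c (Suc n) m)) \<longlongrightarrow>
       (F (Suc n) m - F n m) / of_real (R (Suc n) m)) (at_left 2)"
      using pos by (intro tendsto_divide dl tendsto_of_real Rl e) auto
    then show "((\<lambda>c. of_real (k c) * (f c (Suc n) m - f c n m) / of_real (k c * r c (Suc n) m)) \<longlongrightarrow> U n m) (at_left 2)"
      using o by (simp only: U_def if_False)
    show "\<forall>\<^sub>F c in at_left 2. of_real (k c) * (f c (Suc n) m - f c n m) / of_real (k c * r c (Suc n) m) = u c n m"
      using ev
    proof eventually_elim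
      fix c :: real assume "0 < c \<and> c < 2"
      then have c: "0 < c" "c < 2" by auto
      have "k c \<noteq> 0" "r c (Suc n) m \<noteq> 0" using kpos[OF c] rp[OF c e] by auto
      then show "of_real (k c) * (f c (Suc n) m - f c n m) / of_real (k c * r c (Suc n) m) = u c n m"
        unfolding hd[OF c] ue[OF c e] by simp
    qed
  qed
  \<comment> \<open>Of two neighbouring values of \<open>u\<close> exactly one is a radius; the
    scaling factor is assigned to it.\<close>
  have prod: "((\<lambda>c. of_real (k c) * (u c n m * u c n' m')) \<longlongrightarrow> U n m * U n' m') (at_left 2)"
    if "even (n + m) \<noteq> even (n' + m')" for n m n' m'
  proof (cases "even (n + m)")
    case True
    then have "((\<lambda>c. of_real (k c) * u c n m * u c n' m') \<longlongrightarrow> U n m * U n' m') (at_left 2)"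
      using that by (intro tendsto_mult Ue Uo) auto
    then show ?thesis by (simp only: mult.assoc)
  next
    case False
    then have "((\<lambda>c. u c n m * (of_real (k c) * u c n' m')) \<longlongrightarrow> U n m * U n' m') (at_left 2)"
      using that by (intro tendsto_mult Ue Uo) auto
    then show ?thesis by (simp only: mult.left_commute)
  qed
  have hor: "F (Suc n) m - F n m = U n m * U (Suc n) m" for n m
  proof (rule tendsto_unique[OF nt dl])
    show "((\<lambda>c. of_real (k c) * (f c (Suc n) m - f c n m)) \<longlongrightarrow> U n m * U (Suc n) m) (at_left 2)"
    proof (rule Lim_transform_eventually)
      show "((\<lambda>c. of_real (k c) * (u c n m * u c (Suc n) m)) \<longlongrightarrow> U n m * U (Suc n) m) (at_left 2)"
        by (rule prod) simp
      show "\<forall>\<^sub>F c in at_left 2. of_real (k c) * (u c n m * u c (Suc n) m) = of_real (k c) * (f c (Suc n) m - f c n m)"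
        using ev by eventually_elim (use hd in simp)
    qed
  qed
  have ver: "F n (Suc m) - F n m = cis a * U n m * U n (Suc m)" for n m
  proof (rule tendsto_unique[OF nt el])
    show "((\<lambda>c. of_real (k c) * (f c n (Suc m) - f c n m)) \<longlongrightarrow> cis a * U n m * U n (Suc m)) (at_left 2)"
    proof (rule Lim_transform_eventually)
      have "((\<lambda>c. cis a * (of_real (k c) * (u c n m * u c n (Suc m)))) \<longlongrightarrow> cis a * (U n m * U n (Suc m))) (at_left 2)"
        by (intro tendsto_mult tendsto_const prod) simp
      then show "((\<lambda>c. cis a * (of_real (k c) * (u c n m * u c n (Suc m)))) \<longlongrightarrow> cis a * U n m * U n (Suc m)) (at_left 2)"
        by (simp only: mult.assoc)
      show "\<forall>\<^sub>F c in at_left 2. cis a * (of_real (k c) * (u c n m * u c n (Suc m))) = of_real (k c) * (f c n (Suc m) - f c n m)"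
        using ev by eventually_elim (use ve in simp)
    qed
  qed
  have CP: "circle_pattern a F U R False"
  proof
    fix n m :: nat
    show "norm (U n m) = 1" if o: "odd (n + m)"
    proof (rule tendsto_unique[OF nt])
      show "((\<lambda>c. norm (u c n m)) \<longlongrightarrow> norm (U n m)) (at_left 2)" by (intro tendsto_norm Uo o)
      show "((\<lambda>c. norm (u c n m)) \<longlongrightarrow> 1) (at_left 2)"
        by (rule tendsto_eventually) (use ev in eventually_elim, use uo o in auto)
    qed
    show "U n m = of_real (R n m) \<and> 0 < R n m" if "even (n + m)" "False \<or> n + m \<noteq> 0"
      using that Rpos by (simp add: U_def)
  qed (use a hor ver in auto)
  have uf: "u c (Suc 0) 0 = 1" "u c 0 (Suc 0) = cis ((c - 1) * a)" if "0 < c" "c < 2" for c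
    using discrete_power.u_first[OF DP[OF that]] by (simp_all add: u_eq)
  have "U (Suc 0) 0 = 1"
    by (rule tendsto_unique[OF nt Uo tendsto_eventually]) (simp, use ev in eventually_elim, use uf in auto)
  moreover have "U 0 (Suc 0) = cis a"
  proof (rule tendsto_unique[OF nt Uo])
    show "((\<lambda>c. u c 0 (Suc 0)) \<longlongrightarrow> cis a) (at_left 2)"
    proof (rule Lim_transform_eventually)
      have "((\<lambda>c. cis ((c - 1) * a)) \<longlongrightarrow> cis ((2 - 1) * a)) (at_left 2)"
        unfolding cis_conv_exp by (intro tendsto_intros clim)
      then show "((\<lambda>c. cis ((c - 1) * a)) \<longlongrightarrow> cis a) (at_left 2)" by simp
      show "\<forall>\<^sub>F c in at_left 2. cis ((c - 1) * a) = u c 0 (Suc 0)"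
        using ev by eventually_elim (use uf in auto)
    qed
  qed simp
  \<comment> \<open>Points that stay bounded are contracted to 0 by the scaling. This applies to
    three corners of the first quadrilateral, which thus becomes a segment with empty
    interior.\<close>
  moreover have F0: "F n m = 0" if "\<And>c. 0 < c \<Longrightarrow> c < 2 \<Longrightarrow> norm (f c n m) \<le> 1" for n m
  proof (rule tendsto_unique[OF nt fl])
    show "((\<lambda>c. of_real (k c) * f c n m) \<longlongrightarrow> 0) (at_left 2)"
    proof (rule Lim_null_comparison[OF _ k0])
      show "\<forall>\<^sub>F c in at_left 2. norm (of_real (k c) * f c n m) \<le> k c"
        using ev
      proof eventually_elim
        fix c :: real assume "0 < c \<and> c < 2"
        then have c: "0 < c" "c < 2" by auto
        show "norm (of_real (k c) * f c n m) \<le> k c"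
          using mult_left_mono[OF that[OF c], of "k c"] kpos[OF c] by (simp add: norm_mult)
      qed
    qed
  qed
  have "F 0 0 = 0" "F (Suc 0) 0 = 0" "F 0 (Suc 0) = 0"
    by (rule F0, use discrete_power.f00[OF DP] discrete_power.f10[OF DP] discrete_power.f01[OF DP] in simp)+
  ultimately show thesis using that[OF CP] by blast
qed

lemma degenerate_quad: "quad_interior x x y x = {}"
proof -
  define g where "g = linepath x x +++ linepath x y +++ linepath y x +++ linepath x x"
  have im: "path_image g = closed_segment x y"
    by (auto simp: g_def path_image_join closed_segment_commute)
  have "winding_number g p = 0" if "p \<notin> path_image g" for p
    by (rule winding_number_zero_outside[of g "closed_segment x y"]) (use that in \<open>auto simp: im\<close>, simp_all add: g_def)
  then show ?thesis by (auto simp: quad_interior_def g_def Let_def)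
qed

lemma Z2_immersion:
  assumes "is_Z2 a1 a2 a z" "0 < a" "a < pi"
  shows "sq_immersion (grid z)"
proof -
  define F where "F n m = z (int n, 0, - int m)" for n m
  obtain u R where "circle_pattern a F u R False" and F0: "F 0 0 = 0" "F (Suc 0) 0 = 0" "F 0 (Suc 0) = 0"
    using Z2_pattern[OF assms] unfolding F_def[abs_def] by blast
  then interpret circle_pattern a F u R False by simp
  have Quad: "grid_quad (grid z) (int n) (- int m) = Quad n m" for n m
    unfolding grid_quad_nat Quad_def F_def ..
  have "Quad 0 0 = {}" unfolding Quad_def F0 by (rule degenerate_quad)
  then have "Quad n m \<inter> Quad (Suc n) m = {}" "Quad n m \<inter> Quad n (Suc m) = {}" for n m
    using Quad_disjoint[of n m] by (cases "n + m = 0", auto)+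
  then show ?thesis unfolding sq_immersion_def
    by (intro immersion_byI) (unfold Quad)
qed

section \<open>The dual pattern \<open>Log\<close>\<close>

lemma Log_immersion:
  assumes "is_Log a1 a2 a w" "0 < a" "a < pi"
  shows "sq_immersion_Log (grid w)"
proof -
  obtain z where z: "is_Z2 a1 a2 a z"
    and w: "\<And>p e. inQ p \<Longrightarrow> e \<in> {(1,0,0), (0,1,0), (0,0,1)} \<Longrightarrow> inQ (p + e) \<Longrightarrow> p \<noteq> (0,0,0) \<Longrightarrow> p + e \<noteq> (0,0,0) \<Longrightarrow>
        w (p + e) - w p = edge_label a1 a2 a e / (z (p + e) - z p)"
    using assms(1) unfolding is_Log_def by blast
  define F where "F n m = z (int n, 0, - int m)" for n m
  define f where "f n m = w (int n, 0, - int m)" for n m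
  obtain u R where "circle_pattern a F u R False" and u1: "u (Suc 0) 0 = 1" "u 0 (Suc 0) = cis a"
    using Z2_pattern[OF z assms(2,3)] unfolding F_def[abs_def] by blast
  then interpret Z: circle_pattern a F u R False by simp
  have pair: "(int n, 0, - int m) + (1, 0, 0) = (int (Suc n), 0::int, - int m)"
    "(int n, 0, - int (Suc m)) + (0, 0, 1) = (int n, 0::int, - int m)" for n m :: nat
    by (simp_all add: plus_prod_def)
  \<comment> \<open>The label exp (2 i a) of the edges in the third direction turns the factor
    \<open>cis a\<close> in the denominator into \<open>cis a\<close> in the numerator, so the
    inverted \<open>u\<close> solves the same equations with the same angle.\<close>
  interpret circle_pattern a f "\<lambda>n m. inverse (u n m)" "\<lambda>n m. 1 / R n m" False
  proof
    fix n m :: nat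
    show "0 < a" "a < pi" using assms by auto
    show "f (Suc n) m - f n m = inverse (u n m) * inverse (u (Suc n) m)" if nm: "False \<or> n + m \<noteq> 0"
    proof -
      have "w (int (Suc n), 0, - int m) - w (int n, 0, - int m)
          = edge_label a1 a2 a (1,0,0) / (z (int (Suc n), 0, - int m) - z (int n, 0, - int m))"
        using w[of "(int n, 0, - int m)" "(1,0,0)", unfolded pair] nm by (simp add: inQ_def)
      also have "\<dots> = 1 / (F (Suc n) m - F n m)" by (simp only: F_def edge_label_def simp_thms if_True)
      finally show ?thesis unfolding Z.hor[OF nm] f_def by (simp add: divide_inverse)
    qed
    show "f n (Suc m) - f n m = cis a * inverse (u n m) * inverse (u n (Suc m))" if nm: "False \<or> n + m \<noteq> 0"
    proof -
      have "w (int n, 0, - int m) - w (int n, 0, - int (Suc m))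
          = edge_label a1 a2 a (0,0,1) / (z (int n, 0, - int m) - z (int n, 0, - int (Suc m)))"
        using w[of "(int n, 0, - int (Suc m))" "(0,0,1)", unfolded pair] nm by (simp add: inQ_def)
      also have "edge_label a1 a2 a (0,0,1) = cis a * cis a"
        by (simp add: edge_label_def cis_conv_exp mult.assoc flip: exp_add)
      finally have "f n m - f n (Suc m) = cis a * cis a / (F n m - F n (Suc m))" by (simp only: F_def f_def)
      then have "f n (Suc m) - f n m = cis a * cis a / (F n (Suc m) - F n m)"
        by (metis minus_diff_eq minus_divide_right)
      moreover have "cis a * cis (- a) = 1" by (simp add: cis_mult)
      ultimately show ?thesis unfolding Z.ver[OF nm] by (simp add: divide_inverse)
    qed
    show "norm (inverse (u n m)) = 1" if "odd (n + m)" using Z.odd[OF that] by (simp add: norm_inverse)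
    show "inverse (u n m) = of_real (1 / R n m) \<and> 0 < 1 / R n m" if "even (n + m)" "False \<or> n + m \<noteq> 0"
      using Z.even[OF that] by (simp add: inverse_eq_divide)
  qed
  define Qd where "Qd k m = (if k = 0 \<and> m = 0
                          then quad_interior_inf (-1) (grid w 1 0) (grid w 1 (-1)) (grid w 0 (-1))
                          else grid_quad (grid w) k m)" for k m :: int
  have Qd: "Qd (int n) (- int m) = Quad n m" if "n + m \<noteq> 0" for n m
    using that unfolding Qd_def grid_quad_nat Quad_def f_def by auto
  let ?A = "f (Suc 0) (Suc 0)" and ?S = "f (Suc 0) 0" and ?W = "f 0 (Suc 0)"
  define \<rho> where "\<rho> = 1 / R (Suc 0) (Suc 0)"
  have \<rho>: "\<rho> > 0" "inverse (u (Suc 0) (Suc 0)) = of_real \<rho>"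
    using even[of "Suc 0" "Suc 0"] by (simp_all add: \<rho>_def)
  have S: "?S = ?A - of_real \<rho> * cis a"
    using ver[of "Suc 0" 0] u1 \<rho> by (simp add: algebra_simps)
  have W: "?W = ?A - of_real \<rho> * cis (- a)"
    using hor[of 0 "Suc 0"] u1 \<rho> by (simp add: algebra_simps)
  have Q0: "Qd 0 0 = quad_interior_inf (-1) ?S ?A ?W" by (simp add: Qd_def f_def grid_def)
  \<comment> \<open>The circle opposite to \<open>?A\<close> has degenerated, so the half angle at
    \<open>?A\<close> is exactly a instead of less than a. There is still room, because the adjacent
    kites have half angles below pi - a.\<close>
  have inf: "Qd 0 0 \<subseteq> sector ?A (pi - a) (pi + a)"
    unfolding Q0 by (rule quad_interior_inf_in_sector[OF assms(2,3) \<rho>(1) S W])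
  have pi: "0 < pi - a" "pi - a < pi" using assms by auto
  have cis_pi: "- cis x = cis (pi + x)" for x by (simp add: complex_eq_iff)
  have right: "Qd 0 0 \<inter> Quad (Suc 0) 0 = {}"
  proof -
    have "even (Suc 0 + Suc 0)" by simp
    note K = kite_SE[OF this]
    obtain \<theta> where \<theta>: "0 < \<theta>" "\<theta> < pi - a"
      "\<And>r \<phi>. r > 0 \<Longrightarrow> ?S = ?A + of_real r * cis \<phi> \<Longrightarrow>
       closed_segment ?S (f (Suc (Suc 0)) 0) \<union> closed_segment (f (Suc (Suc 0)) 0) (f (Suc (Suc 0)) (Suc 0)) \<subseteq>
       closed_segment ?A ?S \<union> closed_segment ?A (f (Suc (Suc 0)) (Suc 0)) \<union> sector ?A \<phi> (\<phi> + 2 * \<theta>)"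
      by (rule kite_sector[OF K pi]) (rule that)
    have "?S = ?A + of_real \<rho> * cis (pi + a)" using S unfolding cis_pi[symmetric] by simp
    from \<theta>(3)[OF \<rho>(1) this] have "Quad (Suc 0) 0 \<subseteq> sector ?A (pi + a) (pi + a + 2 * \<theta>)"
      unfolding Quad_def by (intro quad_interior_in_sector[rotated]) (assumption, metis boundary_rotate boundary_reverse)
    moreover have "sector ?A (pi - a) (pi + a) \<inter> sector ?A (pi + a) (pi + a + 2 * \<theta>) = {}"
      by (rule sector_disjoint) (use \<theta> in linarith)
    ultimately show ?thesis using inf by blast
  qed
  have left: "Qd 0 0 \<inter> Quad 0 (Suc 0) = {}"
  proof -
    have "even (Suc 0 + Suc 0)" by simp
    note K = kite_NW[OF this]
    let ?N = "f (Suc 0) (Suc (Suc 0))" and ?B = "f 0 (Suc (Suc 0))"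
    obtain \<theta> where \<theta>: "0 < \<theta>" "\<theta> < pi - a" "?W - ?A = (?N - ?A) * cis (2 * \<theta>)"
      "\<And>r \<phi>. r > 0 \<Longrightarrow> ?N = ?A + of_real r * cis \<phi> \<Longrightarrow>
       closed_segment ?N ?B \<union> closed_segment ?B ?W \<subseteq>
       closed_segment ?A ?N \<union> closed_segment ?A ?W \<union> sector ?A \<phi> (\<phi> + 2 * \<theta>)"
      by (rule kite_sector[OF K pi]) (rule that)
    have "cis (pi - a) = - cis (- a)" using cis_pi[of "- a"] by simp
    then have W': "?W - ?A = of_real \<rho> * cis (pi - a)" using W by simp
    \<comment> \<open>Counterclockwise around \<open>?A\<close> this kite precedes the unbounded
      quadrilateral, so its sector is found by turning back from \<open>?W\<close>.\<close>
    have "?N - ?A = (?W - ?A) * cis (- (2 * \<theta>))" unfolding \<theta>(3) by (simp add: mult.assoc cis_mult)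
    also have "\<dots> = of_real \<rho> * cis (pi - a - 2 * \<theta>)" unfolding W' by (simp add: mult.assoc cis_mult)
    finally have "?N = ?A + of_real \<rho> * cis (pi - a - 2 * \<theta>)" by (simp add: algebra_simps)
    from \<theta>(4)[OF \<rho>(1) this] have "Quad 0 (Suc 0) \<subseteq> sector ?A (pi - a - 2 * \<theta>) (pi - a)"
      unfolding Quad_def diff_add_cancel by (intro quad_interior_in_sector[rotated]) (assumption, metis boundary_rotate boundary_reverse)
    moreover have "sector ?A (pi - a - 2 * \<theta>) (pi - a) \<inter> sector ?A (pi - a) (pi + a) = {}"
      by (rule sector_disjoint) (use \<theta> in linarith)
    ultimately show ?thesis using inf by blast
  qed
  have "immersion_by Qd"
  proof (rule immersion_byI)
    fix n m :: nat
    show "Qd (int n) (- int m) \<inter> Qd (int (Suc n)) (- int m) = {}"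
      using Quad_disjoint(1)[of n m] right Qd[of "Suc n" m] Qd[of n m] by (cases "n + m = 0") auto
    show "Qd (int n) (- int m) \<inter> Qd (int n) (- int (Suc m)) = {}"
      using Quad_disjoint(2)[of n m] left Qd[of n "Suc m"] Qd[of n m] by (cases "n + m = 0") auto
  qed
  then show ?thesis unfolding sq_immersion_Log_def Qd_def[abs_def] .
qed

theorem theorem6:
  fixes a1 a2 a3 :: real
  assumes "0 < a1" and "0 < a2" and "0 < a3" and "a1 + a2 + a3 = pi"
  shows "(\<forall>c z. 0 < c \<and> c < 2 \<and> is_Zc a1 a2 a3 c z \<longrightarrow> sq_immersion (grid z))
       \<and> (\<forall>z. is_Z2 a1 a2 a3 z \<longrightarrow> sq_immersion (grid z))
       \<and> (\<forall>w. is_Log a1 a2 a3 w \<longrightarrow> sq_immersion_Log (grid w))"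
proof -
  have "a3 < pi" using assms by linarith
  then show ?thesis using assms(3) Zc_immersion Z2_immersion Log_immersion by blast
qed

end
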